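(* Suppose $k \in \mathbb{N}$ and $\Gamma = (M; R)$ is a $k$-sparse graph in which all vertices have infinite valency. Suppose $G$ is a topological group which acts continuously (by automorphisms) on $\Gamma$. If $H \leq G$ is amenable, then $H$ has infinitely many orbits on $M^2$. In particular, there is a countable $\omega$-categorical structure $M$ such that $\mathrm{Aut}(M)$ has no co-precompact amenable subgroup.
   Context: Graphs are undirected, without loops or multiple edges. A graph $(M;R)$ is $k$-sparse if for every finite $B \subseteq M$ the number of edges of the induced subgraph on $B$ is at most $k|B|$. A topological group $G$ acts continuously by automorphisms on $\Gamma$ if it acts by graph automorphisms and the action $G \times M \to M$ is continuous with $M$ discrete, i.e. stabilizers of vertices are open in $G$. Subgroups carry the subspace topology; automorphism groups of countable structures carry the topology of pointwise convergence. A topological group $H$ is amenable if every $H$-flow (non-empty compact Hausdorff space with a continuous $H$-action) carries an $H$-invariant Borel probability measure. For a countable structure $M$, a subgroup $H \leq G = \mathrm{Aut}(M)$ is co-precompact in $G$ if for every $n \in \mathbb{N}$ every $G$-orbit on $M^n$ is a union of finitely many $H$-orbits. *)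

theory Defs
  imports "HOL-Probability.Probability" "HOL-Algebra.Group_Action"
begin

section \<open>Graphs\<close>

definition simple_graph :: "'v set \<Rightarrow> 'v set set \<Rightarrow> bool" where
  "simple_graph V E \<longleftrightarrow> (\<forall>e\<in>E. e \<subseteq> V \<and> card e = 2)"

definition k_sparse :: "nat \<Rightarrow> 'v set \<Rightarrow> 'v set set \<Rightarrow> bool" where
  "k_sparse k V E \<longleftrightarrow>
     (\<forall>B. B \<subseteq> V \<and> finite B \<longrightarrow> finite {e \<in> E. e \<subseteq> B} \<and> card {e \<in> E. e \<subseteq> B} \<le> k * card B)"

definition infinite_valency :: "'v set set \<Rightarrow> 'v \<Rightarrow> bool" where
  "infinite_valency E x \<longleftrightarrow> infinite {y. {x, y} \<in> E}"


section \<open>Topological groups and continuous actions\<close>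

definition topological_group :: "('g, 'b) monoid_scheme \<Rightarrow> 'g topology \<Rightarrow> bool" where
  "topological_group G T \<longleftrightarrow>
     group G \<and> topspace T = carrier G \<and>
     continuous_map (prod_topology T T) T (\<lambda>(x, y). x \<otimes>\<^bsub>G\<^esub> y) \<and>
     continuous_map T T (\<lambda>x. inv\<^bsub>G\<^esub> x)"

definition continuous_action ::
  "('g, 'b) monoid_scheme \<Rightarrow> 'g topology \<Rightarrow> 'x topology \<Rightarrow> ('g \<Rightarrow> 'x \<Rightarrow> 'x) \<Rightarrow> bool" where
  "continuous_action G T X act \<longleftrightarrow>
     group_action G (topspace X) act \<and>
     continuous_map (prod_topology T X) X (\<lambda>(g, x). act g x)"

definition acts_on_graph ::
  "('g, 'b) monoid_scheme \<Rightarrow> 'g topology \<Rightarrow> 'v set \<Rightarrow> 'v set set \<Rightarrow> ('g \<Rightarrow> 'v \<Rightarrow> 'v) \<Rightarrow> bool" where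
  "acts_on_graph G T V E act \<longleftrightarrow>
     continuous_action G T (discrete_topology V) act \<and>
     (\<forall>g\<in>carrier G. \<forall>x\<in>V. \<forall>y\<in>V. {act g x, act g y} \<in> E \<longleftrightarrow> {x, y} \<in> E)"

abbreviation subgroup_as_group :: "('g, 'b) monoid_scheme \<Rightarrow> 'g set \<Rightarrow> ('g, 'b) monoid_scheme" where
  "subgroup_as_group G H \<equiv> G\<lparr>carrier := H\<rparr>"

text \<open>The power \<open>V\<^sup>n\<close>, as lists, and the diagonal action on it.\<close>

definition tuples :: "'v set \<Rightarrow> nat \<Rightarrow> 'v list set" where
  "tuples V n = {xs. length xs = n \<and> set xs \<subseteq> V}"

definition diagonal :: "('g \<Rightarrow> 'v \<Rightarrow> 'v) \<Rightarrow> 'g \<Rightarrow> 'v list \<Rightarrow> 'v list" where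
  "diagonal act g = map (act g)"


section \<open>Amenability\<close>

definition flow ::
  "('g, 'b) monoid_scheme \<Rightarrow> 'g topology \<Rightarrow> 'x topology \<Rightarrow> ('g \<Rightarrow> 'x \<Rightarrow> 'x) \<Rightarrow> bool" where
  "flow G T X act \<longleftrightarrow>
     topspace X \<noteq> {} \<and> compact_space X \<and> Hausdorff_space X \<and> continuous_action G T X act"

definition invariant_borel_probability ::
  "('g, 'b) monoid_scheme \<Rightarrow> 'x topology \<Rightarrow> ('g \<Rightarrow> 'x \<Rightarrow> 'x) \<Rightarrow> 'x measure \<Rightarrow> bool" where
  "invariant_borel_probability G X act \<mu> \<longleftrightarrow>
     prob_space \<mu> \<and> space \<mu> = topspace X \<and>
     sets \<mu> = sigma_sets (topspace X) {U. openin X U} \<and>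
     (\<forall>g\<in>carrier G. distr \<mu> \<mu> (act g) = \<mu>)"

text \<open>
  HOL cannot quantify over all types inside a definition, so the flows range over the spaces
  with points in \<^typ>\<open>'g set set\<close>. Nothing is lost: every flow contains an orbit closure, which
  has a copy there, and invariant measures push forward along inclusions. Lemma
  \<open>amenable_flow\<close> below proves this for flows on an arbitrary type.
\<close>

definition amenable :: "('g, 'b) monoid_scheme \<Rightarrow> 'g topology \<Rightarrow> bool" where
  "amenable G T \<longleftrightarrow>
     (\<forall>(X :: 'g set set topology) act.
        flow G T X act \<longrightarrow> (\<exists>\<mu>. invariant_borel_probability G X act \<mu>))"

lemma amenable_flow:
  fixes G :: "('g, 'b) monoid_scheme" and X :: "'x topology"
  assumes tg: "topological_group G T" and am: "amenable G T" and fl: "flow G T X act"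
  shows "\<exists>\<mu>. invariant_borel_probability G X act \<mu>"
proof -
  interpret G: group G
    using tg by (simp add: topological_group_def)
  interpret A: group_action G "topspace X" act
    using fl by (simp add: flow_def continuous_action_def)
  have topT: "topspace T = carrier G"
    using tg by (simp add: topological_group_def)
  have cont: "continuous_map (prod_topology T X) X (\<lambda>(g, x). act g x)"
    and comp: "compact_space X" and haus: "Hausdorff_space X" and ne: "topspace X \<noteq> {}"
    using fl by (auto simp: flow_def continuous_action_def)
  have cont1: "continuous_map X X (act g)" if "g \<in> carrier G" for g
  proof -
    have "continuous_map X (prod_topology T X) (\<lambda>x. (g, x))"
      using that topT by (simp add: continuous_map_pairedI)
    from continuous_map_compose[OF this cont] show ?thesis
      by (simp add: o_def)
  qed
  obtain x0 where x0: "x0 \<in> topspace X"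
    using ne by blast
  define orb where "orb S = (\<lambda>g. act g x0) ` S" for S
  define Y where "Y = X closure_of (orb (carrier G))"
  have orb_sub: "orb S \<subseteq> topspace X" if "S \<subseteq> carrier G" for S
    using that x0 A.element_image by (auto simp: orb_def)
  have YX: "Y \<subseteq> topspace X"
    by (simp add: Y_def closure_of_subset_topspace)
  have orbY: "orb (carrier G) \<subseteq> Y"
    unfolding Y_def by (intro closure_of_subset orb_sub) simp
  have Yne: "Y \<noteq> {}"
    using orbY G.one_closed by (auto simp: orb_def)
  have Yinv: "act g y \<in> Y" if g: "g \<in> carrier G" and y: "y \<in> Y" for g y
  proof -
    have "act g ` orb (carrier G) \<subseteq> orb (carrier G)"
      using g x0 by (auto simp: orb_def A.composition_rule[symmetric])
    then have "X closure_of (act g ` orb (carrier G)) \<subseteq> Y"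
      unfolding Y_def by (rule closure_of_mono)
    with continuous_map_image_closure_subset[OF cont1[OF g], of "orb (carrier G)"] y
    show ?thesis unfolding Y_def by blast
  qed
  define \<iota> where "\<iota> x = {S. S \<subseteq> carrier G \<and> x \<in> X closure_of (orb S)}" for x
  have inj: "inj_on \<iota> Y"
  proof (rule inj_onI, rule ccontr)
    fix x y assume x: "x \<in> Y" and y: "y \<in> Y" and eq: "\<iota> x = \<iota> y" and "x \<noteq> y"
    then obtain U W where U: "openin X U" "openin X W" "x \<in> U" "y \<in> W" "disjnt U W"
      using haus YX unfolding Hausdorff_space_def by (metis subsetD)
    define S where "S = {g \<in> carrier G. act g x0 \<in> U}"
    have "x \<in> X closure_of (orb S)"
    proof -
      have "\<exists>z. z \<in> orb S \<and> z \<in> D" if D: "x \<in> D" "openin X D" for D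
      proof -
        have "openin X (D \<inter> U)" "x \<in> D \<inter> U"
          using D U by auto
        with x obtain z where "z \<in> orb (carrier G)" "z \<in> D \<inter> U"
          unfolding Y_def in_closure_of by blast
        then show ?thesis
          by (auto simp: orb_def S_def)
      qed
      then show ?thesis
        using x YX by (auto simp: in_closure_of)
    qed
    then have "S \<in> \<iota> y"
      unfolding eq[symmetric] by (auto simp: \<iota>_def S_def)
    then have "y \<in> X closure_of (orb S)"
      by (simp add: \<iota>_def)
    then obtain z where "z \<in> orb S" "z \<in> W"
      using U unfolding in_closure_of by blast
    then show False
      using U(5) by (auto simp: orb_def S_def disjnt_iff)
  qed
  define Z where "Z = \<iota> ` Y"
  define \<kappa> where "\<kappa> = inv_into Y \<iota>"
  have \<kappa>Y: "\<kappa> z \<in> Y" if "z \<in> Z" for z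
    using that by (simp add: Z_def \<kappa>_def inv_into_into)
  have \<iota>\<kappa>: "\<iota> (\<kappa> z) = z" if "z \<in> Z" for z
    using that by (simp add: Z_def \<kappa>_def f_inv_into_f)
  have \<kappa>\<iota>: "\<kappa> (\<iota> y) = y" if "y \<in> Y" for y
    using that inj by (simp add: \<kappa>_def)
  have \<iota>Z: "\<iota> y \<in> Z" if "y \<in> Y" for y
    using that by (simp add: Z_def)
  define X' where "X' = pullback_topology Z \<kappa> (subtopology X Y)"
  have topY: "topspace (subtopology X Y) = Y"
    using YX by auto
  have topX': "topspace X' = Z"
    using \<kappa>Y topY by (auto simp: X'_def topspace_pullback_topology)
  have c\<kappa>: "continuous_map X' (subtopology X Y) \<kappa>"
    using continuous_map_pullback[OF continuous_map_id, of Z \<kappa> "subtopology X Y"]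
    by (simp add: X'_def)
  have c\<iota>: "continuous_map (subtopology X Y) X' \<iota>"
    unfolding X'_def
  proof (rule continuous_map_pullback')
    show "continuous_map (subtopology X Y) (subtopology X Y) (\<kappa> \<circ> \<iota>)"
      by (rule continuous_map_eq[OF continuous_map_id]) (use topY \<kappa>\<iota> in auto)
    show "topspace (subtopology X Y) \<subseteq> \<iota> -` Z"
      using topY \<iota>Z by auto
  qed
  have "homeomorphic_maps (subtopology X Y) X' \<iota> \<kappa>"
    unfolding homeomorphic_maps_def using c\<kappa> c\<iota> topY topX' \<kappa>\<iota> \<iota>\<kappa> by simp
  then have hom: "subtopology X Y homeomorphic_space X'"
    unfolding homeomorphic_space_def by blast
  have "compact_space (subtopology X Y)"
    using comp unfolding Y_def
    by (simp add: closedin_compact_space compact_space_subtopology)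
  then have comp': "compact_space X'"
    using hom homeomorphic_compact_space by blast
  have haus': "Hausdorff_space X'"
    using hom haus homeomorphic_Hausdorff_space Hausdorff_space_subtopology by blast
  have c\<kappa>X: "continuous_map X' X \<kappa>"
    using c\<kappa> by (simp add: continuous_map_in_subtopology)
  define act' where "act' g = (\<lambda>z\<in>Z. \<iota> (act g (\<kappa> z)))" for g
  have act'Z: "act' g z \<in> Z" if "g \<in> carrier G" "z \<in> Z" for g z
    using that by (simp add: act'_def \<iota>Z Yinv \<kappa>Y)
  have \<kappa>act': "\<kappa> (act' g z) = act g (\<kappa> z)" if "g \<in> carrier G" "z \<in> Z" for g z
    using that by (simp add: act'_def \<kappa>\<iota> Yinv \<kappa>Y)
  have act'_mult: "act' (g \<otimes>\<^bsub>G\<^esub> h) z = act' g (act' h z)"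
    if "g \<in> carrier G" "h \<in> carrier G" "z \<in> Z" for g h z
  proof -
    have "\<kappa> z \<in> topspace X"
      using that(3) \<kappa>Y YX by blast
    then show ?thesis
      using that act'Z[of h z] \<kappa>act'[of h z] A.composition_rule by (simp add: act'_def)
  qed
  have act'_one: "act' \<one>\<^bsub>G\<^esub> z = z" if "z \<in> Z" for z
  proof -
    have "\<kappa> z \<in> topspace X"
      using that \<kappa>Y YX by blast
    then have "act \<one>\<^bsub>G\<^esub> (\<kappa> z) = \<kappa> z"
      using A.id_eq_one by (metis restrict_apply')
    then show ?thesis
      using that \<iota>\<kappa> by (simp add: act'_def)
  qed
  have bij': "act' g \<in> Bij Z" if g: "g \<in> carrier G" for g
  proof -
    have "bij_betw (act' g) Z Z"
    proof (rule bij_betw_byWitness[where f' = "act' (inv\<^bsub>G\<^esub> g)"])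
      show "\<forall>z\<in>Z. act' (inv\<^bsub>G\<^esub> g) (act' g z) = z"
        using g act'_mult[of "inv\<^bsub>G\<^esub> g" g] act'_one by simp
      show "\<forall>z\<in>Z. act' g (act' (inv\<^bsub>G\<^esub> g) z) = z"
        using g act'_mult[of g "inv\<^bsub>G\<^esub> g"] act'_one by simp
      show "act' g ` Z \<subseteq> Z" "act' (inv\<^bsub>G\<^esub> g) ` Z \<subseteq> Z"
        using g act'Z by auto
    qed
    then show ?thesis
      by (simp add: Bij_def act'_def)
  qed
  have "group_action G (topspace X') act'"
    unfolding group_action_def group_hom_def group_hom_axioms_def topX'
  proof (intro conjI homI)
    show "group G" by (rule G.group_axioms)
    show "group (BijGroup Z)" by (rule group_BijGroup)
    show "act' g \<in> carrier (BijGroup Z)" if "g \<in> carrier G" for g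
      using bij'[OF that] by (simp add: BijGroup_def)
    show "act' (g \<otimes>\<^bsub>G\<^esub> h) = act' g \<otimes>\<^bsub>BijGroup Z\<^esub> act' h"
      if "g \<in> carrier G" "h \<in> carrier G" for g h
    proof -
      have "act' (g \<otimes>\<^bsub>G\<^esub> h) = compose Z (act' g) (act' h)"
      proof
        fix z show "act' (g \<otimes>\<^bsub>G\<^esub> h) z = compose Z (act' g) (act' h) z"
        proof (cases "z \<in> Z")
          case True
          then show ?thesis
            using act'_mult[OF that True] by (simp add: compose_def)
        next
          case False
          then show ?thesis
            by (simp add: act'_def compose_def)
        qed
      qed
      then show ?thesis
        using that bij' by (simp add: BijGroup_def)
    qed
  qed
  moreover have cact': "continuous_map (prod_topology T X') X' (\<lambda>(g, z). act' g z)"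
  proof -
    have "continuous_map (prod_topology T X') (prod_topology T X) (\<lambda>p. (fst p, \<kappa> (snd p)))"
      by (intro continuous_map_pairedI continuous_map_fst
          continuous_map_compose[OF continuous_map_snd c\<kappa>X, unfolded o_def])
    from continuous_map_compose[OF this cont]
    have "continuous_map (prod_topology T X') X (\<lambda>p. act (fst p) (\<kappa> (snd p)))"
      by (simp add: o_def)
    then have "continuous_map (prod_topology T X') (subtopology X Y)
                 (\<lambda>p. act (fst p) (\<kappa> (snd p)))"
      by (auto simp: continuous_map_in_subtopology topT topX' Yinv \<kappa>Y)
    from continuous_map_compose[OF this c\<iota>]
    have "continuous_map (prod_topology T X') X' (\<lambda>p. \<iota> (act (fst p) (\<kappa> (snd p))))"
      by (simp add: o_def)
    then show ?thesis
      by (rule continuous_map_eq) (auto simp: topX' act'_def)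
  qed
  ultimately have "flow G T X' act'"
    using Yne comp' haus' topX' by (simp add: flow_def continuous_action_def Z_def)
  with am obtain \<nu> where "invariant_borel_probability G X' act' \<nu>"
    unfolding amenable_def by blast
  then have p\<nu>: "prob_space \<nu>" and sp\<nu>: "space \<nu> = Z"
    and se\<nu>: "sets \<nu> = sigma_sets Z {U. openin X' U}"
    and inv\<nu>: "\<And>g. g \<in> carrier G \<Longrightarrow> distr \<nu> \<nu> (act' g) = \<nu>"
    by (auto simp: invariant_borel_probability_def topX')
  define B where "B = sigma (topspace X) {U. openin X U}"
  have subP: "{U. openin X U} \<subseteq> Pow (topspace X)"
    using openin_subset by auto
  have spB: "space B = topspace X" and seB: "sets B = sigma_sets (topspace X) {U. openin X U}"
    using subP by (simp_all add: B_def space_measure_of sets_measure_of)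
  have m\<kappa>: "\<kappa> \<in> measurable \<nu> B"
    unfolding B_def
  proof (rule measurable_sigma_sets[OF _ subP])
    show "sets (sigma (topspace X) {U. openin X U}) = sigma_sets (topspace X) {U. openin X U}"
      using subP by (simp add: sets_measure_of)
    show "\<kappa> \<in> space \<nu> \<rightarrow> topspace X"
      using sp\<nu> \<kappa>Y YX by auto
    fix U assume "U \<in> {U. openin X U}"
    then have "openin X' {z \<in> topspace X'. \<kappa> z \<in> U}"
      using c\<kappa>X by (simp add: continuous_map_def)
    moreover have "\<kappa> -` U \<inter> space \<nu> = {z \<in> topspace X'. \<kappa> z \<in> U}"
      using sp\<nu> topX' by auto
    ultimately show "\<kappa> -` U \<inter> space \<nu> \<in> sets \<nu>"
      using se\<nu> by (simp add: sigma_sets.Basic)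
  qed
  have mact: "act g \<in> measurable B B" if g: "g \<in> carrier G" for g
  proof (subst (2) B_def, rule measurable_measure_of[OF subP])
    show "act g \<in> space B \<rightarrow> topspace X"
      using spB A.element_image[OF g] by auto
    fix U assume "U \<in> {U. openin X U}"
    then have "openin X {x \<in> topspace X. act g x \<in> U}"
      using cont1[OF g] by (simp add: continuous_map_def)
    moreover have "act g -` U \<inter> space B = {x \<in> topspace X. act g x \<in> U}"
      using spB by auto
    ultimately show "act g -` U \<inter> space B \<in> sets B"
      using seB by (simp add: sigma_sets.Basic)
  qed
  have mact': "act' g \<in> measurable \<nu> \<nu>" if g: "g \<in> carrier G" for g
  proof (rule measurable_sigma_sets[OF se\<nu>])
    show "{U. openin X' U} \<subseteq> Pow Z"
      using openin_subset topX' by auto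
    show "act' g \<in> space \<nu> \<rightarrow> Z"
      using sp\<nu> act'Z[OF g] by auto
    fix U assume U: "U \<in> {U. openin X' U}"
    have "continuous_map X' (prod_topology T X') (\<lambda>z. (g, z))"
      using g topT by (simp add: continuous_map_pairedI)
    from continuous_map_compose[OF this cact']
    have "continuous_map X' X' (act' g)"
      by (simp add: o_def)
    then have "openin X' {z \<in> topspace X'. act' g z \<in> U}"
      using U by (simp add: continuous_map_def)
    moreover have "act' g -` U \<inter> space \<nu> = {z \<in> topspace X'. act' g z \<in> U}"
      using sp\<nu> topX' by auto
    ultimately show "act' g -` U \<inter> space \<nu> \<in> sets \<nu>"
      using se\<nu> by (simp add: sigma_sets.Basic)
  qed
  define \<mu> where "\<mu> = distr \<nu> B \<kappa>"
  have "distr \<mu> \<mu> (act g) = \<mu>" if g: "g \<in> carrier G" for g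
  proof -
    have "distr \<mu> \<mu> (act g) = distr \<mu> B (act g)"
      by (rule distr_cong) (simp_all add: \<mu>_def)
    also have "\<dots> = distr \<nu> B (act g \<circ> \<kappa>)"
      unfolding \<mu>_def by (rule distr_distr[OF mact[OF g] m\<kappa>])
    also have "\<dots> = distr \<nu> B (\<kappa> \<circ> act' g)"
      by (rule distr_cong) (simp_all add: sp\<nu> \<kappa>act'[OF g])
    also have "\<dots> = distr (distr \<nu> \<nu> (act' g)) B \<kappa>"
      by (rule distr_distr[OF m\<kappa> mact'[OF g], symmetric])
    also have "\<dots> = \<mu>"
      by (simp add: inv\<nu>[OF g] \<mu>_def)
    finally show ?thesis .
  qed
  moreover have "prob_space \<mu>"
    unfolding \<mu>_def by (rule prob_space.prob_space_distr[OF p\<nu> m\<kappa>])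
  ultimately have "invariant_borel_probability G X act \<mu>"
    by (simp add: invariant_borel_probability_def \<mu>_def spB seB)
  then show ?thesis by blast
qed


section \<open>First-order structures\<close>

record ('f, 'r) language =
  funs :: "'f set"
  fun_arity :: "'f \<Rightarrow> nat"
  rels :: "'r set"
  rel_arity :: "'r \<Rightarrow> nat"

record ('f, 'r, 'a) struc =
  dom :: "'a set"
  fun_interp :: "'f \<Rightarrow> 'a list \<Rightarrow> 'a"
  rel_interp :: "'r \<Rightarrow> 'a list \<Rightarrow> bool"

definition is_structure :: "('f, 'r) language \<Rightarrow> ('f, 'r, 'a) struc \<Rightarrow> bool" where
  "is_structure L M \<longleftrightarrow>
     dom M \<noteq> {} \<and>
     (\<forall>f\<in>funs L. \<forall>xs\<in>tuples (dom M) (fun_arity L f). fun_interp M f xs \<in> dom M)"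

datatype 'f fo_term = TVar nat | TFun 'f "'f fo_term list"

datatype ('f, 'r) formula =
    FEq "'f fo_term" "'f fo_term"
  | FRel 'r "'f fo_term list"
  | FNeg "('f, 'r) formula"
  | FConj "('f, 'r) formula" "('f, 'r) formula"
  | FEx nat "('f, 'r) formula"

primrec wf_term :: "('f, 'r) language \<Rightarrow> 'f fo_term \<Rightarrow> bool" where
  "wf_term L (TVar i) \<longleftrightarrow> True"
| "wf_term L (TFun f ts) \<longleftrightarrow>
     f \<in> funs L \<and> length ts = fun_arity L f \<and> list_all (wf_term L) ts"

primrec wf_formula :: "('f, 'r) language \<Rightarrow> ('f, 'r) formula \<Rightarrow> bool" where
  "wf_formula L (FEq s t) \<longleftrightarrow> wf_term L s \<and> wf_term L t"
| "wf_formula L (FRel r ts) \<longleftrightarrow>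
     r \<in> rels L \<and> length ts = rel_arity L r \<and> (\<forall>t\<in>set ts. wf_term L t)"
| "wf_formula L (FNeg \<phi>) \<longleftrightarrow> wf_formula L \<phi>"
| "wf_formula L (FConj \<phi> \<psi>) \<longleftrightarrow> wf_formula L \<phi> \<and> wf_formula L \<psi>"
| "wf_formula L (FEx i \<phi>) \<longleftrightarrow> wf_formula L \<phi>"

primrec term_vars :: "'f fo_term \<Rightarrow> nat set" where
  "term_vars (TVar i) = {i}"
| "term_vars (TFun f ts) = \<Union> (set (map term_vars ts))"

primrec free_vars :: "('f, 'r) formula \<Rightarrow> nat set" where
  "free_vars (FEq s t) = term_vars s \<union> term_vars t"
| "free_vars (FRel r ts) = (\<Union>t\<in>set ts. term_vars t)"
| "free_vars (FNeg \<phi>) = free_vars \<phi>"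
| "free_vars (FConj \<phi> \<psi>) = free_vars \<phi> \<union> free_vars \<psi>"
| "free_vars (FEx i \<phi>) = free_vars \<phi> - {i}"

primrec eval_term :: "('f, 'r, 'a) struc \<Rightarrow> (nat \<Rightarrow> 'a) \<Rightarrow> 'f fo_term \<Rightarrow> 'a" where
  "eval_term M v (TVar i) = v i"
| "eval_term M v (TFun f ts) = fun_interp M f (map (eval_term M v) ts)"

primrec sat :: "('f, 'r, 'a) struc \<Rightarrow> (nat \<Rightarrow> 'a) \<Rightarrow> ('f, 'r) formula \<Rightarrow> bool" where
  "sat M v (FEq s t) \<longleftrightarrow> eval_term M v s = eval_term M v t"
| "sat M v (FRel r ts) \<longleftrightarrow> rel_interp M r (map (eval_term M v) ts)"
| "sat M v (FNeg \<phi>) \<longleftrightarrow> \<not> sat M v \<phi>"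
| "sat M v (FConj \<phi> \<psi>) \<longleftrightarrow> sat M v \<phi> \<and> sat M v \<psi>"
| "sat M v (FEx i \<phi>) \<longleftrightarrow> (\<exists>a\<in>dom M. sat M (v(i := a)) \<phi>)"

definition sentences :: "('f, 'r) language \<Rightarrow> ('f, 'r) formula set" where
  "sentences L = {\<phi>. wf_formula L \<phi> \<and> free_vars \<phi> = {}}"

definition holds :: "('f, 'r, 'a) struc \<Rightarrow> ('f, 'r) formula \<Rightarrow> bool" where
  "holds M \<phi> \<longleftrightarrow> (\<forall>v. range v \<subseteq> dom M \<longrightarrow> sat M v \<phi>)"

definition theory_of :: "('f, 'r) language \<Rightarrow> ('f, 'r, 'a) struc \<Rightarrow> ('f, 'r) formula set" where
  "theory_of L M = {\<phi> \<in> sentences L. holds M \<phi>}"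

definition is_model ::
  "('f, 'r) language \<Rightarrow> ('f, 'r) formula set \<Rightarrow> ('f, 'r, 'a) struc \<Rightarrow> bool" where
  "is_model L \<Theta> N \<longleftrightarrow> is_structure L N \<and> (\<forall>\<phi>\<in>\<Theta>. holds N \<phi>)"

definition isomorphism ::
  "('f, 'r) language \<Rightarrow> ('f, 'r, 'a) struc \<Rightarrow> ('f, 'r, 'c) struc \<Rightarrow> ('a \<Rightarrow> 'c) \<Rightarrow> bool" where
  "isomorphism L M N h \<longleftrightarrow>
     bij_betw h (dom M) (dom N) \<and>
     (\<forall>f\<in>funs L. \<forall>xs\<in>tuples (dom M) (fun_arity L f).
        h (fun_interp M f xs) = fun_interp N f (map h xs)) \<and>
     (\<forall>r\<in>rels L. \<forall>xs\<in>tuples (dom M) (rel_arity L r).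
        rel_interp M r xs \<longleftrightarrow> rel_interp N r (map h xs))"

text \<open>
  \<open>M\<close> is a countably infinite structure whose theory has, up to isomorphism, no other countably
  infinite model. Every such model has an isomorphic copy with points in \<^typ>\<open>nat\<close>, so it
  suffices to let \<open>N\<close> range over those (whose domains are automatically countable).
\<close>

definition countable_omega_categorical ::
  "('f, 'r) language \<Rightarrow> ('f, 'r, 'a) struc \<Rightarrow> bool" where
  "countable_omega_categorical L M \<longleftrightarrow>
     is_structure L M \<and> countable (dom M) \<and> infinite (dom M) \<and>
     (\<forall>N :: ('f, 'r, nat) struc.
        is_model L (theory_of L M) N \<and> infinite (dom N) \<longrightarrow> (\<exists>h. isomorphism L M N h))"


section \<open>Automorphism groups\<close>

text \<open>Automorphisms are extensional functions on the domain, as in \<^const>\<open>BijGroup\<close>.\<close>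

definition Aut :: "('f, 'r) language \<Rightarrow> ('f, 'r, 'a) struc \<Rightarrow> ('a \<Rightarrow> 'a) monoid" where
  "Aut L M = (BijGroup (dom M))\<lparr>carrier := {g \<in> Bij (dom M). isomorphism L M M g}\<rparr>"

definition pointwise_topology ::
  "('f, 'r) language \<Rightarrow> ('f, 'r, 'a) struc \<Rightarrow> ('a \<Rightarrow> 'a) topology" where
  "pointwise_topology L M =
     subtopology (product_topology (\<lambda>_. discrete_topology (dom M)) (dom M)) (carrier (Aut L M))"

definition co_precompact ::
  "('f, 'r) language \<Rightarrow> ('f, 'r, 'a) struc \<Rightarrow> ('a \<Rightarrow> 'a) set \<Rightarrow> bool" where
  "co_precompact L M H \<longleftrightarrow>
     (\<forall>n. \<forall>\<Omega> \<in> orbits (Aut L M) (tuples (dom M) n) (diagonal (\<lambda>g. g)).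
        \<exists>F. finite F \<and>
            F \<subseteq> orbits (subgroup_as_group (Aut L M) H) (tuples (dom M) n) (diagonal (\<lambda>g. g)) \<and>
            \<Omega> = \<Union> F)"

end

theory Submission
  imports Defs
begin

text \<open>
  Why amenability forces infinitely many orbits. In a \<open>k\<close>-sparse graph, Hall's theorem orients each
  finite piece with out-degrees at most \<open>k\<close>, so by compactness the orientations of the whole graph
  with this bound form a nonempty compact space (\<open>orientations_closed_nonempty\<close>), on which a group
  acting continuously on the graph acts continuously (\<open>flow_orientations\<close>). Given an invariant
  probability measure on this space, let \<open>D\<close> consist of the pairs \<open>(a, b)\<close> of adjacent vertices for
  which the edge points from \<open>a\<close> to \<open>b\<close> with probability at least \<open>1/2\<close>. Then \<open>D\<close> is invariant; it
  contains each edge in at least one direction; and its out-degrees are at most \<open>2k\<close>, because the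
  expected out-degree of a vertex is at most \<open>k\<close>. Since valencies are infinite, every vertex has
  infinitely many predecessors, so backward chains of distinct vertices never stop, and there are
  vertices from which arbitrarily many others are reachable along \<open>D\<close>. On the other hand the directed
  distance along \<open>D\<close> is constant on orbits of pairs. If there were only finitely many orbits, this
  distance would be bounded, and so would the number of vertices reachable from a given vertex
  (\<open>infinite_orbits_of_invariant_relation\<close>).

  For the second claim it remains to find a sparse graph with infinite valencies whose automorphism
  group has finitely many orbits on every power. This is Hrushovski's construction with the
  predimension \<open>\<delta>(B) = 2|B| - e(B)\<close>, where \<open>e(B)\<close> counts edges inside \<open>B\<close>, on the class of graphs with
  \<open>|B| \<le> 2^\<delta>(B)\<close> for all finite \<open>B\<close>. Call \<open>A\<close> strong if every finite proper superset has larger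
  predimension. The choice of an exponential bound serves two purposes at once. Free amalgams over
  strong subsets stay in the class, because a free amalgam at most doubles the size of the larger side
  and raises the predimension by at least one (\<open>tame_free_amalgam\<close>). And every set of \<open>n\<close> vertices
  lies in a strong set of size at most \<open>4^n\<close>, because enlarging the set without raising the
  predimension above \<open>2n\<close> is only possible within that size (\<open>strong_hull\<close>). Amalgamation yields a
  countable generic graph, which is homogeneous for isomorphisms between finite strong sets
  (\<open>generic_homogeneous\<close>); as strong hulls are bounded, there are finitely many orbits on \<open>n\<close>-tuples
  (\<open>generic_oligomorphic\<close>), and the graph is \<open>\<omega>\<close>-categorical by the easy half of the Ryll-Nardzewski
  theorem (\<open>oligomorphic_imp_omega_categorical\<close>). A co-precompact subgroup of its automorphism group
  has finitely many orbits on pairs, hence is not amenable by the first part.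
\<close>

section \<open>Bounded orientations of sparse graphs\<close>

text \<open>
  Rado's proof of Hall's theorem: while some \<open>A i\<close> has two elements
  \<open>x\<close> and \<open>y\<close>, one of them can be removed from it. Otherwise both
  removals violate the condition, say on \<open>J\<close> and \<open>K\<close>, and
  submodularity of the size of unions makes the condition fail for \<open>J \<union> K \<union>
  {i}\<close> or for \<open>J \<inter> K\<close>.
\<close>

lemma marriage:
  fixes A :: "'i \<Rightarrow> 'a set"
  assumes "finite I" "\<And>i. i \<in> I \<Longrightarrow> finite (A i)"
    and "\<And>J. J \<subseteq> I \<Longrightarrow> card J \<le> card (\<Union>(A ` J))"
  shows "\<exists>s. inj_on s I \<and> (\<forall>i\<in>I. s i \<in> A i)"
  using assms(2,3)
proof (induction "\<Sum>i\<in>I. card (A i)" arbitrary: A rule: less_induct)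
  case less
  note fin = less.prems(1) and hall = less.prems(2)
  show ?case
  proof (cases "\<exists>i\<in>I. \<exists>x\<in>A i. \<exists>y\<in>A i. x \<noteq> y")
    case False
    have ne: "A i \<noteq> {}" if "i \<in> I" for i
      using hall[of "{i}"] that by auto
    define s where "s i = (SOME x. x \<in> A i)" for i
    have s: "s i \<in> A i" if "i \<in> I" for i
      unfolding s_def using ne[OF that] by (simp add: some_in_eq)
    have A: "A i = {s i}" if "i \<in> I" for i
      using s False that by blast
    have "inj_on s I"
    proof (rule inj_onI, rule ccontr)
      fix i j assume ij: "i \<in> I" "j \<in> I" "s i = s j" "i \<noteq> j"
      then show False
        using hall[of "{i, j}"] A by auto
    qed
    then show ?thesis
      using s by blast
  next
    case True
    then obtain i x y where i: "i \<in> I" and xy: "x \<in> A i" "y \<in> A i" "x \<noteq> y"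
      by blast
    have smaller: "(\<Sum>j\<in>I. card ((A(i := A i - {z})) j)) < (\<Sum>j\<in>I. card (A j))" if "z \<in> A i" for z
    proof (rule sum_strict_mono_ex1[OF assms(1)])
      show "\<forall>j\<in>I. card ((A(i := A i - {z})) j) \<le> card (A j)"
        using fin by (auto intro: card_mono)
      show "\<exists>j\<in>I. card ((A(i := A i - {z})) j) < card (A j)"
        using card_Diff1_less[OF fin[OF i] that] i by (intro bexI[of _ i]) simp_all
    qed
    have reduce: ?thesis
      if z: "z \<in> A i" and H: "\<And>J. J \<subseteq> I \<Longrightarrow> card J \<le> card (\<Union>((A(i := A i - {z})) ` J))" for z
    proof -
      have "finite ((A(i := A i - {z})) j)" if "j \<in> I" for j
        using fin[OF that] by (cases "j = i") simp_all
      from this H have "\<exists>s. inj_on s I \<and> (\<forall>j\<in>I. s j \<in> (A(i := A i - {z})) j)"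
        by (rule less.hyps[OF smaller[OF z]])
      then obtain s where s: "inj_on s I" "\<forall>j\<in>I. s j \<in> (A(i := A i - {z})) j"
        by blast
      then have "\<forall>j\<in>I. s j \<in> A j"
        by (metis DiffE fun_upd_apply)
      with s(1) show ?thesis by blast
    qed
    \<comment> \<open>The strict inequality becomes a weak one because \<open>i\<close> is left out of \<open>J\<close>.\<close>
  have violated: "\<exists>J \<subseteq> I - {i}. card (\<Union>(A ` J) \<union> (A i - {z})) \<le> card J"
      if no: "\<not> (\<forall>J\<subseteq>I. card J \<le> card (\<Union>((A(i := A i - {z})) ` J)))" for z
    proof -
      obtain J where J: "J \<subseteq> I" "card (\<Union>((A(i := A i - {z})) ` J)) < card J"
        using no by (auto simp: not_le)
      have "i \<in> J"
      proof (rule ccontr)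
        assume "i \<notin> J"
        then have "(A(i := A i - {z})) ` J = A ` J"
          by (auto simp: image_iff)
        then show False
          using J(2) hall[OF J(1)] by (simp only: not_le[symmetric] not_True_eq_False simp_thms)
      qed
      moreover have "(\<Union>((A(i := A i - {z})) ` J)) = \<Union>(A ` (J - {i})) \<union> (A i - {z})"
        using \<open>i \<in> J\<close> by (auto split: if_splits)
      moreover have "card J = Suc (card (J - {i}))"
        using \<open>i \<in> J\<close> J(1) assms(1) by (metis card_Suc_Diff1 finite_subset)
      ultimately have "card (\<Union>(A ` (J - {i})) \<union> (A i - {z})) \<le> card (J - {i})"
        using J(2) by simp
      with J(1) show ?thesis by (intro exI[of _ "J - {i}"]) auto
    qed
    have "(\<forall>J\<subseteq>I. card J \<le> card (\<Union>((A(i := A i - {x})) ` J))) \<or>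
          (\<forall>J\<subseteq>I. card J \<le> card (\<Union>((A(i := A i - {y})) ` J)))"
    proof (rule ccontr)
      assume "\<not> ?thesis"
      then obtain J K where J: "J \<subseteq> I - {i}" "card (\<Union>(A ` J) \<union> (A i - {x})) \<le> card J"
        and K: "K \<subseteq> I - {i}" "card (\<Union>(A ` K) \<union> (A i - {y})) \<le> card K"
        using violated[of x] violated[of y] by blast
      let ?U = "\<Union>(A ` J) \<union> (A i - {x})" and ?W = "\<Union>(A ` K) \<union> (A i - {y})"
      have finJK: "finite J" "finite K"
        using J(1) K(1) assms(1) by (auto intro: finite_subset)
      have finU: "finite ?U" "finite ?W"
        using J(1) K(1) finJK fin i by auto
      have "?U \<union> ?W = \<Union>(A ` insert i (J \<union> K))"
        using xy by auto
      then have "card (insert i (J \<union> K)) \<le> card (?U \<union> ?W)"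
      proof -
        have "insert i (J \<union> K) \<subseteq> I"
          using J(1) K(1) i by blast
        from hall[OF this] show ?thesis
          by (simp only: \<open>?U \<union> ?W = \<Union>(A ` insert i (J \<union> K))\<close>)
      qed
      moreover have "card (insert i (J \<union> K)) = Suc (card (J \<union> K))"
        using J(1) K(1) finJK by (subst card_insert_disjoint) auto
      moreover have "card (J \<inter> K) \<le> card (?U \<inter> ?W)"
      proof -
        have "card (J \<inter> K) \<le> card (\<Union>(A ` (J \<inter> K)))"
          using hall J(1) by blast
        also have "\<dots> \<le> card (?U \<inter> ?W)"
          by (rule card_mono) (use finU in auto)
        finally show ?thesis .
      qed
      ultimately have "card J + card K < card ?U + card ?W"
        using card_Un_Int[OF finJK] card_Un_Int[OF finU] by linarith
      with J(2) K(2) show False by linarith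
    qed
    then show ?thesis
      using reduce[OF xy(1)] reduce[OF xy(2)] by blast
  qed
qed

text \<open>
  The function \<open>dist\<close> below is the directed distance, and \<open>\<rho>\<close>
  reads it off an orbit. All pairs that are not connected share one default value, so
  \<open>dist\<close> is constant on their orbits too. The contradiction compares a bound on the
  number of vertices reachable from a vertex, which bounded distance gives, with the sets of
  reachable vertices that grow by one with each step backwards.
\<close>

lemma infinite_orbits_of_invariant_relation:
  assumes act: "group_action K V act" and "V \<noteq> {}" and D: "D \<subseteq> V \<times> V"
    and inv: "\<And>g a b. g \<in> carrier K \<Longrightarrow> (a, b) \<in> D \<Longrightarrow> (act g a, act g b) \<in> D"
    and out: "\<And>a. finite (D `` {a}) \<and> card (D `` {a}) \<le> c"
    and into: "\<And>a. a \<in> V \<Longrightarrow> infinite (D\<inverse> `` {a})"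
  shows "infinite (orbits K (tuples V 2) (diagonal act))"
proof
  assume fin: "finite (orbits K (tuples V 2) (diagonal act))"
  interpret group_action K V act by (rule act)
  interpret K: group K
    using group_hom by (simp add: group_hom_def)
  have inv_pow: "(act g a, act g b) \<in> D ^^ i" if "g \<in> carrier K" "(a, b) \<in> D ^^ i" for g a b i
    using that(2)
  proof (induction i arbitrary: b)
    case (Suc i)
    then obtain z where z: "(a, z) \<in> D ^^ i" "(z, b) \<in> D"
      by auto
    then show ?case using Suc.IH inv[OF that(1)] by (auto intro: relcompI)
  qed simp
  have pow_iff: "(act g a, act g b) \<in> D ^^ i \<longleftrightarrow> (a, b) \<in> D ^^ i"
    if g: "g \<in> carrier K" and ab: "a \<in> V" "b \<in> V" for g a b i
    using inv_pow[OF g, of a b i] inv_pow[OF K.inv_closed[OF g], of "act g a" "act g b" i]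
      orbit_sym_aux[OF g ab(1) refl] orbit_sym_aux[OF g ab(2) refl] by auto
  define dist where "dist xs = (LEAST i. (xs ! 0, xs ! 1) \<in> D ^^ i)" for xs
  have dist_inv: "dist (diagonal act g [a, b]) = dist [a, b]"
    if "g \<in> carrier K" "a \<in> V" "b \<in> V" for g a b
    using pow_iff[OF that] by (simp add: dist_def diagonal_def)
  have tup: "[a, b] \<in> tuples V 2" if "a \<in> V" "b \<in> V" for a b
    using that by (simp add: tuples_def)
  define \<rho> where "\<rho> \<Omega> = dist (SOME xs. xs \<in> \<Omega>)" for \<Omega>
  have dist_orbit: "dist [a, b] = \<rho> (orbit K (diagonal act) [a, b])" if "a \<in> V" "b \<in> V" for a b
  proof -
    let ?\<Omega> = "orbit K (diagonal act) [a, b]"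
    have "diagonal act \<one>\<^bsub>K\<^esub> [a, b] \<in> ?\<Omega>"
      unfolding orbit_def by blast
    then have "(SOME xs. xs \<in> ?\<Omega>) \<in> ?\<Omega>"
      by (rule someI)
    then obtain g where "g \<in> carrier K" "(SOME xs. xs \<in> ?\<Omega>) = diagonal act g [a, b]"
      unfolding orbit_def by blast
    then show ?thesis using dist_inv[OF _ that] by (simp add: \<rho>_def)
  qed
  have "{dist [a, b] |a b. a \<in> V \<and> b \<in> V} \<subseteq> \<rho> ` orbits K (tuples V 2) (diagonal act)"
    using dist_orbit tup unfolding orbits_def by blast
  then have "finite {dist [a, b] |a b. a \<in> V \<and> b \<in> V}"
    using fin by (meson finite_imageI finite_subset)
  then obtain n where n: "\<And>a b. a \<in> V \<Longrightarrow> b \<in> V \<Longrightarrow> dist [a, b] \<le> n"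
    unfolding finite_nat_set_iff_bounded_le by blast
  have star_V: "b \<in> V" if "(a, b) \<in> D\<^sup>*" "a \<in> V" for a b
    using that(1) by (induction rule: rtrancl_induct) (use D that(2) in auto)
  have star: "D\<^sup>* `` {a} \<subseteq> (\<Union>i\<le>n. (D ^^ i) `` {a})" if a: "a \<in> V" for a
  proof
    fix b assume "b \<in> D\<^sup>* `` {a}"
    then obtain i where i: "(a, b) \<in> D ^^ i" and b: "b \<in> V"
      using star_V a by (auto simp: rtrancl_power)
    have "(a, b) \<in> D ^^ (LEAST i. (a, b) \<in> D ^^ i)"
      using i by (rule LeastI)
    then have "(a, b) \<in> D ^^ dist [a, b]"
      by (simp add: dist_def)
    then show "b \<in> (\<Union>i\<le>n. (D ^^ i) `` {a})"
      using n[OF a b] by auto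
  qed
  have pow: "finite ((D ^^ i) `` {a}) \<and> card ((D ^^ i) `` {a}) \<le> c ^ i" for i a
  proof (induction i)
    case (Suc i)
    have eq: "(D ^^ Suc i) `` {a} = (\<Union>z\<in>(D ^^ i) `` {a}. D `` {z})"
      by auto
    have "card ((D ^^ Suc i) `` {a}) \<le> (\<Sum>z\<in>(D ^^ i) `` {a}. card (D `` {z}))"
      unfolding eq using Suc.IH by (intro card_UN_le) simp
    also have "\<dots> \<le> card ((D ^^ i) `` {a}) * c"
      using out by (intro sum_bounded_above[of _ _ c, simplified]) simp
    also have "\<dots> \<le> c ^ i * c"
      using Suc.IH by simp
    finally show ?case
      unfolding eq using Suc.IH out by (simp add: mult.commute)
  qed simp
  have bound: "finite (D\<^sup>* `` {a}) \<and> card (D\<^sup>* `` {a}) \<le> (\<Sum>i\<le>n. c ^ i)" if a: "a \<in> V" for a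
  proof -
    have "card (\<Union>i\<le>n. (D ^^ i) `` {a}) \<le> (\<Sum>i\<le>n. card ((D ^^ i) `` {a}))"
      by (rule card_UN_le) simp
    also have "\<dots> \<le> (\<Sum>i\<le>n. c ^ i)"
      using pow by (intro sum_mono) simp
    finally have "card (\<Union>i\<le>n. (D ^^ i) `` {a}) \<le> (\<Sum>i\<le>n. c ^ i)" .
    moreover have "finite (\<Union>i\<le>n. (D ^^ i) `` {a})"
      using pow by auto
    ultimately show ?thesis
      using star[OF a] by (meson card_mono finite_subset le_trans)
  qed
  have "\<exists>a\<in>V. \<exists>S \<subseteq> D\<^sup>* `` {a}. card S = m" for m
  proof (induction m)
    case 0
    then show ?case using \<open>V \<noteq> {}\<close> by (metis card.empty empty_subsetI ex_in_conv)
  next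
    case (Suc m)
    then obtain a S where a: "a \<in> V" "S \<subseteq> D\<^sup>* `` {a}" "card S = m"
      by blast
    have finS: "finite S"
      using a bound by (meson finite_subset)
    then obtain b where b: "(b, a) \<in> D" "b \<notin> S"
      using into[OF a(1)] by (meson Image_singleton_iff converse_iff finite_subset subsetI)
    have "insert b S \<subseteq> D\<^sup>* `` {b}"
      using a(2) b(1) by (auto intro: converse_rtrancl_into_rtrancl)
    moreover have "card (insert b S) = Suc m"
      using finS b(2) a(3) by simp
    moreover have "b \<in> V" using b(1) D by blast
    ultimately show ?case by blast
  qed
  then obtain a S where "a \<in> V" "S \<subseteq> D\<^sup>* `` {a}" "card S = Suc (\<Sum>i\<le>n. c ^ i)"
    by blast
  then show False
    using bound[of a] card_mono[of "D\<^sup>* `` {a}" S] by simp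
qed

text \<open>
  The value \<open>s e\<close> is the tail of the edge \<open>e\<close>. The edges are matched
  into \<open>k\<close> copies of the vertex set; for a set \<open>J\<close> of edges, sparsity
  on the union of \<open>J\<close> is exactly Hall's condition.
\<close>

lemma finite_orientation:
  assumes "simple_graph V E" "k_sparse k V E" "finite B" "B \<subseteq> V"
  obtains s where "\<And>e. e \<in> E \<Longrightarrow> e \<subseteq> B \<Longrightarrow> s e \<in> e"
    "\<And>a. card {e \<in> E. e \<subseteq> B \<and> s e = a} \<le> k"
proof -
  let ?I = "{e \<in> E. e \<subseteq> B}"
  have finI: "finite ?I"
    using assms by (auto simp: k_sparse_def)
  have "\<exists>t. inj_on t ?I \<and> (\<forall>e\<in>?I. t e \<in> e \<times> {..<k})"
  proof (rule marriage[OF finI])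
    fix e assume "e \<in> ?I"
    then show "finite (e \<times> {..<k})"
      using assms(3) by (auto intro: finite_subset)
  next
    fix J assume J: "J \<subseteq> ?I"
    have U: "finite (\<Union>J)" "\<Union>J \<subseteq> V"
      using J assms(3,4) by (auto intro: finite_subset)
    have "card J \<le> card {e \<in> E. e \<subseteq> \<Union>J}"
      using J U assms(2) by (intro card_mono) (auto simp: k_sparse_def)
    also have "\<dots> \<le> k * card (\<Union>J)"
      using assms(2) U unfolding k_sparse_def by blast
    also have "\<dots> = card (\<Union>((\<lambda>e. e \<times> {..<k}) ` J))"
    proof -
      have "\<Union>((\<lambda>e. e \<times> {..<k}) ` J) = \<Union>J \<times> {..<k}"
        by blast
      then show ?thesis by (simp add: card_cartesian_product)
    qed
    finally show "card J \<le> card (\<Union>((\<lambda>e. e \<times> {..<k}) ` J))" .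
  qed
  then obtain t where t: "inj_on t ?I" "\<And>e. e \<in> ?I \<Longrightarrow> t e \<in> e \<times> {..<k}"
    by blast
  show ?thesis
  proof (rule that[of "fst \<circ> t"])
    show "(fst \<circ> t) e \<in> e" if "e \<in> E" "e \<subseteq> B" for e
      using t(2)[of e] that by (auto simp: mem_Times_iff)
    show "card {e \<in> E. e \<subseteq> B \<and> (fst \<circ> t) e = a} \<le> k" for a
    proof -
      let ?F = "{e \<in> E. e \<subseteq> B \<and> (fst \<circ> t) e = a}"
      have "inj_on (snd \<circ> t) ?F"
        using t(1) by (auto simp: inj_on_def prod_eq_iff)
      moreover have "(snd \<circ> t) ` ?F \<subseteq> {..<k}"
        using t(2) by (auto simp: mem_Times_iff)
      ultimately have "card ?F \<le> card {..<k}"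
        by (rule card_inj_on_le) simp
      then show ?thesis by simp
    qed
  qed
qed

text \<open>
  \<open>f (a, b)\<close> says that \<open>a\<close> points to \<open>b\<close>; an edge that
  points both ways counts towards both out-degrees. Each single condition involves finitely many
  coordinates, so the set is closed in the product topology.
\<close>

definition orientations :: "nat \<Rightarrow> 'v set set \<Rightarrow> ('v \<times> 'v \<Rightarrow> bool) set" where
  "orientations k E = {f. (\<forall>a b. f (a, b) \<longrightarrow> {a, b} \<in> E) \<and>
     (\<forall>a b. {a, b} \<in> E \<longrightarrow> f (a, b) \<or> f (b, a)) \<and>
     (\<forall>a S. finite S \<longrightarrow> (\<forall>b\<in>S. f (a, b)) \<longrightarrow> card S \<le> k)}"

abbreviation cantor_topology :: "('i \<Rightarrow> bool) topology" where
  "cantor_topology \<equiv> product_topology (\<lambda>_. discrete_topology UNIV) UNIV"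

lemma openin_cantor_coordinate: "openin cantor_topology {f. f p = x}"
  using openin_continuous_map_preimage[OF continuous_map_product_coordinates[of p UNIV "\<lambda>_. discrete_topology UNIV"], of "{x}"]
  by simp

lemma openin_cantor_finite:
  fixes Q :: "('a \<Rightarrow> bool) \<Rightarrow> bool"
  assumes "finite S" and "\<And>f g. (\<And>p. p \<in> S \<Longrightarrow> f p = g p) \<Longrightarrow> Q f \<Longrightarrow> Q g"
  shows "openin cantor_topology {f. Q f}"
proof (subst openin_subopen, intro ballI)
  fix f assume "f \<in> {f. Q f}"
  have "openin cantor_topology {g. \<forall>p\<in>S. g p = f p}"
    using assms(1)
  proof (induction S)
    case (insert p S)
    have "{g. \<forall>q\<in>insert p S. g q = f q} = {g. g p = f p} \<inter> {g. \<forall>q\<in>S. g q = f q}"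
      by auto
    then show ?case
      using openin_Int[OF openin_cantor_coordinate insert.IH] by simp
  next
    case empty
    then show ?case
      using openin_topspace[of "cantor_topology :: ('a \<Rightarrow> bool) topology"] by simp
  qed
  moreover have "{g. \<forall>p\<in>S. g p = f p} \<subseteq> {f. Q f}"
    using assms(2)[of f] \<open>f \<in> {f. Q f}\<close> by auto
  ultimately show "\<exists>T. openin cantor_topology T \<and> f \<in> T \<and> T \<subseteq> {f. Q f}"
    by blast
qed

text \<open>
  A property that depends on finitely many coordinates is clopen, being decided on basic open
  sets.
\<close>

lemma closedin_cantor_finite:
  assumes "finite S" and Q: "\<And>f g. (\<And>p. p \<in> S \<Longrightarrow> f p = g p) \<Longrightarrow> Q f \<Longrightarrow> Q g"
  shows "closedin cantor_topology {f. Q f}"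
proof -
  have "openin cantor_topology {f. \<not> Q f}"
    by (rule openin_cantor_finite[OF assms(1)]) (metis Q)
  moreover have "UNIV - {f. Q f} = {f. \<not> Q f}"
    by auto
  ultimately show ?thesis
    by (simp add: closedin_def)
qed

lemma compact_space_cantor: "compact_space cantor_topology"
  by (simp add: compact_space_product_topology compact_space_discrete_topology)

text \<open>
  Compactness: the orientations of the whole graph are the intersection, over finite vertex sets
  \<open>B\<close>, of the closed sets of functions that orient the graph on \<open>B\<close>.
  These sets decrease with \<open>B\<close>, and each is nonempty by Hall's theorem.
\<close>

lemma orientations_closed_nonempty:
  assumes simple: "simple_graph V E" and sparse: "k_sparse k V E"
  shows "closedin cantor_topology (orientations k E) \<and> orientations k E \<noteq> {}"
proof -
  define ok where "ok B f \<longleftrightarrow> (\<forall>a\<in>B. \<forall>b\<in>B. (f (a, b) \<longrightarrow> {a, b} \<in> E) \<and> ({a, b} \<in> E \<longrightarrow> f (a, b) \<or> f (b, a))) \<and>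
     (\<forall>a\<in>B. \<forall>S\<subseteq>B. (\<forall>b\<in>S. f (a, b)) \<longrightarrow> card S \<le> k)" for B f
  have closed: "closedin cantor_topology {f. ok B f}" if "finite B" for B
  proof (rule closedin_cantor_finite)
    show "finite (B \<times> B)" using that by simp
    fix f g assume fg: "\<And>p. p \<in> B \<times> B \<Longrightarrow> f p = g p" "ok B f"
    have "f (a, b) = g (a, b)" if "a \<in> B" "b \<in> B" for a b
      using that fg(1) by simp
    with fg(2) show "ok B g"
      unfolding ok_def by (metis subsetD)
  qed
  have mono: "ok B f" if "ok C f" "B \<subseteq> C" for B C f
    using that unfolding ok_def by (meson order_trans subsetD)
  have eq: "orientations k E = \<Inter>((\<lambda>B. {f. ok B f}) ` {B. finite B})"
  proof (intro equalityI subsetI)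
    fix f assume f: "f \<in> orientations k E"
    have "ok B f" if "finite B" for B
      unfolding ok_def
    proof (intro conjI ballI allI impI)
      show "{a, b} \<in> E" if "f (a, b)" for a b
        using f that by (simp add: orientations_def)
      show "f (a, b) \<or> f (b, a)" if "{a, b} \<in> E" for a b
        using f that by (simp add: orientations_def)
      show "card S \<le> k" if "S \<subseteq> B" "\<forall>b\<in>S. f (a, b)" for a S
        using f that finite_subset[OF _ \<open>finite B\<close>] by (simp add: orientations_def)
    qed
    then show "f \<in> \<Inter>((\<lambda>B. {f. ok B f}) ` {B. finite B})" by blast
  next
    fix f assume "f \<in> \<Inter>((\<lambda>B. {f. ok B f}) ` {B. finite B})"
    then have f: "ok B f" if "finite B" for B
      using that by blast
    show "f \<in> orientations k E"
      unfolding orientations_def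
    proof (intro CollectI conjI allI impI)
      fix a b
      show "{a, b} \<in> E" if "f (a, b)"
        using f[of "{a, b}"] that by (simp add: ok_def)
      show "f (a, b) \<or> f (b, a)" if "{a, b} \<in> E"
        using f[of "{a, b}"] that by (simp add: ok_def)
    next
      fix a S assume S: "finite S" "\<forall>b\<in>S. f (a, b)"
      have "S \<subseteq> insert a S" by blast
      then show "card S \<le> k"
        using f[of "insert a S"] S unfolding ok_def by (meson finite.insertI insertI1)
    qed
  qed
  have nonempty: "\<exists>f. ok B f" if finB: "finite B" for B
  proof -
    obtain s where s: "\<And>e. e \<in> E \<Longrightarrow> e \<subseteq> B \<inter> V \<Longrightarrow> s e \<in> e"
      "\<And>a. card {e \<in> E. e \<subseteq> B \<inter> V \<and> s e = a} \<le> k"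
      by (rule finite_orientation[OF simple sparse, of "B \<inter> V"]) (use finB in auto)
    let ?f = "\<lambda>(a, b). {a, b} \<in> E \<and> s {a, b} = a"
    have EV: "e \<subseteq> B \<inter> V" if "e \<in> E" "e \<subseteq> B" for e
      using that simple by (auto simp: simple_graph_def)
    have "card S \<le> k" if "a \<in> B" "S \<subseteq> B" "\<forall>b\<in>S. ?f (a, b)" for a S
    proof -
      have "inj_on (\<lambda>b. {a, b}) S"
        by (auto simp: inj_on_def doubleton_eq_iff)
      moreover have "(\<lambda>b. {a, b}) ` S \<subseteq> {e \<in> E. e \<subseteq> B \<inter> V \<and> s e = a}"
        using that EV by auto
      moreover have "finite {e \<in> E. e \<subseteq> B \<inter> V \<and> s e = a}"
        by (rule finite_subset[of _ "Pow B"]) (use finB in auto)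
      ultimately have "card S \<le> card {e \<in> E. e \<subseteq> B \<inter> V \<and> s e = a}"
        by (rule card_inj_on_le)
      then show ?thesis using s(2)[of a] by linarith
    qed
    moreover have "s {a, b} = a \<or> s {a, b} = b" if "{a, b} \<in> E" "a \<in> B" "b \<in> B" for a b
      using s(1)[OF that(1) EV[OF that(1)]] that by auto
    ultimately have "ok B ?f"
      unfolding ok_def by (auto simp: insert_commute)
    then show ?thesis by blast
  qed
  have "\<Inter>((\<lambda>B. {f. ok B f}) ` {B. finite B}) \<noteq> {}"
  proof (rule compact_space_fip[THEN iffD1, rule_format, OF compact_space_cantor])
    show "(\<forall>C\<in>(\<lambda>B. {f. ok B f}) ` {B. finite B}. closedin cantor_topology C) \<and>
      (\<forall>\<F>. finite \<F> \<and> \<F> \<subseteq> (\<lambda>B. {f. ok B f}) ` {B. finite B} \<longrightarrow> \<Inter> \<F> \<noteq> {})"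
    proof (intro conjI ballI allI impI)
      fix \<F> assume \<F>: "finite \<F> \<and> \<F> \<subseteq> (\<lambda>B. {f. ok B f}) ` {B. finite B}"
      then obtain \<B> where \<B>: "finite \<B>" "\<B> \<subseteq> {B. finite B}" "\<F> = (\<lambda>B. {f. ok B f}) ` \<B>"
        by (meson finite_subset_image)
      then have "finite (\<Union>\<B>)" by auto
      then obtain f where "ok (\<Union>\<B>) f"
        using nonempty by blast
      then have "ok B f" if "B \<in> \<B>" for B
        using that mono by blast
      then have "f \<in> \<Inter>\<F>"
        by (simp add: \<B>(3))
      then show "\<Inter>\<F> \<noteq> {}" by blast
    qed (use closed in auto)
  qed
  moreover have "closedin cantor_topology (\<Inter>((\<lambda>B. {f. ok B f}) ` {B. finite B}))"
    by (rule closedin_Inter) (use closed in auto)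
  ultimately show ?thesis by (simp add: eq)
qed

section \<open>The flow of orientations and amenable groups\<close>

text \<open>
  Pulling an orientation back along \<open>g\<inverse>\<close>. The restriction to
  \<open>orientations k E\<close> makes the map extensional, as group actions require; the
  guards discard values of \<open>act\<close> outside \<open>V\<close>.
\<close>

definition orientation_action ::
  "('g, 'b) monoid_scheme \<Rightarrow> 'v set \<Rightarrow> 'v set set \<Rightarrow> nat \<Rightarrow> ('g \<Rightarrow> 'v \<Rightarrow> 'v) \<Rightarrow>
    'g \<Rightarrow> ('v \<times> 'v \<Rightarrow> bool) \<Rightarrow> ('v \<times> 'v \<Rightarrow> bool)" where
  "orientation_action K V E k act g =
     (\<lambda>f\<in>orientations k E. \<lambda>(a, b). a \<in> V \<and> b \<in> V \<and> f (act (inv\<^bsub>K\<^esub> g) a, act (inv\<^bsub>K\<^esub> g) b))"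

abbreviation orientation_space :: "nat \<Rightarrow> 'v set set \<Rightarrow> ('v \<times> 'v \<Rightarrow> bool) topology" where
  "orientation_space k E \<equiv> subtopology cantor_topology (orientations k E)"

lemma topspace_orientation_space: "topspace (orientation_space k E) = orientations k E"
  by simp

text \<open>
  This is where continuity of the action enters: cosets of vertex stabilizers are open.
\<close>

lemma openin_vertex_transporter:
  assumes "continuous_action K T (discrete_topology V) act" "topspace T = carrier K" "c \<in> V"
  shows "openin T {g \<in> carrier K. act g c = a}"
proof (cases "a \<in> V")
  case True
  have "continuous_map T (prod_topology T (discrete_topology V)) (\<lambda>g. (g, c))"
    using assms(3) by (simp add: continuous_map_pairedI)
  moreover have "continuous_map (prod_topology T (discrete_topology V)) (discrete_topology V) (\<lambda>(g, x). act g x)"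
    using assms(1) by (simp add: continuous_action_def)
  ultimately have "continuous_map T (discrete_topology V) (\<lambda>g. act g c)"
    by (auto dest: continuous_map_compose simp: o_def)
  then have "openin T {g \<in> topspace T. act g c \<in> {a}}"
    by (rule openin_continuous_map_preimage) (use True in simp)
  then show ?thesis by (simp add: assms(2))
next
  case False
  interpret group_action K V act
    using assms(1) by (simp add: continuous_action_def)
  have "{g \<in> carrier K. act g c = a} = {}"
    using False element_image[OF _ assms(3)] by auto
  then show ?thesis by (simp only: openin_empty)
qed

locale graph_action =
  fixes K :: "('g, 'b) monoid_scheme" and T :: "'g topology" and V :: "'v set" and E :: "'v set set"
    and act :: "'g \<Rightarrow> 'v \<Rightarrow> 'v" and k :: nat
  assumes simple: "simple_graph V E" and sparse: "k_sparse k V E"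
    and top_group: "topological_group K T" and on_graph: "acts_on_graph K T V E act"
begin

sublocale group_action K V act
  using on_graph by (simp add: acts_on_graph_def continuous_action_def)

sublocale K: group K
  using top_group by (simp add: topological_group_def)

abbreviation Ori where "Ori \<equiv> orientations k E"

abbreviation act_ori where "act_ori \<equiv> orientation_action K V E k act"

lemma act_V: "g \<in> carrier K \<Longrightarrow> a \<in> V \<Longrightarrow> act g a \<in> V"
  using element_image by blast

lemma act_one: "a \<in> V \<Longrightarrow> act \<one>\<^bsub>K\<^esub> a = a"
  using id_eq_one by (metis restrict_apply')

lemma act_inv: "g \<in> carrier K \<Longrightarrow> a \<in> V \<Longrightarrow> act (inv\<^bsub>K\<^esub> g) (act g a) = a"
  using orbit_sym_aux by blast

lemma act_inv': "g \<in> carrier K \<Longrightarrow> a \<in> V \<Longrightarrow> act g (act (inv\<^bsub>K\<^esub> g) a) = a"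
  using act_inv[of "inv\<^bsub>K\<^esub> g" a] by simp

lemma edge_V: "{a, b} \<in> E \<Longrightarrow> a \<in> V \<and> b \<in> V"
  using simple by (auto simp: simple_graph_def)

lemma act_edge: "g \<in> carrier K \<Longrightarrow> a \<in> V \<Longrightarrow> b \<in> V \<Longrightarrow> {act g a, act g b} \<in> E \<longleftrightarrow> {a, b} \<in> E"
  using on_graph unfolding acts_on_graph_def by blast

lemma Ori_V: "f \<in> Ori \<Longrightarrow> f (a, b) \<Longrightarrow> a \<in> V \<and> b \<in> V"
  using edge_V by (auto simp: orientations_def)

lemma act_ori_apply:
  "f \<in> Ori \<Longrightarrow> act_ori g f (a, b) \<longleftrightarrow> a \<in> V \<and> b \<in> V \<and> f (act (inv\<^bsub>K\<^esub> g) a, act (inv\<^bsub>K\<^esub> g) b)"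
  by (simp add: orientation_action_def)

lemma act_ori_Ori:
  assumes g: "g \<in> carrier K" and f: "f \<in> Ori"
  shows "act_ori g f \<in> Ori"
proof -
  let ?h = "act (inv\<^bsub>K\<^esub> g)"
  have h: "inv\<^bsub>K\<^esub> g \<in> carrier K" using g by simp
  have fE: "\<And>a b. f (a, b) \<Longrightarrow> {a, b} \<in> E" "\<And>a b. {a, b} \<in> E \<Longrightarrow> f (a, b) \<or> f (b, a)"
    and fS: "\<And>a S. finite S \<Longrightarrow> (\<forall>b\<in>S. f (a, b)) \<Longrightarrow> card S \<le> k"
    using f by (auto simp: orientations_def)
  have "{a, b} \<in> E" if "act_ori g f (a, b)" for a b
    using that fE(1) act_edge[OF h] by (auto simp: act_ori_apply[OF f])
  moreover have "act_ori g f (a, b) \<or> act_ori g f (b, a)" if "{a, b} \<in> E" for a b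
    using edge_V[OF that] that fE(2)[of "?h a" "?h b"] act_edge[OF h, of a b] by (simp add: act_ori_apply[OF f])
  moreover have "card S \<le> k" if S: "finite S" "\<forall>b\<in>S. act_ori g f (a, b)" for a S
  proof -
    have "S \<subseteq> V" "\<forall>b\<in>?h ` S. f (?h a, b)"
      using S(2) by (auto simp: act_ori_apply[OF f])
    moreover have "inj_on ?h S"
      using inj_prop[OF h] \<open>S \<subseteq> V\<close> by (rule inj_on_subset)
    ultimately show ?thesis
      using fS[of "?h ` S" "?h a"] S(1) by (simp add: card_image)
  qed
  ultimately show ?thesis
    unfolding orientations_def by blast
qed

lemma act_ori_mult:
  assumes g: "g \<in> carrier K" and h: "h \<in> carrier K" and f: "f \<in> Ori"
  shows "act_ori (g \<otimes>\<^bsub>K\<^esub> h) f = act_ori g (act_ori h f)"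
proof
  fix p :: "'v \<times> 'v"
  obtain a b where p: "p = (a, b)" by (cases p)
  have "act (inv\<^bsub>K\<^esub> (g \<otimes>\<^bsub>K\<^esub> h)) x = act (inv\<^bsub>K\<^esub> h) (act (inv\<^bsub>K\<^esub> g) x)" if "x \<in> V" for x
    using composition_rule[OF that, of "inv\<^bsub>K\<^esub> h" "inv\<^bsub>K\<^esub> g"] g h by (simp add: K.inv_mult_group)
  moreover have "act (inv\<^bsub>K\<^esub> g) x \<in> V" if "x \<in> V" for x
    using act_V[OF _ that] g by simp
  ultimately show "act_ori (g \<otimes>\<^bsub>K\<^esub> h) f p = act_ori g (act_ori h f) p"
    unfolding p act_ori_apply[OF f] act_ori_apply[OF act_ori_Ori[OF h f]] by metis
qed

lemma act_ori_one:
  assumes f: "f \<in> Ori"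
  shows "act_ori \<one>\<^bsub>K\<^esub> f = f"
proof
  fix p :: "'v \<times> 'v"
  obtain a b where p: "p = (a, b)" by (cases p)
  show "act_ori \<one>\<^bsub>K\<^esub> f p = f p"
    unfolding p using Ori_V[OF f] by (auto simp: act_ori_apply[OF f] act_one)
qed

lemma group_action_orientations: "group_action K Ori act_ori"
proof -
  have bij: "act_ori g \<in> Bij Ori" if g: "g \<in> carrier K" for g
  proof -
    have "bij_betw (act_ori g) Ori Ori"
    proof (rule bij_betw_byWitness[where f' = "act_ori (inv\<^bsub>K\<^esub> g)"])
      show "\<forall>f\<in>Ori. act_ori (inv\<^bsub>K\<^esub> g) (act_ori g f) = f"
        using g act_ori_mult[of "inv\<^bsub>K\<^esub> g" g] act_ori_one by simp
      show "\<forall>f\<in>Ori. act_ori g (act_ori (inv\<^bsub>K\<^esub> g) f) = f"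
        using g act_ori_mult[of g "inv\<^bsub>K\<^esub> g"] act_ori_one by simp
    qed (use g act_ori_Ori in auto)
    then show ?thesis
      by (simp add: Bij_def orientation_action_def)
  qed
  have "act_ori (g \<otimes>\<^bsub>K\<^esub> h) = compose Ori (act_ori g) (act_ori h)"
    if "g \<in> carrier K" "h \<in> carrier K" for g h
  proof
    fix f show "act_ori (g \<otimes>\<^bsub>K\<^esub> h) f = compose Ori (act_ori g) (act_ori h) f"
      using act_ori_mult[OF that, of f] by (cases "f \<in> Ori") (simp_all add: compose_def orientation_action_def)
  qed
  then have "act_ori \<in> hom K (BijGroup Ori)"
    using bij by (auto intro!: homI simp: BijGroup_def)
  then show ?thesis
    unfolding group_action_def group_hom_def group_hom_axioms_def
    using K.group_axioms group_BijGroup by blast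
qed

lemma topT: "topspace T = carrier K"
  using top_group by (simp add: topological_group_def)

text \<open>
  The value at \<open>(a, b)\<close> of the translate by \<open>g\<close> depends on
  \<open>g\<close> only through \<open>g\<inverse>a\<close> and \<open>g\<inverse>b\<close>,
  hence is locally constant in \<open>g\<close>.
\<close>

lemma continuous_action_orientations: "continuous_action K T (orientation_space k E) act_ori"
  unfolding continuous_action_def topspace_orientation_space
proof (intro conjI group_action_orientations)
  let ?P = "prod_topology T (orientation_space k E)"
  have topP: "topspace ?P = carrier K \<times> Ori"
    by (simp add: topT)
  have coord: "continuous_map ?P (discrete_topology UNIV) (\<lambda>(g, f). act_ori g f (a, b))" for a b
  proof -
    have "openin ?P {p \<in> topspace ?P. (case p of (g, f) \<Rightarrow> act_ori g f (a, b)) \<in> U}" for U :: "bool set"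
    proof (subst openin_subopen, intro ballI)
      fix p assume p: "p \<in> {p \<in> topspace ?P. (case p of (g, f) \<Rightarrow> act_ori g f (a, b)) \<in> U}"
      then obtain g f where gf: "p = (g, f)" "g \<in> carrier K" "f \<in> Ori" "act_ori g f (a, b) \<in> U"
        unfolding topP by auto
      show "\<exists>W. openin ?P W \<and> p \<in> W \<and> W \<subseteq> {p \<in> topspace ?P. (case p of (g, f) \<Rightarrow> act_ori g f (a, b)) \<in> U}"
      proof (cases "a \<in> V \<and> b \<in> V")
        case False
        then have "act_ori g' f' (a, b) \<in> U" if "f' \<in> Ori" for g' f'
        proof -
          have "act_ori g' f' (a, b) = act_ori g f (a, b)"
            using False act_ori_apply[OF that] act_ori_apply[OF gf(3)] by blast
          then show ?thesis using gf(4) by simp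
        qed
        then have "topspace ?P \<subseteq> {p \<in> topspace ?P. (case p of (g, f) \<Rightarrow> act_ori g f (a, b)) \<in> U}"
          unfolding topP by auto
        moreover have "p \<in> topspace ?P"
          using p by blast
        ultimately show ?thesis
          using openin_topspace[of ?P] by blast
      next
        case True
        let ?c = "act (inv\<^bsub>K\<^esub> g) a" and ?d = "act (inv\<^bsub>K\<^esub> g) b"
        have cd: "?c \<in> V" "?d \<in> V"
          using True gf(2) by (auto intro: act_V)
        let ?A = "{h \<in> carrier K. act h ?c = a} \<inter> {h \<in> carrier K. act h ?d = b}"
        let ?B = "{f' \<in> Ori. f' (?c, ?d) = f (?c, ?d)}"
        have ca: "continuous_action K T (discrete_topology V) act"
          using on_graph by (simp add: acts_on_graph_def)
        have "openin T ?A"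
          by (intro openin_Int openin_vertex_transporter[OF ca topT] cd)
        moreover have "openin (orientation_space k E) ?B"
        proof -
          have "?B = {f'. f' (?c, ?d) = f (?c, ?d)} \<inter> Ori" by auto
          then show ?thesis
            by (simp only: openin_subtopology_Int openin_cantor_coordinate)
        qed
        ultimately have "openin ?P (?A \<times> ?B)"
          by (simp add: openin_prod_Times_iff)
        moreover have "act g ?c = a" "act g ?d = b"
          using act_inv'[OF gf(2)] True by simp_all
        then have "p \<in> ?A \<times> ?B"
          using gf by simp
        moreover have "act_ori h f' (a, b) \<in> U" if "h \<in> ?A" "f' \<in> ?B" for h f'
        proof -
          have "act (inv\<^bsub>K\<^esub> h) a = ?c" "act (inv\<^bsub>K\<^esub> h) b = ?d"
            using that(1) act_inv[OF _ cd(1), of h] act_inv[OF _ cd(2), of h] by simp_all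
          then have "act_ori h f' (a, b) = act_ori g f (a, b)"
            using that(2) act_ori_apply[OF gf(3)] act_ori_apply[of f' h a b] by auto
          then show ?thesis using gf(4) by simp
        qed
        then have "?A \<times> ?B \<subseteq> {p \<in> topspace ?P. (case p of (g, f) \<Rightarrow> act_ori g f (a, b)) \<in> U}"
          unfolding topP by auto
        ultimately show ?thesis by blast
      qed
    qed
    then show ?thesis by (simp add: continuous_map_def)
  qed
  have "continuous_map ?P cantor_topology (\<lambda>(g, f). act_ori g f)"
    unfolding continuous_map_componentwise_UNIV
  proof
    fix q :: "'v \<times> 'v"
    obtain a b where q: "q = (a, b)" by (cases q)
    show "continuous_map ?P (discrete_topology UNIV) (\<lambda>x. (case x of (g, f) \<Rightarrow> act_ori g f) q)"
      using coord[of a b] unfolding q by (simp add: case_prod_unfold)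
  qed
  moreover have "(\<lambda>(g, f). act_ori g f) \<in> topspace ?P \<rightarrow> Ori"
    unfolding topP using act_ori_Ori by auto
  ultimately show "continuous_map ?P (orientation_space k E) (\<lambda>(g, f). act_ori g f)"
    by (simp add: continuous_map_in_subtopology image_subset_iff_funcset)
qed

lemma flow_orientations: "flow K T (orientation_space k E) act_ori"
  unfolding flow_def topspace_orientation_space
proof (intro conjI continuous_action_orientations)
  note cn = orientations_closed_nonempty[OF simple sparse]
  show "Ori \<noteq> {}" using cn by blast
  show "compact_space (orientation_space k E)"
    by (rule compact_space_subtopology[OF closedin_compact_space[OF compact_space_cantor conjunct1[OF cn]]])
  show "Hausdorff_space (orientation_space k E)"
    by (intro Hausdorff_space_subtopology) (simp add: Hausdorff_space_product_topology)
qed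

end

context graph_action
begin

text \<open>
  Here \<open>ev a b\<close> is the event that \<open>a\<close> points to \<open>b\<close> and
  \<open>m a b\<close> its probability. The bound \<open>k\<close> on out-degrees holds
  pointwise, so it holds for the expectation, and Markov's inequality bounds by
  \<open>2k\<close> the number of \<open>b\<close> with \<open>m a b \<ge> 1/2\<close>.
\<close>

lemma infinite_orbits_if_amenable:
  assumes "V \<noteq> {}" and valency: "\<And>x. x \<in> V \<Longrightarrow> infinite_valency E x" and am: "amenable K T"
  shows "infinite (orbits K (tuples V 2) (diagonal act))"
proof -
  obtain \<mu> where \<mu>: "invariant_borel_probability K (orientation_space k E) act_ori \<mu>"
    using amenable_flow[OF top_group am flow_orientations] by blast
  have sp: "space \<mu> = Ori" and se: "sets \<mu> = sigma_sets Ori {U. openin (orientation_space k E) U}"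
    and inv: "\<And>g. g \<in> carrier K \<Longrightarrow> distr \<mu> \<mu> (act_ori g) = \<mu>"
    using \<mu> by (auto simp: invariant_borel_probability_def)
  interpret prob_space \<mu>
    using \<mu> by (simp add: invariant_borel_probability_def)
  have cont: "continuous_map (orientation_space k E) (orientation_space k E) (act_ori g)"
    if g: "g \<in> carrier K" for g
  proof -
    have "continuous_map (orientation_space k E) (prod_topology T (orientation_space k E)) (\<lambda>f. (g, f))"
      using g topT by (simp add: continuous_map_pairedI)
    moreover have "continuous_map (prod_topology T (orientation_space k E)) (orientation_space k E)
        (\<lambda>(g, f). act_ori g f)"
      using continuous_action_orientations by (simp add: continuous_action_def)
    ultimately have "continuous_map (orientation_space k E) (orientation_space k E)
        ((\<lambda>(g, f). act_ori g f) \<circ> (\<lambda>f. (g, f)))"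
      by (rule continuous_map_compose)
    then show ?thesis by (simp add: o_def)
  qed
  have meas: "act_ori g \<in> measurable \<mu> \<mu>" if g: "g \<in> carrier K" for g
  proof (rule measurable_sigma_sets[OF se])
    show "{U. openin (orientation_space k E) U} \<subseteq> Pow Ori"
      using openin_subset[of "orientation_space k E"] by auto
    show "act_ori g \<in> space \<mu> \<rightarrow> Ori"
      using sp act_ori_Ori[OF g] by auto
    fix U assume U: "U \<in> {U. openin (orientation_space k E) U}"
    have "openin (orientation_space k E) {f \<in> topspace (orientation_space k E). act_ori g f \<in> U}"
      by (rule openin_continuous_map_preimage[OF cont[OF g]]) (use U in simp)
    moreover have "act_ori g -` U \<inter> space \<mu> = {f \<in> topspace (orientation_space k E). act_ori g f \<in> U}"
      using sp by auto
    ultimately have "openin (orientation_space k E) (act_ori g -` U \<inter> space \<mu>)"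
      by (simp only:)
    then show "act_ori g -` U \<inter> space \<mu> \<in> sets \<mu>"
      unfolding se by (intro sigma_sets.Basic) simp
  qed
  define ev where "ev a b = {f \<in> Ori. f (a, b)}" for a b
  have ev: "ev a b \<in> sets \<mu>" for a b
  proof -
    have "ev a b = {f. f (a, b) = True} \<inter> Ori"
      by (auto simp: ev_def)
    then have "openin (orientation_space k E) (ev a b)"
      by (simp only: openin_subtopology_Int openin_cantor_coordinate)
    then show ?thesis
      unfolding se by (intro sigma_sets.Basic) simp
  qed
  define m where "m a b = prob (ev a b)" for a b
  have m_inv: "m (act g a) (act g b) = m a b" if g: "g \<in> carrier K" and ab: "a \<in> V" "b \<in> V" for g a b
  proof -
    have "act_ori g f (act g a, act g b) = f (a, b)" if "f \<in> Ori" for f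
      using act_ori_apply[OF that, of g "act g a" "act g b"] act_inv[OF g] act_V[OF g] ab by simp
    then have "act_ori g -` ev (act g a) (act g b) \<inter> space \<mu> = ev a b"
      using act_ori_Ori[OF g] by (auto simp: ev_def sp)
    then have "measure (distr \<mu> \<mu> (act_ori g)) (ev (act g a) (act g b)) = m a b"
      using measure_distr[OF meas[OF g] ev] by (simp add: m_def)
    then show ?thesis
      using inv[OF g] by (simp add: m_def)
  qed
  have m_edge: "1 \<le> m a b + m b a" if "{a, b} \<in> E" for a b
  proof -
    have "ev a b \<union> ev b a = space \<mu>"
      using that by (auto simp: ev_def sp orientations_def)
    then show ?thesis
      using measure_Un_le[OF ev[of a b] ev[of b a]] prob_space by (simp add: m_def)
  qed
  have int_ev: "integrable \<mu> (indicat_real (ev a b))" for a b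
    by (rule integrable_real_indicator[OF ev]) (simp add: emeasure_eq_measure)
  have m_out: "(\<Sum>b\<in>S. m a b) \<le> k" if S: "finite S" for a S
  proof -
    have "(\<Sum>b\<in>S. m a b) = (\<Sum>b\<in>S. expectation (indicat_real (ev a b)))"
      using ev by (simp add: m_def)
    also have "\<dots> = expectation (\<lambda>f. \<Sum>b\<in>S. indicat_real (ev a b) f)"
      by (intro Bochner_Integration.integral_sum[symmetric] int_ev)
    also have "\<dots> \<le> k"
    proof (rule integral_le_const)
      show "integrable \<mu> (\<lambda>f. \<Sum>b\<in>S. indicat_real (ev a b) f)"
        by (intro Bochner_Integration.integrable_sum int_ev)
      have "(\<Sum>b\<in>S. indicat_real (ev a b) f) \<le> k" if f: "f \<in> space \<mu>" for f
      proof -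
        have "(\<Sum>b\<in>S. indicat_real (ev a b) f) = (\<Sum>b\<in>S. if f (a, b) then 1 else 0)"
          using f by (intro sum.cong) (auto simp: ev_def sp indicator_def)
        also have "\<dots> = card {b \<in> S. f (a, b)}"
          using S by (simp add: sum.If_cases Int_def)
        also have "real (card {b \<in> S. f (a, b)}) \<le> real k"
        proof -
          have out_k: "card S \<le> k" if "finite S" "\<forall>b\<in>S. f (a, b)" for S
            using f that by (simp add: sp orientations_def)
          have "card {b \<in> S. f (a, b)} \<le> k"
            by (rule out_k) (use S in auto)
          then show ?thesis by simp
        qed
        finally show ?thesis .
      qed
      then show "AE f in \<mu>. (\<Sum>b\<in>S. indicat_real (ev a b) f) \<le> k"
        by simp
    qed
    finally show ?thesis .
  qed
  define D where "D = {(a, b). {a, b} \<in> E \<and> 1 / 2 \<le> m a b}"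
  have D_V: "D \<subseteq> V \<times> V"
    using edge_V by (auto simp: D_def)
  have D_inv: "(act g a, act g b) \<in> D" if "g \<in> carrier K" "(a, b) \<in> D" for g a b
    using that m_inv[of g a b] act_edge[of g a b] edge_V[of a b] by (auto simp: D_def)
  have D_out: "finite (D `` {a}) \<and> card (D `` {a}) \<le> 2 * k" for a
  proof (rule finite_if_finite_subsets_card_bdd)
    fix S assume S: "S \<subseteq> D `` {a}" "finite S"
    have "real (card S) * (1 / 2) \<le> (\<Sum>b\<in>S. m a b)"
      using S by (intro sum_bounded_below) (auto simp: D_def)
    also have "\<dots> \<le> k"
      using S m_out by blast
    finally show "card S \<le> 2 * k" by linarith
  qed
  have D_in: "infinite (D\<inverse> `` {a})" if "a \<in> V" for a
  proof
    assume "finite (D\<inverse> `` {a})"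
    then have "finite (D\<inverse> `` {a} \<union> D `` {a})"
      using D_out by simp
    moreover have "{b. {a, b} \<in> E} \<subseteq> D\<inverse> `` {a} \<union> D `` {a}"
    proof
      fix b assume "b \<in> {b. {a, b} \<in> E}"
      then have "{a, b} \<in> E" "{b, a} \<in> E" "1 / 2 \<le> m a b \<or> 1 / 2 \<le> m b a"
        using m_edge[of a b] by (auto simp: insert_commute)
      then show "b \<in> D\<inverse> `` {a} \<union> D `` {a}"
        by (auto simp: D_def)
    qed
    ultimately have "finite {b. {a, b} \<in> E}"
      by (rule finite_subset[rotated])
    then show False
      using valency[OF that] by (simp add: infinite_valency_def)
  qed
  show ?thesis
    by (rule infinite_orbits_of_invariant_relation[OF group_action_axioms assms(1) D_V D_inv D_out D_in])
qed

end

lemma topological_group_subgroup: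
  assumes G: "topological_group G T" and H: "subgroup H G"
  shows "topological_group (subgroup_as_group G H) (subtopology T H)"
proof -
  interpret group G
    using G by (simp add: topological_group_def)
  have HG: "H \<subseteq> carrier G" and topT: "topspace T = carrier G"
    using subgroup.subset[OF H] G by (auto simp: topological_group_def)
  let ?T = "subtopology T H"
  have "group (subgroup_as_group G H)"
    using subgroup.subgroup_is_group[OF H] group_axioms by blast
  moreover have "topspace ?T = H"
    using HG topT by auto
  moreover have "continuous_map (prod_topology ?T ?T) ?T (\<lambda>(x, y). x \<otimes>\<^bsub>G\<^esub> y)"
  proof -
    have eq: "prod_topology ?T ?T = subtopology (prod_topology T T) (H \<times> H)"
      by (simp add: subtopology_Times)
    have "continuous_map (prod_topology ?T ?T) T (\<lambda>(x, y). x \<otimes>\<^bsub>G\<^esub> y)"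
      unfolding eq using G by (intro continuous_map_from_subtopology) (simp add: topological_group_def)
    then show ?thesis
      unfolding continuous_map_in_subtopology using subgroup.m_closed[OF H] by auto
  qed
  moreover have "continuous_map ?T ?T (\<lambda>x. inv\<^bsub>subgroup_as_group G H\<^esub> x)"
  proof -
    have "continuous_map ?T ?T (\<lambda>x. inv\<^bsub>G\<^esub> x)"
      unfolding continuous_map_in_subtopology
      using G subgroup.m_inv_closed[OF H]
      by (auto simp: topological_group_def intro: continuous_map_from_subtopology)
    then show ?thesis
      by (rule continuous_map_eq) (use m_inv_consistent[OF H] in auto)
  qed
  ultimately show ?thesis
    by (simp add: topological_group_def)
qed

lemma acts_on_graph_subgroup:
  assumes act: "acts_on_graph G T V E act" and H: "subgroup H G"
  shows "acts_on_graph (subgroup_as_group G H) (subtopology T H) V E act"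
proof -
  interpret group_action G V act
    using act by (simp add: acts_on_graph_def continuous_action_def)
  have HG: "H \<subseteq> carrier G"
    using subgroup.subset[OF H] .
  have hom: "group_hom G (BijGroup V) act"
    by (rule group_hom)
  then have "group (subgroup_as_group G H)"
    using subgroup.subgroup_is_group[OF H] by (simp add: group_hom_def)
  moreover have "act \<in> hom (subgroup_as_group G H) (BijGroup V)"
    using group_hom.homh[OF hom] HG by (auto simp: hom_def Pi_iff subset_iff)
  ultimately have "group_action (subgroup_as_group G H) V act"
    using hom by (simp add: group_action_def group_hom_def group_hom_axioms_def)
  moreover have "continuous_map (prod_topology (subtopology T H) (discrete_topology V)) (discrete_topology V)
      (\<lambda>(g, x). act g x)"
  proof -
    have "prod_topology (subtopology T H) (discrete_topology V) =
        subtopology (prod_topology T (discrete_topology V)) (H \<times> V)"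
      using subtopology_Times[of T "discrete_topology V" H V] by simp
    then show ?thesis
      using act by (auto simp: acts_on_graph_def continuous_action_def intro: continuous_map_from_subtopology)
  qed
  ultimately show ?thesis
    using act HG by (auto simp: acts_on_graph_def continuous_action_def)
qed

theorem amenable_subgroup_infinite_orbits:
  assumes "V \<noteq> {}" "simple_graph V E" "k_sparse k V E" "\<forall>x\<in>V. infinite_valency E x"
    and G: "topological_group G T" and act: "acts_on_graph G T V E act" and H: "subgroup H G"
    and am: "amenable (subgroup_as_group G H) (subtopology T H)"
  shows "infinite (orbits (subgroup_as_group G H) (tuples V 2) (diagonal act))"
proof -
  interpret graph_action "subgroup_as_group G H" "subtopology T H" V E act k
    using assms(2,3) topological_group_subgroup[OF G H] acts_on_graph_subgroup[OF act H]
    by unfold_locales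
  show ?thesis
    using infinite_orbits_if_amenable assms(1,4) am by blast
qed

section \<open>Predimension and free amalgamation\<close>

text \<open>
  Hrushovski's predimension, for a set system \<open>E\<close> in place of a graph. The weight 2
  leaves room for a new vertex to be attached by one edge with positive gain.
\<close>

definition predim :: "'v set set \<Rightarrow> 'v set \<Rightarrow> int" where
  "predim E B = 2 * int (card B) - int (card {e \<in> E. e \<subseteq> B})"

text \<open>
  The class that is amalgamated. Nonnegativity of the predimension is 2-sparsity; it is stated
  separately because \<open>nat\<close> truncates negative values in the exponential bound.
\<close>

definition tame :: "'v set set \<Rightarrow> 'v set \<Rightarrow> bool" where
  "tame E U \<longleftrightarrow> (\<forall>B. finite B \<and> B \<subseteq> U \<longrightarrow> 0 \<le> predim E B \<and> card B \<le> 2 ^ nat (predim E B))"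

text \<open>
  The strict form of self-sufficiency, in which supersets of equal predimension are excluded as
  well. The strict inequality is the gain of one on which \<open>tame_free_amalgam\<close>
  relies.
\<close>

definition strong :: "'v set set \<Rightarrow> 'v set \<Rightarrow> 'v set \<Rightarrow> bool" where
  "strong E U A \<longleftrightarrow> finite A \<and> A \<subseteq> U \<and>
     (\<forall>B. finite B \<and> A \<subset> B \<and> B \<subseteq> U \<longrightarrow> predim E A < predim E B)"

definition embedding :: "'v set set \<Rightarrow> 'v set \<Rightarrow> 'w set set \<Rightarrow> ('v \<Rightarrow> 'w) \<Rightarrow> bool" where
  "embedding F C E g \<longleftrightarrow> inj_on g C \<and> (\<forall>X\<subseteq>C. X \<in> F \<longleftrightarrow> g ` X \<in> E)"

lemma finite_edges_within: "finite B \<Longrightarrow> finite {e \<in> E. e \<subseteq> B}"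
  by (rule finite_subset[of _ "Pow B"]) auto

lemma predim_cong:
  assumes "\<And>e. e \<subseteq> B \<Longrightarrow> e \<in> E \<longleftrightarrow> e \<in> F"
  shows "predim E B = predim F B"
proof -
  have "{e \<in> E. e \<subseteq> B} = {e \<in> F. e \<subseteq> B}"
    using assms by auto
  then show ?thesis by (simp add: predim_def)
qed

lemma tame_cong:
  assumes "\<And>e. e \<subseteq> U \<Longrightarrow> e \<in> E \<longleftrightarrow> e \<in> F"
  shows "tame E U \<longleftrightarrow> tame F U"
proof -
  have "predim E B = predim F B" if "B \<subseteq> U" for B
    using assms that by (intro predim_cong) auto
  then show ?thesis by (simp add: tame_def cong: conj_cong)
qed

lemma strong_cong:
  assumes "\<And>e. e \<subseteq> U \<Longrightarrow> e \<in> E \<longleftrightarrow> e \<in> F"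
  shows "strong E U A \<longleftrightarrow> strong F U A"
proof -
  have "predim E B = predim F B" if "B \<subseteq> U" for B
    using assms that by (intro predim_cong) auto
  then show ?thesis by (auto simp: strong_def)
qed

lemma tame_mono: "tame E U \<Longrightarrow> W \<subseteq> U \<Longrightarrow> tame E W"
  unfolding tame_def by blast

lemma strong_mono: "strong E U A \<Longrightarrow> W \<subseteq> U \<Longrightarrow> A \<subseteq> W \<Longrightarrow> strong E W A"
  unfolding strong_def by blast

lemma strong_self: "finite A \<Longrightarrow> strong E A A"
  unfolding strong_def by blast

lemma embedding_subset: "embedding F C E g \<Longrightarrow> B \<subseteq> C \<Longrightarrow> embedding F B E g"
  unfolding embedding_def by (auto intro: inj_on_subset)

lemma embedding_cong:
  assumes "\<And>x. x \<in> C \<Longrightarrow> f x = g x"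
  shows "embedding F C E f \<longleftrightarrow> embedding F C E g"
proof -
  have "f ` X = g ` X" if "X \<subseteq> C" for X
    using assms that by (auto intro!: image_cong)
  moreover have "inj_on f C \<longleftrightarrow> inj_on g C"
    using assms by (rule inj_on_cong)
  ultimately show ?thesis by (simp add: embedding_def)
qed

text \<open>
  Embeddings are isomorphisms onto induced substructures, so predimension, tameness and strength
  transfer along them.
\<close>

lemma predim_embedding:
  assumes "embedding F B E g"
  shows "predim E (g ` B) = predim F B"
proof -
  have inj: "inj_on g B" and iff: "\<And>X. X \<subseteq> B \<Longrightarrow> X \<in> F \<longleftrightarrow> g ` X \<in> E"
    using assms by (auto simp: embedding_def)
  have "{e \<in> E. e \<subseteq> g ` B} = (`) g ` {e \<in> F. e \<subseteq> B}"
  proof (intro equalityI subsetI)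
    fix e assume e: "e \<in> {e \<in> E. e \<subseteq> g ` B}"
    then obtain X where "X \<subseteq> B" "e = g ` X"
      by (auto simp: subset_image_iff)
    with e iff show "e \<in> (`) g ` {e \<in> F. e \<subseteq> B}" by auto
  qed (use iff in auto)
  moreover have "inj_on ((`) g) {e \<in> F. e \<subseteq> B}"
    by (rule inj_on_subset[OF inj_on_image_Pow[OF inj]]) auto
  ultimately show ?thesis
    using inj by (simp add: predim_def card_image)
qed

lemma tame_embedding:
  assumes "embedding F C E g" "tame F C"
  shows "tame E (g ` C)"
  unfolding tame_def
proof (intro allI impI)
  fix B assume B: "finite B \<and> B \<subseteq> g ` C"
  have inj: "inj_on g C"
    using assms(1) by (simp add: embedding_def)
  obtain D where D: "D \<subseteq> C" "B = g ` D"
    using B by (auto simp: subset_image_iff)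
  then have "finite D"
    using B inj by (metis finite_imageD inj_on_subset)
  moreover have "predim E B = predim F D"
    using D predim_embedding[OF embedding_subset[OF assms(1)]] by simp
  moreover have "card B = card D"
    using D inj by (metis card_image inj_on_subset)
  ultimately show "0 \<le> predim E B \<and> card B \<le> 2 ^ nat (predim E B)"
    using assms(2) D(1) by (simp add: tame_def)
qed

lemma strong_embedding:
  assumes "embedding F C E g" "strong F C A"
  shows "strong E (g ` C) (g ` A)"
  unfolding strong_def
proof (intro conjI allI impI)
  show "finite (g ` A)" "g ` A \<subseteq> g ` C"
    using assms(2) by (auto simp: strong_def)
  fix B assume B: "finite B \<and> g ` A \<subset> B \<and> B \<subseteq> g ` C"
  have inj: "inj_on g C"
    using assms(1) by (simp add: embedding_def)
  obtain D where D: "D \<subseteq> C" "B = g ` D"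
    using B by (auto simp: subset_image_iff)
  have AC: "A \<subseteq> C"
    using assms(2) by (simp add: strong_def)
  have "finite D"
    using D B inj by (metis finite_imageD inj_on_subset)
  moreover have "A \<subset> D"
  proof -
    have "x \<in> D" if "x \<in> A" for x
      using that B D AC inj inj_on_image_mem_iff[OF inj, of x D] by blast
    then show ?thesis
      using B D by blast
  qed
  ultimately have "predim F A < predim F D"
    using assms(2) D(1) by (simp add: strong_def)
  then show "predim E (g ` A) < predim E B"
    using D AC predim_embedding[OF embedding_subset[OF assms(1)]] by simp
qed

text \<open>
  Submodularity: an edge inside \<open>B\<close> or inside \<open>C\<close> lies inside the
  union, and equality holds if there are no other edges in the union, that is, if the union is a
  free amalgam.
\<close>

lemma predim_submodular:
  assumes "finite B" "finite C"
  shows "predim E (B \<union> C) + predim E (B \<inter> C) \<le> predim E B + predim E C"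
proof -
  let ?e = "\<lambda>B. {e \<in> E. e \<subseteq> B}"
  have "card (?e B) + card (?e C) = card (?e B \<union> ?e C) + card (?e B \<inter> ?e C)"
    using assms by (intro card_Un_Int finite_edges_within)
  moreover have "?e B \<inter> ?e C = ?e (B \<inter> C)"
    by auto
  moreover have "card (?e B \<union> ?e C) \<le> card (?e (B \<union> C))"
    by (rule card_mono) (use assms in \<open>auto intro: finite_edges_within\<close>)
  moreover have "card B + card C = card (B \<union> C) + card (B \<inter> C)"
    using assms by (rule card_Un_Int)
  ultimately show ?thesis
    unfolding predim_def by simp
qed

lemma predim_free_amalgam:
  assumes "finite B" "finite C" "\<And>e. e \<in> E \<Longrightarrow> e \<subseteq> B \<union> C \<Longrightarrow> e \<subseteq> B \<or> e \<subseteq> C"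
  shows "predim E (B \<union> C) + predim E (B \<inter> C) = predim E B + predim E C"
proof -
  let ?e = "\<lambda>B. {e \<in> E. e \<subseteq> B}"
  have "card (?e B) + card (?e C) = card (?e B \<union> ?e C) + card (?e B \<inter> ?e C)"
    using assms by (intro card_Un_Int finite_edges_within)
  moreover have "?e B \<inter> ?e C = ?e (B \<inter> C)" "?e B \<union> ?e C = ?e (B \<union> C)"
    using assms(3) by auto
  moreover have "card B + card C = card (B \<union> C) + card (B \<inter> C)"
    using assms(1,2) by (rule card_Un_Int)
  ultimately show ?thesis
    unfolding predim_def by simp
qed

text \<open>
  By submodularity, passing from \<open>D\<close> to its trace on a strong set loses at least as
  much predimension as passing from \<open>A \<union> D\<close> to \<open>A\<close>.
\<close>

lemma strong_Int_less:
  assumes "strong E U A" "finite D" "D \<subseteq> U" "\<not> D \<subseteq> A"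
  shows "predim E (A \<inter> D) < predim E D"
proof -
  have "predim E A < predim E (A \<union> D)"
  proof -
    have "finite (A \<union> D)" "A \<subset> A \<union> D" "A \<union> D \<subseteq> U"
      using assms by (auto simp: strong_def)
    then show ?thesis
      using assms(1) unfolding strong_def by blast
  qed
  also have "predim E (A \<union> D) \<le> predim E A + predim E D - predim E (A \<inter> D)"
    using predim_submodular[of A D E] assms by (simp add: strong_def)
  finally show ?thesis by simp
qed

lemma predim_split:
  assumes free: "\<And>e. e \<in> E \<Longrightarrow> e \<subseteq> B \<union> C \<Longrightarrow> e \<subseteq> B \<or> e \<subseteq> C"
    and "finite D" "D \<subseteq> B \<union> C"
  shows "predim E D = predim E (D \<inter> B) + predim E (D \<inter> C) - predim E (D \<inter> (B \<inter> C))"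
proof -
  have "predim E ((D \<inter> B) \<union> (D \<inter> C)) + predim E ((D \<inter> B) \<inter> (D \<inter> C))
      = predim E (D \<inter> B) + predim E (D \<inter> C)"
    by (rule predim_free_amalgam) (use assms in auto)
  moreover have "(D \<inter> B) \<union> (D \<inter> C) = D" "(D \<inter> B) \<inter> (D \<inter> C) = D \<inter> (B \<inter> C)"
    using assms(3) by auto
  ultimately show ?thesis by simp
qed

text \<open>
  In a free amalgam over \<open>B \<inter> C\<close> that is strong in \<open>C\<close>, the
  part of \<open>D\<close> in \<open>C\<close> adds positive predimension to the part in
  \<open>B\<close>. With the roles of \<open>B\<close> and \<open>C\<close> exchanged the lemma
  also shows that each side is strong in the amalgam.
\<close>

lemma strong_free_amalgam:
  assumes free: "\<And>e. e \<in> E \<Longrightarrow> e \<subseteq> B \<union> C \<Longrightarrow> e \<subseteq> B \<or> e \<subseteq> C"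
    and C: "strong E C (B \<inter> C)" and S: "strong E B S"
  shows "strong E (B \<union> C) S"
  unfolding strong_def
proof (intro conjI allI impI)
  show "finite S" "S \<subseteq> B \<union> C"
    using S by (auto simp: strong_def)
  fix D assume D: "finite D \<and> S \<subset> D \<and> D \<subseteq> B \<union> C"
  have split: "predim E D = predim E (D \<inter> B) + predim E (D \<inter> C) - predim E (D \<inter> (B \<inter> C))"
    using predim_split[OF free] D by blast
  have SB: "S \<subseteq> B"
    using S by (simp add: strong_def)
  show "predim E S < predim E D"
  proof (cases "D \<subseteq> B")
    case True
    then show ?thesis using S D by (simp add: strong_def)
  next
    case False
    have "predim E ((B \<inter> C) \<inter> (D \<inter> C)) < predim E (D \<inter> C)"
      by (rule strong_Int_less[OF C]) (use D False in auto)
    moreover have "(B \<inter> C) \<inter> (D \<inter> C) = D \<inter> (B \<inter> C)"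
      by auto
    moreover have "predim E S \<le> predim E (D \<inter> B)"
    proof (cases "S = D \<inter> B")
      case False
      then have "S \<subset> D \<inter> B" "finite (D \<inter> B)"
        using D SB by auto
      then have "predim E S < predim E (D \<inter> B)"
        using S unfolding strong_def by blast
      then show ?thesis by simp
    qed simp
    ultimately show ?thesis using split by simp
  qed
qed

text \<open>
  If \<open>D\<close> lies in neither side, then its predimension exceeds that of both \<open>D
  \<inter> B\<close> and \<open>D \<inter> C\<close> by at least one, while its size is at most
  twice that of the larger of them. This is what the base 2 in \<open>tame\<close> is for.
\<close>

lemma tame_free_amalgam:
  assumes free: "\<And>e. e \<in> E \<Longrightarrow> e \<subseteq> B \<union> C \<Longrightarrow> e \<subseteq> B \<or> e \<subseteq> C"
    and "strong E B (B \<inter> C)" "strong E C (B \<inter> C)" "tame E B" "tame E C"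
  shows "tame E (B \<union> C)"
  unfolding tame_def
proof (intro allI impI)
  fix D assume D: "finite D \<and> D \<subseteq> B \<union> C"
  show "0 \<le> predim E D \<and> card D \<le> 2 ^ nat (predim E D)"
  proof (cases "D \<subseteq> B \<or> D \<subseteq> C")
    case True
    then show ?thesis using D assms by (auto simp: tame_def)
  next
    case False
    have split: "predim E D = predim E (D \<inter> B) + predim E (D \<inter> C) - predim E (D \<inter> (B \<inter> C))"
      using predim_split[OF free] D by blast
    have "predim E ((B \<inter> C) \<inter> (D \<inter> B)) < predim E (D \<inter> B)"
      by (rule strong_Int_less[OF assms(2)]) (use D False in auto)
    moreover have "predim E ((B \<inter> C) \<inter> (D \<inter> C)) < predim E (D \<inter> C)"
      by (rule strong_Int_less[OF assms(3)]) (use D False in auto)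
    moreover have "(B \<inter> C) \<inter> (D \<inter> B) = D \<inter> (B \<inter> C)" "(B \<inter> C) \<inter> (D \<inter> C) = D \<inter> (B \<inter> C)"
      by auto
    ultimately have less: "predim E (D \<inter> B) < predim E D" "predim E (D \<inter> C) < predim E D"
      using split by simp_all
    have B: "0 \<le> predim E (D \<inter> B)" "card (D \<inter> B) \<le> 2 ^ nat (predim E (D \<inter> B))"
      and C: "0 \<le> predim E (D \<inter> C)" "card (D \<inter> C) \<le> 2 ^ nat (predim E (D \<inter> C))"
      using assms(4,5) D by (auto simp: tame_def)
    define m where "m = nat (predim E D) - 1"
    have m: "nat (predim E D) = Suc m" "nat (predim E (D \<inter> B)) \<le> m" "nat (predim E (D \<inter> C)) \<le> m"
      using less B(1) C(1) by (auto simp: m_def)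
    have "card D \<le> card (D \<inter> B) + card (D \<inter> C)"
      using D card_Un_le[of "D \<inter> B" "D \<inter> C"] by (metis Int_Un_distrib inf.absorb1)
    also have "\<dots> \<le> 2 ^ m + 2 ^ m"
      by (intro add_mono order_trans[OF B(2)] order_trans[OF C(2)] power_increasing m) auto
    also have "\<dots> = 2 ^ nat (predim E D)"
      using m(1) by simp
    finally show ?thesis using less B(1) by simp
  qed
qed

text \<open>
  Among the finite supersets of \<open>X\<close> choose one of least predimension and then of
  largest size. The maximum exists because such a set has predimension at most \<open>predim E X
  \<le> 2 |X|\<close>, so tameness bounds its size.
\<close>

lemma strong_hull:
  assumes "tame E U" "finite X" "X \<subseteq> U"
  obtains Y where "X \<subseteq> Y" "strong E U Y" "card Y \<le> 2 ^ (2 * card X)"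
proof -
  let ?K = "(2::nat) ^ (2 * card X)"
  define Q where "Q Y \<longleftrightarrow> finite Y \<and> X \<subseteq> Y \<and> Y \<subseteq> U" for Y
  have nonneg: "0 \<le> predim E Y" if "Q Y" for Y
    using that assms(1) by (simp add: Q_def tame_def)
  \<comment> \<open>\<open>predim E Y0\<close> is the least predimension of a finite superset; \<open>Y\<close> below attains it with largest size.\<close>
  obtain Y0 where Y0: "Q Y0" "\<forall>Y. Q Y \<longrightarrow> nat (predim E Y0) \<le> nat (predim E Y)"
    using ex_has_least_nat[of Q X "\<lambda>Y. nat (predim E Y)"] assms by (auto simp: Q_def)
  have least: "predim E Y0 \<le> predim E Y" if "Q Y" for Y
    using Y0 nonneg that by (metis nat_le_eq_zle)
  have bound: "card Y \<le> ?K" if "Q Y" "predim E Y = predim E Y0" for Y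
  proof -
    have "predim E Y \<le> predim E X"
      using least[of X] that assms by (simp add: Q_def)
    also have "\<dots> \<le> 2 * int (card X)"
      by (simp add: predim_def)
    finally have "nat (predim E Y) \<le> 2 * card X" by simp
    then have "(2::nat) ^ nat (predim E Y) \<le> ?K"
      by (intro power_increasing) auto
    moreover have "card Y \<le> 2 ^ nat (predim E Y)"
      using assms(1) that(1) by (simp add: tame_def Q_def)
    ultimately show ?thesis
      by (rule order_trans[rotated])
  qed
  obtain Y where Y: "Q Y \<and> predim E Y = predim E Y0"
    "\<forall>Z. Q Z \<and> predim E Z = predim E Y0 \<longrightarrow> card Z \<le> card Y"
  proof -
    have "\<forall>Y. Q Y \<and> predim E Y = predim E Y0 \<longrightarrow> card Y < Suc ?K"
      using bound by (simp add: less_Suc_eq_le)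
    from ex_has_greatest_nat[of "\<lambda>Y. Q Y \<and> predim E Y = predim E Y0", OF _ this] show ?thesis
      using Y0(1) that by blast
  qed
  have "strong E U Y"
    unfolding strong_def
  proof (intro conjI allI impI)
    show "finite Y" "Y \<subseteq> U" using Y(1) by (auto simp: Q_def)
    fix Z assume Z: "finite Z \<and> Y \<subset> Z \<and> Z \<subseteq> U"
    then have "Q Z" using Y(1) by (auto simp: Q_def)
    moreover have "card Y < card Z"
      using Z by (simp add: psubset_card_mono)
    ultimately show "predim E Y < predim E Z"
      using Y least[OF \<open>Q Z\<close>] by (metis leD order_le_less)
  qed
  then show ?thesis
    using that Y(1) bound by (auto simp: Q_def)
qed

text \<open>
  One amalgamation step. The graph \<open>E\<close> lives on all natural numbers, those from
  \<open>N\<close> on being isolated so far. A copy of \<open>C\<close> is glued to it freely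
  along \<open>p\<close>, using fresh isolated points for \<open>C - A\<close>. Only sets below
  \<open>N\<close> are promised to remain strong, since a fresh point of a larger set may
  acquire edges.
\<close>

lemma strong_realize_type:
  fixes E :: "nat set set" and p :: "'c \<Rightarrow> nat"
  assumes E: "E \<subseteq> Pow {..<N}" "\<forall>e\<in>E. card e = 2" "tame E UNIV"
    and F: "finite C" "F \<subseteq> Pow C" "\<forall>e\<in>F. card e = 2" "tame F C" "strong F C A"
    and p: "embedding F A E p" "strong E UNIV (p ` A)" "p ` A \<subseteq> {..<N}"
  obtains N' E' g where "N \<le> N'" "E' \<subseteq> Pow {..<N'}" "\<forall>e\<in>E'. card e = 2" "tame E' UNIV"
    "{e \<in> E'. e \<subseteq> {..<N}} = E"
    "\<And>S. S \<subseteq> {..<N} \<Longrightarrow> strong E UNIV S \<Longrightarrow> strong E' UNIV S"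
    "embedding F C E' g" "strong E' UNIV (g ` C)" "g ` C \<subseteq> {..<N'}"
    "\<And>x. x \<in> A \<Longrightarrow> g x = p x"
proof -
  have AC: "A \<subseteq> C" "finite A"
    using F(5) by (auto simp: strong_def)
  have injp: "inj_on p A"
    using p(1) by (simp add: embedding_def)
  obtain c :: "'c \<Rightarrow> nat" where c: "inj_on c C"
    using finite_imp_inj_to_nat_seg[OF F(1)] by blast
  define g where "g x = (if x \<in> A then p x else N + c x)" for x
  have gA: "g x = p x" if "x \<in> A" for x
    using that by (simp add: g_def)
  have g_old: "x \<in> A" if "x \<in> C" "g x < N" for x
    using that by (auto simp: g_def split: if_splits)
  have pN: "p x < N" if "x \<in> A" for x
    using that p(3) by auto
  have injg: "inj_on g C"
  proof (rule inj_onI)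
    fix x y assume "x \<in> C" "y \<in> C" "g x = g y"
    then show "x = y"
      using pN[of x] pN[of y] injp c by (auto simp: g_def inj_on_def split: if_splits)
  qed
  have gimA: "g ` X = p ` X" if "X \<subseteq> A" for X
    using that gA by (intro image_cong) auto
  define E' where "E' = E \<union> (`) g ` F"
  obtain N0::nat where N0: "\<And>x. x \<in> g ` C \<Longrightarrow> x < N0"
    using finite_imageI[OF F(1), of g] unfolding finite_nat_set_iff_bounded by blast
  have emb: "embedding F C E' g"
    unfolding embedding_def
  proof (intro conjI allI impI injg)
    fix X assume X: "X \<subseteq> C"
    show "X \<in> F \<longleftrightarrow> g ` X \<in> E'"
    proof
      assume "g ` X \<in> E'"
      then consider "g ` X \<in> E" | Y where "Y \<in> F" "g ` X = g ` Y"
        by (auto simp: E'_def)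
      then show "X \<in> F"
      proof cases
        case 1
        then have "\<forall>x\<in>X. g x < N"
          using E(1) by auto
        then have "X \<subseteq> A"
          using g_old X by blast
        with 1 gimA p(1) show ?thesis by (auto simp: embedding_def)
      next
        case 2
        then show ?thesis
          using injg X F(2) by (metis PowD inj_on_image_eq_iff subsetD)
      qed
    qed (simp add: E'_def)
  qed
  \<comment> \<open>The two sides of the amalgam are everything except the fresh points, and the copy of \<open>C\<close>.\<close>
  define B where "B = - g ` (C - A)"
  have BC: "B \<union> g ` C = UNIV" "B \<inter> g ` C = p ` A"
  proof -
    show "B \<union> g ` C = UNIV"
      by (auto simp: B_def)
    have "g ` (C - (C - A)) = g ` C - g ` (C - A)"
      using injg by (rule inj_on_image_set_diff) auto
    moreover have "C - (C - A) = A"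
      using AC by blast
    ultimately show "B \<inter> g ` C = p ` A"
      using gimA[of A] by (auto simp: B_def)
  qed
  have NB: "{..<N} \<subseteq> B"
    using g_old by (auto simp: B_def)
  have free: "e \<subseteq> B \<or> e \<subseteq> g ` C" if "e \<in> E'" for e
  proof -
    have "e \<in> E \<or> (\<exists>X\<in>F. e = g ` X)"
      using that by (auto simp: E'_def)
    then show ?thesis
    proof
      assume "e \<in> E"
      then show ?thesis using NB E(1) by blast
    next
      assume "\<exists>X\<in>F. e = g ` X"
      then show ?thesis using F(2) by blast
    qed
  qed
  have E'B: "e \<in> E' \<longleftrightarrow> e \<in> E" if "e \<subseteq> B" for e
  proof
    assume "e \<in> E'"
    then show "e \<in> E"
    proof (unfold E'_def, elim UnE imageE)
      fix X assume X: "e = g ` X" "X \<in> F"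
      then have "X \<subseteq> C" using F(2) by blast
      then have "g ` X \<subseteq> p ` A"
        using X that BC(2) by blast
      then have "X \<subseteq> A"
        using \<open>X \<subseteq> C\<close> g_old pN by fastforce
      then show ?thesis
        using X gimA p(1) by (auto simp: embedding_def)
    qed
  qed (simp add: E'_def)
  have tameB: "tame E' B"
    using tame_cong[OF E'B] E(3) tame_mono by blast
  have strongB: "strong E' B S" if "S \<subseteq> {..<N}" "strong E UNIV S" for S
    using strong_cong[OF E'B] strong_mono[OF that(2)] that(1) NB by blast
  have tameC: "tame E' (g ` C)"
    by (rule tame_embedding[OF emb F(4)])
  have strongC: "strong E' (g ` C) (B \<inter> g ` C)"
    using strong_embedding[OF emb F(5)] gimA[of A] BC(2) by simp
  have strongBA: "strong E' B (B \<inter> g ` C)"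
    using strongB[OF p(3,2)] BC(2) by simp
  show ?thesis
  proof (rule that[of "max N N0" E' g])
    show "E' \<subseteq> Pow {..<max N N0}"
    proof
      fix e assume "e \<in> E'"
      then have "e \<subseteq> {..<N} \<or> e \<subseteq> g ` C"
        unfolding E'_def using E(1) F(2) by blast
      then show "e \<in> Pow {..<max N N0}"
        using N0 by (force simp: less_max_iff_disj)
    qed
    show "\<forall>e\<in>E'. card e = 2"
      using E(2) F(2,3) injg unfolding E'_def
      by (auto simp: card_image inj_on_subset)
    show "tame E' UNIV"
      using tame_free_amalgam[OF free strongBA strongC tameB tameC] BC by simp
    show "{e \<in> E'. e \<subseteq> {..<N}} = E"
      using E'B NB E(1) by blast
    show "strong E' UNIV S" if "S \<subseteq> {..<N}" "strong E UNIV S" for S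
      using strong_free_amalgam[OF free strongC strongB[OF that]] BC by simp
    have swap: "B \<inter> g ` C = g ` C \<inter> B" "B \<union> g ` C = g ` C \<union> B"
      by auto
    have free': "e \<subseteq> g ` C \<or> e \<subseteq> B" if "e \<in> E'" for e
      using free[OF that] by blast
    show "strong E' UNIV (g ` C)"
      using strong_free_amalgam[OF free' strongBA[unfolded swap(1)] strong_self] F(1) BC swap by simp
    show "g ` C \<subseteq> {..<max N N0}"
      using N0 by (force simp: less_max_iff_disj)
  qed (use emb gA in auto)
qed

section \<open>The generic graph\<close>

text \<open>
  An extension problem over a finite strong set: a finite graph \<open>F\<close> of the class on
  \<open>C\<close>, a strong subset \<open>A\<close> of it, and a copy \<open>p\<close> of
  \<open>A\<close> that is already strong in \<open>E\<close>.
\<close>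

definition type_over :: "'v set set \<Rightarrow> 'c set \<times> 'c set set \<times> 'c set \<times> ('c \<Rightarrow> 'v) \<Rightarrow> bool" where
  "type_over E = (\<lambda>(C, F, A, p). finite C \<and> F \<subseteq> Pow C \<and> (\<forall>e\<in>F. card e = 2) \<and> tame F C \<and>
     strong F C A \<and> embedding F A E p \<and> strong E UNIV (p ` A))"

definition realizes :: "'v set set \<Rightarrow> 'c set \<times> 'c set set \<times> 'c set \<times> ('c \<Rightarrow> 'v) \<Rightarrow> ('c \<Rightarrow> 'v) \<Rightarrow> bool" where
  "realizes E = (\<lambda>(C, F, A, p) g. (\<forall>x\<in>A. g x = p x) \<and> embedding F C E g \<and> strong E UNIV (g ` C))"

definition generic :: "nat set set \<Rightarrow> bool" where
  "generic E \<longleftrightarrow> (\<forall>e\<in>E. card e = 2) \<and> tame E UNIV \<and>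
     (\<forall>t :: nat set \<times> nat set set \<times> nat set \<times> (nat \<Rightarrow> nat). type_over E t \<longrightarrow> (\<exists>g. realizes E t g))"

text \<open>
  The starting point of the construction: without edges the predimension of \<open>B\<close> is
  \<open>2|B|\<close>.
\<close>

lemma tame_empty: "tame {} U"
proof -
  have "n \<le> 2 ^ (2 * n)" for n :: nat
    by (rule order_trans[OF less_imp_le[OF less_exp] power_increasing]) auto
  then show ?thesis by (simp add: tame_def predim_def nat_mult_distrib)
qed

text \<open>
  There are countably many extension problems with points in the natural numbers. They are
  listed so that each occurs infinitely often, hence also at a stage at which the base of the
  problem lies below the current bound \<open>N\<close> and is strong in the graph built so far;
  such a stage solves it by \<open>strong_realize_type\<close>, and the solution remains strong
  in the limit.
\<close>

lemma generic_exists: "\<exists>E. generic E"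
proof -
  define T :: "(nat set \<times> nat set set \<times> nat set \<times> (nat \<Rightarrow> nat)) set"
    where "T = (SIGMA C : {C. finite C}. Pow (Pow C) \<times> (SIGMA A : Pow C. A \<rightarrow>\<^sub>E UNIV))"
  have "countable T"
    unfolding T_def
  proof (intro countable_SIGMA countable_PiE)
    show "countable {C :: nat set. finite C}"
      by (rule countable_Collect_finite)
  qed (auto intro: countable_finite finite_subset)
  \<comment> \<open>The second component of the decoded pair is only there to repeat every problem infinitely often.\<close>
  define task where "task n = from_nat_into T (fst (prod_decode n))" for n
  have task: "\<exists>n\<ge>m. task n = t" if t: "t \<in> T" for t m
  proof -
    obtain i where i: "from_nat_into T i = t"
      using from_nat_into_surj[OF \<open>countable T\<close> t] by blast
    have "task (prod_encode (i, m)) = t"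
      by (simp add: task_def i)
    moreover have "m \<le> prod_encode (i, m)"
      by (rule le_prod_encode_2)
    ultimately show ?thesis by blast
  qed
  define invar where "invar = (\<lambda>(N :: nat, E :: nat set set).
    E \<subseteq> Pow {..<N} \<and> (\<forall>e\<in>E. card e = 2) \<and> tame E UNIV)"
  define step where "step = (\<lambda>n (N :: nat, E :: nat set set) (N', E').
    N < N' \<and> {e \<in> E'. e \<subseteq> {..<N}} = E \<and> (\<forall>S \<subseteq> {..<N}. strong E UNIV S \<longrightarrow> strong E' UNIV S) \<and>
    (case task n of (C, F, A, p) \<Rightarrow> type_over E (C, F, A, p) \<and> p ` A \<subseteq> {..<N} \<longrightarrow>
       (\<exists>g. realizes E' (C, F, A, p) g \<and> g ` C \<subseteq> {..<N'})))"
  have extend: "\<exists>s'. invar s' \<and> step n s s'" if "invar s" for s n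
  proof -
    obtain N E where s: "s = (N, E)" by (cases s)
    obtain C F A p where t: "task n = (C, F, A, p)" by (cases "task n")
    have E: "E \<subseteq> Pow {..<N}" "\<forall>e\<in>E. card e = 2" "tame E UNIV"
      using that by (auto simp: invar_def s)
    show ?thesis
    proof (cases "type_over E (C, F, A, p) \<and> p ` A \<subseteq> {..<N}")
      case True
      then obtain N' E' g where N': "N \<le> N'" and E': "E' \<subseteq> Pow {..<N'}" "\<forall>e\<in>E'. card e = 2" "tame E' UNIV"
        and old: "{e \<in> E'. e \<subseteq> {..<N}} = E"
          "\<And>S. S \<subseteq> {..<N} \<Longrightarrow> strong E UNIV S \<Longrightarrow> strong E' UNIV S"
        and g: "embedding F C E' g" "strong E' UNIV (g ` C)" "g ` C \<subseteq> {..<N'}" "\<And>x. x \<in> A \<Longrightarrow> g x = p x"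
        using strong_realize_type[OF E, of C F A p] by (auto simp: type_over_def)
      have "E' \<subseteq> Pow {..<Suc N'}"
        by (rule order_trans[OF E'(1) Pow_mono]) auto
      then have "invar (Suc N', E')"
        using E' by (simp add: invar_def)
      moreover have "g ` C \<subseteq> {..<Suc N'}" "realizes E' (C, F, A, p) g"
        using g by (auto simp: realizes_def less_Suc_eq)
      then have "step n s (Suc N', E')"
        unfolding step_def s t split using N' old by (intro conjI impI exI[of _ g]) auto
      ultimately have "invar (Suc N', E') \<and> step n s (Suc N', E')"
        by simp
      then show ?thesis by blast
    next
      case False
      have "E \<subseteq> Pow {..<Suc N}"
        by (rule order_trans[OF E(1) Pow_mono]) auto
      then have "invar (Suc N, E)"
        using E by (simp add: invar_def)
      moreover have "step n s (Suc N, E)"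
        unfolding step_def s t split using False E(1) by auto
      ultimately have "invar (Suc N, E) \<and> step n s (Suc N, E)"
        by simp
      then show ?thesis by blast
    qed
  qed
  have "invar (0, {})"
    by (simp add: invar_def tame_empty)
  then obtain st where st: "\<And>n. invar (st n)" "\<And>n. step n (st n) (st (Suc n))"
    using dependent_nat_choice[of "\<lambda>_ s. invar s" step] extend by metis
  \<comment> \<open>Stage \<open>n\<close> is the graph \<open>E n\<close>, with all its edges below the bound \<open>N n\<close>.\<close>
  define N where "N n = fst (st n)" for n
  define E where "E n = snd (st n)" for n
  have st_eq: "st n = (N n, E n)" for n
    by (simp add: N_def E_def)
  have E_N: "E n \<subseteq> Pow {..<N n}" and E2: "\<forall>e\<in>E n. card e = 2" and tameE: "tame (E n) UNIV" for n
    using st(1)[of n] by (auto simp: invar_def st_eq)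
  have N_Suc: "N n < N (Suc n)" and E_Suc: "{e \<in> E (Suc n). e \<subseteq> {..<N n}} = E n"
    and strong_Suc: "\<And>S. S \<subseteq> {..<N n} \<Longrightarrow> strong (E n) UNIV S \<Longrightarrow> strong (E (Suc n)) UNIV S"
    and real: "\<And>C F A p. task n = (C, F, A, p) \<Longrightarrow> type_over (E n) (C, F, A, p) \<Longrightarrow>
      p ` A \<subseteq> {..<N n} \<Longrightarrow> \<exists>g. realizes (E (Suc n)) (C, F, A, p) g \<and> g ` C \<subseteq> {..<N (Suc n)}" for n
    using st(2)[of n] by (auto simp: step_def st_eq split: prod.splits)
  have N_mono: "N m \<le> N n" if "m \<le> n" for m n
    using lift_Suc_mono_le[of N, OF _ that] N_Suc by (simp add: less_imp_le)
  have N_ge: "n \<le> N n" for n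
  proof (induction n)
    case (Suc n)
    then show ?case using N_Suc[of n] by simp
  qed simp
  have E_le: "{e \<in> E n. e \<subseteq> {..<N m}} = E m" if "m \<le> n" for m n
    using that
  proof (induction n rule: dec_induct)
    case base
    then show ?case using E_N by blast
  next
    case (step n)
    then have "{..<N m} \<subseteq> {..<N n}"
      using N_mono by auto
    then have "e \<in> E (Suc n) \<longleftrightarrow> e \<in> E n" if "e \<subseteq> {..<N m}" for e
      using E_Suc[of n] order_trans[OF that] by auto
    then have "{e \<in> E (Suc n). e \<subseteq> {..<N m}} = {e \<in> E n. e \<subseteq> {..<N m}}"
      by auto
    then show ?case using step.IH by simp
  qed
  have strong_le: "strong (E n) UNIV S" if "m \<le> n" "S \<subseteq> {..<N m}" "strong (E m) UNIV S" for m n S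
    using that(1)
  proof (induction n rule: dec_induct)
    case (step n)
    have "{..<N m} \<subseteq> {..<N n}"
      using step.hyps(1) N_mono by auto
    then show ?case using strong_Suc[OF order_trans[OF that(2)] step.IH] by simp
  qed (rule that)
  define G where "G = (\<Union>n. E n)"
  have G_E: "{e \<in> G. e \<subseteq> {..<N m}} = E m" for m
  proof (intro equalityI subsetI)
    fix e assume "e \<in> {e \<in> G. e \<subseteq> {..<N m}}"
    then obtain n where e: "e \<in> E n" "e \<subseteq> {..<N m}"
      by (auto simp: G_def)
    then have "e \<in> E (max m n)"
      using E_le[of n "max m n"] by auto
    then show "e \<in> E m"
      using e E_le[of m "max m n"] by auto
  qed (use E_N in \<open>auto simp: G_def\<close>)
  have G_iff: "e \<in> G \<longleftrightarrow> e \<in> E m" if "e \<subseteq> {..<N m}" for e m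
    using that G_E[of m] by auto
  have bounded: "\<exists>m\<ge>n. D \<subseteq> {..<N m}" if D: "finite D" for D n
  proof -
    obtain k where k: "\<forall>x\<in>D. x < k"
      using D finite_nat_set_iff_bounded by blast
    have "x < N (max k n)" if "x \<in> D" for x
      using k that N_ge[of "max k n"] by fastforce
    then show ?thesis by (intro exI[of _ "max k n"]) auto
  qed
  have predim_G: "predim G D = predim (E m) D" if "D \<subseteq> {..<N m}" for D m
    by (rule predim_cong) (use that G_iff in auto)
  have "tame G UNIV"
    unfolding tame_def
  proof (intro allI impI)
    fix B assume "finite B \<and> B \<subseteq> (UNIV :: nat set)"
    moreover from this obtain m where "B \<subseteq> {..<N m}"
      using bounded by blast
    ultimately show "0 \<le> predim G B \<and> card B \<le> 2 ^ nat (predim G B)"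
      using predim_G tameE[of m] by (simp add: tame_def)
  qed
  have strong_G: "strong G UNIV S" if S: "S \<subseteq> {..<N m}" "strong (E m) UNIV S" for S m
    unfolding strong_def
  proof (intro conjI allI impI)
    show "finite S" using S by (auto intro: finite_subset)
    fix B assume B: "finite B \<and> S \<subset> B \<and> B \<subseteq> (UNIV :: nat set)"
    then obtain n where n: "m \<le> n" "B \<subseteq> {..<N n}"
      using bounded by blast
    have "predim (E n) S < predim (E n) B"
      using strong_le[OF n(1) S] B by (simp add: strong_def)
    moreover have "S \<subseteq> {..<N n}"
      using B n by blast
    ultimately show "predim G S < predim G B"
      using n(2) by (simp add: predim_G)
  qed simp
  have strong_E: "strong (E m) UNIV S" if S: "S \<subseteq> {..<N m}" "strong G UNIV S" for S m
    unfolding strong_def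
  proof (intro conjI allI impI)
    show "finite S" using S by (auto intro: finite_subset)
    fix B assume B: "finite B \<and> S \<subset> B \<and> B \<subseteq> (UNIV :: nat set)"
    have "predim (E m) S = predim G S"
      using S predim_G by simp
    also have "\<dots> < predim G B"
      using S B by (simp add: strong_def)
    also have "\<dots> \<le> predim (E m) B"
    proof -
      have "card {e \<in> E m. e \<subseteq> B} \<le> card {e \<in> G. e \<subseteq> B}"
        by (rule card_mono) (use B in \<open>auto simp: G_def intro: finite_edges_within\<close>)
      then show ?thesis by (simp add: predim_def)
    qed
    finally show "predim (E m) S < predim (E m) B" .
  qed simp
  have "\<exists>g. realizes G t g" if t0: "type_over G t" for t :: "nat set \<times> nat set set \<times> nat set \<times> (nat \<Rightarrow> nat)"
  proof -
    obtain C F A p where teq: "t = (C, F, A, p)" by (cases t)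
    have t: "finite C" "F \<subseteq> Pow C" "\<forall>e\<in>F. card e = 2" "tame F C" "strong F C A"
      "embedding F A G p" "strong G UNIV (p ` A)"
      using t0 by (auto simp: teq type_over_def)
    have AC: "A \<subseteq> C"
      using t(5) by (simp add: strong_def)
    \<comment> \<open>Only extensional base maps are listed, to keep the list of problems countable.\<close>
    define q where "q = restrict p A"
    have q: "embedding F A G q" "q ` A = p ` A"
      using t(6) embedding_cong[of A q p] by (simp_all add: q_def)
    have "(C, F, A, q) \<in> T"
      using t AC by (auto simp: T_def q_def)
    moreover obtain m where m: "p ` A \<subseteq> {..<N m}"
      using bounded[of "p ` A"] AC t(1) by (metis finite_imageI finite_subset)
    ultimately obtain n where n: "n \<ge> m" "task n = (C, F, A, q)"
      using task by blast
    have pN: "q ` A \<subseteq> {..<N n}"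
      using m N_mono[OF n(1)] q(2) by auto
    have "embedding F A (E n) q"
    proof -
      have "q ` X \<in> G \<longleftrightarrow> q ` X \<in> E n" if "X \<subseteq> A" for X
        using order_trans[OF image_mono[OF that] pN] by (rule G_iff)
      then show ?thesis
        using q(1) by (simp add: embedding_def)
    qed
    then have "type_over (E n) (C, F, A, q)"
      using t strong_E[OF pN] q(2) by (simp add: type_over_def)
    then obtain g where g: "realizes (E (Suc n)) (C, F, A, q) g" "g ` C \<subseteq> {..<N (Suc n)}"
      using real[OF n(2)] pN by blast
    have "embedding F C G g"
    proof -
      have "g ` X \<in> G \<longleftrightarrow> g ` X \<in> E (Suc n)" if "X \<subseteq> C" for X
        using order_trans[OF image_mono[OF that] g(2)] by (rule G_iff)
      then show ?thesis
        using g(1) by (simp add: embedding_def realizes_def)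
    qed
    moreover have "strong G UNIV (g ` C)"
      using g strong_G[of "g ` C" "Suc n"] by (simp add: realizes_def)
    ultimately have "realizes G t g"
      using g(1) by (auto simp: realizes_def teq q_def)
    then show ?thesis by blast
  qed
  moreover have "\<forall>e\<in>G. card e = 2"
    using E2 by (auto simp: G_def)
  ultimately show ?thesis
    using \<open>tame G UNIV\<close> unfolding generic_def by blast
qed

text \<open>
  The usual back-and-forth along enumerations of both sides, for a family \<open>P\<close> of
  partial bijections, given as relations. The last property of \<open>h\<close> lets every
  finitary invariant of the members of \<open>P\<close> pass to \<open>h\<close>. The lemma
  serves both for the homogeneity of the generic graph and for
  \<open>\<omega>\<close>-categoricity.
\<close>

lemma back_and_forth:
  assumes "countable X" "countable Y" and R0: "P R0"
    and part: "\<And>R. P R \<Longrightarrow> R \<subseteq> X \<times> Y \<and> single_valued R \<and> single_valued (R\<inverse>)"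
    and go_forth: "\<And>R x. P R \<Longrightarrow> x \<in> X \<Longrightarrow> \<exists>R'. P R' \<and> R \<subseteq> R' \<and> x \<in> Domain R'"
    and go_back: "\<And>R y. P R \<Longrightarrow> y \<in> Y \<Longrightarrow> \<exists>R'. P R' \<and> R \<subseteq> R' \<and> y \<in> Range R'"
  obtains h where "bij_betw h X Y" "\<And>x y. (x, y) \<in> R0 \<Longrightarrow> h x = y"
    "\<And>S. finite S \<Longrightarrow> S \<subseteq> X \<Longrightarrow> \<exists>R. P R \<and> (\<forall>x\<in>S. (x, h x) \<in> R)"
proof -
  have step: "\<exists>R'. P R' \<and> R \<subseteq> R' \<and> (X \<noteq> {} \<longrightarrow> from_nat_into X n \<in> Domain R') \<and>
      (Y \<noteq> {} \<longrightarrow> from_nat_into Y n \<in> Range R')" if PR: "P R" for R n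
  proof -
    obtain R1 where R1: "P R1" "R \<subseteq> R1" "X \<noteq> {} \<longrightarrow> from_nat_into X n \<in> Domain R1"
      using go_forth[OF PR] from_nat_into[of X n] PR by blast
    obtain R2 where R2: "P R2" "R1 \<subseteq> R2" "Y \<noteq> {} \<longrightarrow> from_nat_into Y n \<in> Range R2"
      using go_back[OF R1(1)] from_nat_into[of Y n] R1(1) by blast
    show ?thesis
      using R1 R2 by (intro exI[of _ R2]) blast
  qed
  obtain f where f: "\<And>n. P (f n)" "f 0 = R0" "\<And>n. f n \<subseteq> f (Suc n)"
    "\<And>n. X \<noteq> {} \<Longrightarrow> from_nat_into X n \<in> Domain (f (Suc n))"
    "\<And>n. Y \<noteq> {} \<Longrightarrow> from_nat_into Y n \<in> Range (f (Suc n))"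
    using dependent_nat_choice[of "\<lambda>n R. P R \<and> (n = 0 \<longrightarrow> R = R0)"
        "\<lambda>n R R'. R \<subseteq> R' \<and> (X \<noteq> {} \<longrightarrow> from_nat_into X n \<in> Domain R') \<and>
                      (Y \<noteq> {} \<longrightarrow> from_nat_into Y n \<in> Range R')"] step R0
    by (metis nat.distinct(1))
  have mono: "f m \<subseteq> f n" if "m \<le> n" for m n
    using lift_Suc_mono_le[of f, OF f(3) that] .
  define G where "G = (\<Union>n. f n)"
  have G2: "\<exists>n. p \<in> f n \<and> q \<in> f n" if pq: "p \<in> G" "q \<in> G" for p q
  proof -
    obtain m n where "p \<in> f m" "q \<in> f n"
      using pq by (auto simp: G_def)
    then show ?thesis
      using mono[of m "max m n"] mono[of n "max m n"] by auto
  qed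
  have fun_G: "y = y'" if "(x, y) \<in> G" "(x, y') \<in> G" for x y y'
    using G2[OF that] part[OF f(1)] unfolding single_valued_def by blast
  have inj_G: "x = x'" if "(x, y) \<in> G" "(x', y) \<in> G" for x x' y
    using G2[OF that] part[OF f(1)] unfolding single_valued_def by blast
  have G_sub: "G \<subseteq> X \<times> Y"
    using part f(1) unfolding G_def by blast
  have dom_G: "\<exists>y. (x, y) \<in> G" if "x \<in> X" for x
    using f(4) from_nat_into_surj[OF assms(1) that] that unfolding G_def by blast
  have ran_G: "\<exists>x. (x, y) \<in> G" if "y \<in> Y" for y
    using f(5) from_nat_into_surj[OF assms(2) that] that unfolding G_def by blast
  define h where "h x = (SOME y. (x, y) \<in> G)" for x
  have hG: "(x, h x) \<in> G" if "x \<in> X" for x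
    unfolding h_def using dom_G[OF that] by (rule someI_ex)
  have h_eq: "h x = y" if "(x, y) \<in> G" for x y
    using hG[of x] fun_G[OF _ that] G_sub that by blast
  have "bij_betw h X Y"
    unfolding bij_betw_def
  proof
    show "inj_on h X"
      by (rule inj_onI) (metis hG inj_G)
    show "h ` X = Y"
    proof
      show "h ` X \<subseteq> Y"
        using hG G_sub by blast
      show "Y \<subseteq> h ` X"
      proof
        fix y assume "y \<in> Y"
        then obtain x where "(x, y) \<in> G"
          using ran_G by blast
        then show "y \<in> h ` X"
          using G_sub h_eq by blast
      qed
    qed
  qed
  moreover have "h x = y" if "(x, y) \<in> R0" for x y
    using h_eq that f(2) unfolding G_def by blast
  moreover have "\<exists>R. P R \<and> (\<forall>x\<in>S. (x, h x) \<in> R)" if "finite S" "S \<subseteq> X" for S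
  proof -
    have "\<exists>n. \<forall>x\<in>S. (x, h x) \<in> f n"
      using that
    proof (induction S)
      case (insert a S)
      then obtain m n where "\<forall>x\<in>S. (x, h x) \<in> f m" "(a, h a) \<in> f n"
        using hG[of a] unfolding G_def by auto
      then show ?case
        using mono[of m "max m n"] mono[of n "max m n"] by (intro exI[of _ "max m n"]) auto
    qed simp
    then show ?thesis using f(1) by blast
  qed
  ultimately show ?thesis
    by (rule that)
qed

text \<open>
  If \<open>x\<close> had finitely many neighbours, let \<open>A\<close> be a strong set
  containing all of them and \<open>x\<close>. Joining a new vertex to \<open>x\<close> alone
  raises the predimension by one, so this is an admissible extension of \<open>A\<close>; its
  realization is a neighbour of \<open>x\<close> outside \<open>A\<close>.
\<close>

lemma generic_infinite_valency:
  assumes "generic E"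
  shows "infinite {y. {x, y} \<in> E}"
proof
  define S where "S = {y. {x, y} \<in> E}"
  assume "finite {y. {x, y} \<in> E}"
  then have finS: "finite S"
    by (simp add: S_def)
  have tameE: "tame E UNIV"
    using assms by (simp add: generic_def)
  obtain A where A: "insert x S \<subseteq> A" "strong E UNIV A"
    by (rule strong_hull[OF tameE, of "insert x S"]) (use finS in auto)
  have finA: "finite A"
    using A(2) by (simp add: strong_def)
  obtain c where c: "c \<notin> A"
    using ex_new_if_finite[OF infinite_UNIV_nat finA] by blast
  define F where "F = insert {c, x} {e \<in> E. e \<subseteq> A}"
  have F_A: "e \<in> F \<longleftrightarrow> e \<in> E" if "e \<subseteq> A" for e
    using that c by (auto simp: F_def)
  have tameA: "tame F A"
    using tame_cong[of A F E, OF F_A] tame_mono[OF tameE] by blast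
  have grow: "predim F B + 1 \<le> predim F (insert c B)" if B: "B \<subseteq> A" for B
  proof -
    have finB: "finite B"
      using B finA by (rule finite_subset)
    have "{e \<in> F. e \<subseteq> insert c B} \<subseteq> insert {c, x} {e \<in> F. e \<subseteq> B}"
      using c by (auto simp: F_def)
    then have "card {e \<in> F. e \<subseteq> insert c B} \<le> card (insert {c, x} {e \<in> F. e \<subseteq> B})"
      by (rule card_mono[rotated]) (simp add: finite_edges_within finB)
    also have "\<dots> \<le> Suc (card {e \<in> F. e \<subseteq> B})"
      by (rule card_insert_le_m1) simp_all
    finally have "card {e \<in> F. e \<subseteq> insert c B} \<le> Suc (card {e \<in> F. e \<subseteq> B})" .
    moreover have "c \<notin> B"
      using B c by blast
    ultimately show ?thesis
      using finB by (simp add: predim_def)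
  qed
  have "tame F (insert c A)"
    unfolding tame_def
  proof (intro allI impI)
    fix D assume D: "finite D \<and> D \<subseteq> insert c A"
    show "0 \<le> predim F D \<and> card D \<le> 2 ^ nat (predim F D)"
    proof (cases "c \<in> D")
      case False
      then show ?thesis using D tameA by (auto simp: tame_def)
    next
      case True
      define B where "B = D - {c}"
      have B: "finite B" "B \<subseteq> A" "D = insert c B" "c \<notin> B"
        using D True by (auto simp: B_def)
      have pB: "0 \<le> predim F B" "card B \<le> 2 ^ nat (predim F B)"
        using tameA B by (auto simp: tame_def)
      have "card D \<le> 2 ^ nat (predim F B) + 1"
        using B pB(2) by simp
      also have "\<dots> \<le> 2 ^ Suc (nat (predim F B))"
        by simp
      also have "\<dots> \<le> 2 ^ nat (predim F D)"
        using grow[OF B(2)] pB(1) B(3) by (intro power_increasing) auto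
      finally show ?thesis
        using grow[OF B(2)] pB(1) B(3) by simp
    qed
  qed
  moreover have "strong F (insert c A) A"
    unfolding strong_def
  proof (intro conjI allI impI)
    fix B assume "finite B \<and> A \<subset> B \<and> B \<subseteq> insert c A"
    then have "B = insert c A" by blast
    then show "predim F A < predim F B"
      using grow[of A] by simp
  qed (use finA in auto)
  moreover have "embedding F A E id"
    using F_A by (simp add: embedding_def)
  moreover have "F \<subseteq> Pow (insert c A)" "\<forall>e\<in>F. card e = 2"
  proof -
    have "c \<noteq> x" using A(1) c by blast
    then show "F \<subseteq> Pow (insert c A)" "\<forall>e\<in>F. card e = 2"
      using assms A(1) by (auto simp: F_def generic_def simp del: split_paired_All)
  qed
  ultimately have "type_over E (insert c A, F, A, id)"
    using A(2) finA by (simp add: type_over_def)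
  then obtain g where "realizes E (insert c A, F, A, id) g"
    using assms unfolding generic_def by blast
  then have gA: "\<And>a. a \<in> A \<Longrightarrow> g a = a" and g: "embedding F (insert c A) E g"
    by (auto simp: realizes_def)
  have "{c, x} \<in> F" "{c, x} \<subseteq> insert c A"
    using A(1) by (auto simp: F_def)
  then have "g ` {c, x} \<in> E"
    using g by (auto simp: embedding_def)
  then have "g c \<in> S"
    using gA[of x] A(1) by (simp add: S_def insert_commute)
  then have "g c \<in> A" using A(1) by blast
  then have "g (g c) = g c" by (rule gA)
  then show False
    using g \<open>g c \<in> A\<close> c unfolding embedding_def by (metis inj_onD insertI1 insertI2)
qed

definition strong_iso :: "nat set set \<Rightarrow> (nat \<times> nat) set \<Rightarrow> bool" where
  "strong_iso E R \<longleftrightarrow> (\<exists>A p. R = (\<lambda>x. (x, p x)) ` A \<and> embedding E A E p \<and>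
     strong E UNIV A \<and> strong E UNIV (p ` A))"

lemma strong_iso_converse:
  assumes "strong_iso E R"
  shows "strong_iso E (R\<inverse>)"
proof -
  obtain A p where R: "R = (\<lambda>x. (x, p x)) ` A" and p: "embedding E A E p"
    and s: "strong E UNIV A" "strong E UNIV (p ` A)"
    using assms by (auto simp: strong_iso_def)
  let ?q = "inv_into A p"
  have inj: "inj_on p A"
    using p by (simp add: embedding_def)
  have qim: "?q ` (p ` X) = X" if "X \<subseteq> A" for X
    using inj that by (rule inv_into_image_cancel)
  have "embedding E (p ` A) E ?q"
    unfolding embedding_def
  proof (intro conjI allI impI)
    show "inj_on ?q (p ` A)"
      by (rule inj_on_inv_into) simp
    fix X assume "X \<subseteq> p ` A"
    then obtain Y where "Y \<subseteq> A" "X = p ` Y"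
      by (auto simp: subset_image_iff)
    then show "X \<in> E \<longleftrightarrow> ?q ` X \<in> E"
      using p qim by (simp add: embedding_def)
  qed
  moreover have "R\<inverse> = (\<lambda>y. (y, ?q y)) ` p ` A"
    using inj by (auto simp: R image_iff)
  ultimately show ?thesis
    unfolding strong_iso_def using s qim[of A] by (metis order_refl)
qed

text \<open>
  A strong hull \<open>C\<close> of the domain together with \<open>x\<close> is an extension
  problem over the range, and genericity solves it.
\<close>

lemma strong_iso_extend:
  assumes "generic E" "strong_iso E R"
  shows "\<exists>R'. strong_iso E R' \<and> R \<subseteq> R' \<and> x \<in> Domain R'"
proof -
  obtain A p where R: "R = (\<lambda>x. (x, p x)) ` A" and p: "embedding E A E p"
    and s: "strong E UNIV A" "strong E UNIV (p ` A)"
    using assms by (auto simp: strong_iso_def)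
  have tameE: "tame E UNIV"
    using assms by (simp add: generic_def)
  have finA: "finite A"
    using s(1) by (simp add: strong_def)
  obtain C where C: "insert x A \<subseteq> C" "strong E UNIV C"
    by (rule strong_hull[OF tameE, of "insert x A"]) (use finA in auto)
  let ?F = "{e \<in> E. e \<subseteq> C}"
  have FC: "e \<in> ?F \<longleftrightarrow> e \<in> E" if "e \<subseteq> C" for e
    using that by simp
  have embF: "embedding ?F B E g \<longleftrightarrow> embedding E B E g" if "B \<subseteq> C" for B g
  proof -
    have "X \<in> ?F \<longleftrightarrow> X \<in> E" if "X \<subseteq> B" for X
      using that \<open>B \<subseteq> C\<close> by auto
    then show ?thesis unfolding embedding_def by blast
  qed
  have "type_over E (C, ?F, A, p)"
    unfolding type_over_def split
  proof (intro conjI)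
    show "finite C" using C(2) by (simp add: strong_def)
    show "\<forall>e\<in>?F. card e = 2" using assms(1) by (simp add: generic_def)
    show "tame ?F C"
      using tame_cong[of C, OF FC] tame_mono[OF tameE] by blast
    show "strong ?F C A"
      using strong_cong[of C, OF FC] strong_mono[OF s(1), of C] C(1) by blast
    show "embedding ?F A E p"
      using embF[of A] C(1) p by blast
  qed (use s in auto)
  then obtain g where "realizes E (C, ?F, A, p) g"
    using assms(1) unfolding generic_def by blast
  then have g: "\<And>a. a \<in> A \<Longrightarrow> g a = p a" "embedding E C E g" "strong E UNIV (g ` C)"
    using embF[of C g] by (auto simp: realizes_def)
  have "strong_iso E ((\<lambda>x. (x, g x)) ` C)"
    unfolding strong_iso_def using g C(2) by blast
  moreover have "R \<subseteq> (\<lambda>x. (x, g x)) ` C"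
    using R g(1) C(1) by auto
  moreover have "x \<in> Domain ((\<lambda>x. (x, g x)) ` C)"
    using C(1) by auto
  ultimately show ?thesis by blast
qed

lemma generic_homogeneous:
  assumes E: "generic E" and "strong E UNIV A" "strong E UNIV (p ` A)" "embedding E A E p"
  obtains h where "bij h" "\<And>X. X \<in> E \<longleftrightarrow> h ` X \<in> E" "\<And>x. x \<in> A \<Longrightarrow> h x = p x"
proof -
  have part: "R \<subseteq> UNIV \<times> UNIV \<and> single_valued R \<and> single_valued (R\<inverse>)" if "strong_iso E R" for R
    using that by (auto simp: strong_iso_def embedding_def single_valued_def inj_on_def)
  have go_back: "\<exists>R'. strong_iso E R' \<and> R \<subseteq> R' \<and> y \<in> Range R'" if R: "strong_iso E R" for R y
  proof -
    obtain R' where "strong_iso E R'" "R\<inverse> \<subseteq> R'" "y \<in> Domain R'"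
      using strong_iso_extend[OF E strong_iso_converse[OF R]] by blast
    then show ?thesis
      using strong_iso_converse[of E R'] by (intro exI[of _ "R'\<inverse>"]) auto
  qed
  have R0: "strong_iso E ((\<lambda>x. (x, p x)) ` A)"
    using assms(2-4) unfolding strong_iso_def by blast
  have "\<exists>h. bij h \<and> (\<forall>x\<in>A. h x = p x) \<and>
      (\<forall>S. finite S \<longrightarrow> (\<exists>R. strong_iso E R \<and> (\<forall>x\<in>S. (x, h x) \<in> R)))"
  proof (rule back_and_forth[where X = UNIV and Y = UNIV and P = "strong_iso E", OF _ _ R0])
    fix R assume "strong_iso E R"
    then show "R \<subseteq> UNIV \<times> UNIV \<and> single_valued R \<and> single_valued (R\<inverse>)"
      by (rule part)
  next
    fix R and x :: nat assume "strong_iso E R"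
    then show "\<exists>R'. strong_iso E R' \<and> R \<subseteq> R' \<and> x \<in> Domain R'"
      by (rule strong_iso_extend[OF E])
  next
    fix R y assume "strong_iso E R"
    then show "\<exists>R'. strong_iso E R' \<and> R \<subseteq> R' \<and> y \<in> Range R'"
      by (rule go_back)
  next
    fix h
    assume "bij h" "\<And>x y. (x, y) \<in> (\<lambda>x. (x, p x)) ` A \<Longrightarrow> h x = y"
      "\<And>S. finite S \<Longrightarrow> S \<subseteq> UNIV \<Longrightarrow> \<exists>R. strong_iso E R \<and> (\<forall>x\<in>S. (x, h x) \<in> R)"
    then show ?thesis
      by (intro exI[of _ h]) auto
  qed simp_all
  then obtain h where h: "bij h" "\<And>x. x \<in> A \<Longrightarrow> h x = p x"
    "\<And>S. finite S \<Longrightarrow> \<exists>R. strong_iso E R \<and> (\<forall>x\<in>S. (x, h x) \<in> R)"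
    by blast
  have fin: "X \<in> E \<longleftrightarrow> h ` X \<in> E" if X: "finite X" for X
  proof -
    obtain R where R: "strong_iso E R" "\<forall>x\<in>X. (x, h x) \<in> R"
      using h(3)[OF X] by blast
    then obtain B q where q: "R = (\<lambda>x. (x, q x)) ` B" "embedding E B E q"
      unfolding strong_iso_def by blast
    then have "X \<subseteq> B" "\<And>x. x \<in> X \<Longrightarrow> h x = q x"
      using R(2) by auto
    then have "h ` X = q ` X" by auto
    then show ?thesis
      using q(2) \<open>X \<subseteq> B\<close> by (simp add: embedding_def)
  qed
  have "X \<in> E \<longleftrightarrow> h ` X \<in> E" for X
  proof (cases "finite X")
    case False
    then have "infinite (h ` X)"
      using h(1) by (metis bij_is_inj finite_imageD inj_on_subset subset_UNIV)
    with False show ?thesis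
      using E unfolding generic_def by (metis card.infinite zero_neq_numeral)
  qed (rule fin)
  then show ?thesis using that[OF h(1)] h(2) by blast
qed

text \<open>
  The orbit of a tuple is determined by the isomorphism type of a strong set containing it, with
  the position of the tuple in it. Coding this set by an initial segment of length at most
  \<open>4^n\<close> leaves finitely many codes, and tuples with the same code are conjugate by
  homogeneity.
\<close>

lemma generic_oligomorphic:
  assumes E: "generic E"
  shows "\<exists>K. finite K \<and> (\<forall>ys\<in>K. length ys = n) \<and>
    (\<forall>xs. length xs = n \<longrightarrow> (\<exists>ys\<in>K. \<exists>h. bij h \<and> (\<forall>X. X \<in> E \<longleftrightarrow> h ` X \<in> E) \<and> xs = map h ys))"
proof -
  define codes :: "(nat \<times> nat set set \<times> nat list) set" where "codes = (\<Union>k\<in>{..(2 :: nat) ^ (2 * n)}.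
    {k} \<times> Pow (Pow {..<k}) \<times> {zs. set zs \<subseteq> {..<k} \<and> length zs = n})"
  define good :: "nat list \<Rightarrow> nat \<times> nat set set \<times> nat list \<Rightarrow> bool" where "good xs = (\<lambda>(k, F, zs). \<exists>b. inj_on b {..<k} \<and>
    strong E UNIV (b ` {..<k}) \<and> F = {X \<in> Pow {..<k}. b ` X \<in> E} \<and> set zs \<subseteq> {..<k} \<and> xs = map b zs)" for xs
  have "finite codes"
    unfolding codes_def by (intro finite_UN_I finite_cartesian_product finite_lists_length_eq) auto
  have code: "\<exists>c\<in>codes. good xs c" if xs: "length xs = n" for xs
  proof -
    obtain Y where Y: "set xs \<subseteq> Y" "strong E UNIV Y" "card Y \<le> 2 ^ (2 * card (set xs))"
      using strong_hull[of E UNIV "set xs"] E by (auto simp: generic_def)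
    have "finite Y" using Y(2) by (simp add: strong_def)
    then obtain b where b: "bij_betw b {..<card Y} Y"
      by (metis ex_bij_betw_nat_finite atLeast0LessThan)
    have cardY: "card Y \<le> 2 ^ (2 * n)"
      using Y(3) card_length[of xs] xs by (auto elim: order_trans intro: power_increasing)
    have "\<forall>y\<in>Y. \<exists>i<card Y. b i = y"
    proof
      fix y assume "y \<in> Y"
      then have "y \<in> b ` {..<card Y}"
        using bij_betw_imp_surj_on[OF b] by simp
      then show "\<exists>i<card Y. b i = y" by auto
    qed
    then obtain r where r: "\<And>y. y \<in> Y \<Longrightarrow> r y < card Y \<and> b (r y) = y"
      by metis
    define zs where "zs = map r xs"
    have zs: "set zs \<subseteq> {..<card Y}" "length zs = n" "map b zs = xs"
      using r Y(1) xs by (auto simp: zs_def intro!: map_idI)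
    let ?F = "{X \<in> Pow {..<card Y}. b ` X \<in> E}"
    have "good xs (card Y, ?F, zs)"
      unfolding good_def split using b Y(2) zs by (intro exI[of _ b]) (auto simp: bij_betw_def)
    moreover have "(card Y, ?F, zs) \<in> codes"
      using zs cardY by (auto simp: codes_def)
    ultimately show ?thesis by blast
  qed
  have same: "\<exists>h. bij h \<and> (\<forall>X. X \<in> E \<longleftrightarrow> h ` X \<in> E) \<and> xs = map h ys"
    if good: "good xs c" "good ys c" for xs ys c
  proof -
    obtain k F zs where c: "c = (k, F, zs)" by (cases c)
    obtain b where b: "inj_on b {..<k}" "strong E UNIV (b ` {..<k})"
      "F = {X \<in> Pow {..<k}. b ` X \<in> E}" "set zs \<subseteq> {..<k}" "xs = map b zs"
      using good(1) unfolding good_def c split by blast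
    obtain d where d: "inj_on d {..<k}" "strong E UNIV (d ` {..<k})"
      "F = {X \<in> Pow {..<k}. d ` X \<in> E}" "ys = map d zs"
      using good(2) unfolding good_def c split by blast
    \<comment> \<open>Both strong sets carry the same graph \<open>F\<close> in their coordinates, so this map is an isomorphism.\<close>
    let ?p = "b \<circ> inv_into {..<k} d"
    have pd: "?p (d i) = b i" if "i < k" for i
      using d(1) that by simp
    have pim: "?p ` d ` X = b ` X" if "X \<subseteq> {..<k}" for X
      using inv_into_image_cancel[OF d(1) that] by (simp only: image_comp[symmetric])
    have emb: "embedding E (d ` {..<k}) E ?p"
      unfolding embedding_def
    proof (intro conjI allI impI)
      show "inj_on ?p (d ` {..<k})"
        using d(1) b(1) by (auto simp: inj_on_def)
      fix X assume "X \<subseteq> d ` {..<k}"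
      then obtain Y where Y: "Y \<subseteq> {..<k}" "X = d ` Y"
        by (auto simp: subset_image_iff)
      have "X \<in> E \<longleftrightarrow> Y \<in> F"
        using d(3) Y by blast
      also have "\<dots> \<longleftrightarrow> b ` Y \<in> E"
        using b(3) Y by blast
      finally show "X \<in> E \<longleftrightarrow> ?p ` X \<in> E"
        using pim[OF Y(1)] Y(2) by simp
    qed
    obtain h where h: "bij h" "\<And>X. X \<in> E \<longleftrightarrow> h ` X \<in> E" "\<And>x. x \<in> d ` {..<k} \<Longrightarrow> h x = ?p x"
      using generic_homogeneous[OF E d(2) _ emb] b(2) pim[of "{..<k}"] by auto
    have "xs = map h ys"
      unfolding b(5) d(4) using h(3) pd b(4) by (auto simp: subset_iff)
    with h show ?thesis by blast
  qed
  define rep where "rep c = (SOME xs. length xs = n \<and> good xs c)" for c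
  have rep: "length (rep c) = n \<and> good (rep c) c" if "\<exists>xs. length xs = n \<and> good xs c" for c
    unfolding rep_def using that by (rule someI_ex)
  let ?K = "rep ` {c \<in> codes. \<exists>xs. length xs = n \<and> good xs c}"
  have "\<exists>ys\<in>?K. \<exists>h. bij h \<and> (\<forall>X. X \<in> E \<longleftrightarrow> h ` X \<in> E) \<and> xs = map h ys" if "length xs = n" for xs
    using code[OF that] same rep that by blast
  then show ?thesis
    using \<open>finite codes\<close> rep by (intro exI[of _ ?K]) auto
qed

lemma generic_sparse:
  assumes "generic E" "finite B"
  shows "card {e \<in> E. e \<subseteq> B} \<le> 2 * card B"
  using assms by (auto simp: generic_def tame_def predim_def)

section \<open>Structures with finitely many orbits on every power\<close>

lemma eval_term_cong:
  "(\<And>i. i \<in> term_vars t \<Longrightarrow> v i = w i) \<Longrightarrow> eval_term M v t = eval_term M w t"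
proof (induction t)
  case (TFun f ts)
  then have "map (eval_term M v) ts = map (eval_term M w) ts"
    by (intro map_cong) auto
  then show ?case by (simp only: eval_term.simps)
qed simp

lemma sat_cong:
  "(\<And>i. i \<in> free_vars \<phi> \<Longrightarrow> v i = w i) \<Longrightarrow> sat M v \<phi> \<longleftrightarrow> sat M w \<phi>"
proof (induction \<phi> arbitrary: v w)
  case (FEq s t)
  then show ?case using eval_term_cong[of s v w M] eval_term_cong[of t v w M] by simp
next
  case (FRel r ts)
  then have "map (eval_term M v) ts = map (eval_term M w) ts"
    by (intro map_cong eval_term_cong) auto
  then show ?case by (simp only: sat.simps)
next
  case (FNeg \<phi>)
  then show ?case by (metis free_vars.simps(3) sat.simps(3))
next
  case (FConj \<phi> \<psi>)
  then have "sat M v \<phi> = sat M w \<phi>" "sat M v \<psi> = sat M w \<psi>"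
    by (metis UnCI free_vars.simps(4))+
  then show ?case by simp
next
  case (FEx i \<phi>)
  have "sat M (v(i := a)) \<phi> = sat M (w(i := a)) \<phi>" for a
    by (rule FEx.IH) (use FEx.prems in auto)
  then show ?case by simp
qed

lemma eval_term_isomorphism:
  assumes "is_structure L M" "isomorphism L M N h"
  shows "wf_term L t \<Longrightarrow> (\<And>i. i \<in> term_vars t \<Longrightarrow> v i \<in> dom M) \<Longrightarrow>
    eval_term M v t \<in> dom M \<and> h (eval_term M v t) = eval_term N (h \<circ> v) t"
proof (induction t)
  case (TFun f ts)
  have ts: "eval_term M v t \<in> dom M \<and> h (eval_term M v t) = eval_term N (h \<circ> v) t" if "t \<in> set ts" for t
  proof (rule TFun.IH[OF that])
    show "wf_term L t"
      using TFun.prems(1) that by (simp add: list_all_iff)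
    show "v i \<in> dom M" if "i \<in> term_vars t" for i
      using TFun.prems(2) that \<open>t \<in> set ts\<close> by auto
  qed
  then have "map (eval_term M v) ts \<in> tuples (dom M) (fun_arity L f)"
    using TFun.prems(1) by (auto simp: tuples_def)
  moreover have "map h (map (eval_term M v) ts) = map (eval_term N (h \<circ> v)) ts"
    using ts by simp
  moreover have "f \<in> funs L"
    using TFun.prems(1) by simp
  ultimately show ?case
    using assms unfolding is_structure_def isomorphism_def
    by (metis eval_term.simps(2))
qed simp

text \<open>
  Only the values of free variables are required to lie in the domain: a list used as a
  valuation says nothing about its values beyond its length.
\<close>

lemma sat_isomorphism:
  assumes "is_structure L M" "isomorphism L M N h"
  shows "wf_formula L \<phi> \<Longrightarrow> (\<And>i. i \<in> free_vars \<phi> \<Longrightarrow> v i \<in> dom M) \<Longrightarrow>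
    sat M v \<phi> \<longleftrightarrow> sat N (h \<circ> v) \<phi>"
proof (induction \<phi> arbitrary: v)
  case (FEq s t)
  have "eval_term M v s \<in> dom M \<and> h (eval_term M v s) = eval_term N (h \<circ> v) s"
    "eval_term M v t \<in> dom M \<and> h (eval_term M v t) = eval_term N (h \<circ> v) t"
    using FEq by (auto intro!: eval_term_isomorphism[OF assms])
  moreover have "inj_on h (dom M)"
    using assms(2) by (simp add: isomorphism_def bij_betw_def)
  ultimately show ?case
    by (metis inj_onD sat.simps(1))
next
  case (FRel r ts)
  have ts: "eval_term M v t \<in> dom M \<and> h (eval_term M v t) = eval_term N (h \<circ> v) t" if "t \<in> set ts" for t
  proof (rule eval_term_isomorphism[OF assms])
    show "wf_term L t"
      using FRel.prems(1) that by simp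
    show "v i \<in> dom M" if "i \<in> term_vars t" for i
      using FRel.prems(2) that \<open>t \<in> set ts\<close> by auto
  qed
  then have "map (eval_term M v) ts \<in> tuples (dom M) (rel_arity L r)"
    using FRel.prems(1) by (auto simp: tuples_def)
  moreover have "map h (map (eval_term M v) ts) = map (eval_term N (h \<circ> v)) ts"
    using ts by simp
  moreover have "r \<in> rels L"
    using FRel.prems(1) by simp
  ultimately show ?case
    using assms(2) unfolding isomorphism_def by (metis sat.simps(2))
next
  case (FNeg \<phi>)
  then show ?case by simp
next
  case (FConj \<phi> \<psi>)
  then show ?case by simp
next
  case (FEx i \<phi>)
  have "sat M (v(i := a)) \<phi> \<longleftrightarrow> sat N ((h \<circ> v)(i := h a)) \<phi>" if "a \<in> dom M" for a
  proof -
    have "sat M (v(i := a)) \<phi> \<longleftrightarrow> sat N (h \<circ> v(i := a)) \<phi>"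
      by (rule FEx.IH) (use FEx.prems that in auto)
    moreover have "h \<circ> v(i := a) = (h \<circ> v)(i := h a)"
      by auto
    ultimately show ?thesis by simp
  qed
  then have "sat M v (FEx i \<phi>) \<longleftrightarrow> (\<exists>b\<in>h ` dom M. sat N ((h \<circ> v)(i := b)) \<phi>)"
    by (auto simp del: fun_upd_apply)
  moreover have "h ` dom M = dom N"
    using assms(2) by (simp add: isomorphism_def bij_betw_def)
  ultimately show ?case
    by (simp only: sat.simps)
qed

text \<open>
  Types of \<open>n\<close>-tuples are handled through formulas whose free variables are among
  the first \<open>n\<close>, and a tuple is turned into a valuation by indexing.
\<close>

definition formulas :: "('f, 'r) language \<Rightarrow> nat \<Rightarrow> ('f, 'r) formula set" where
  "formulas L n = {\<phi>. wf_formula L \<phi> \<and> free_vars \<phi> \<subseteq> {..<n}}"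

definition sat_at :: "('f, 'r, 'a) struc \<Rightarrow> 'a list \<Rightarrow> ('f, 'r) formula \<Rightarrow> bool" where
  "sat_at M xs \<phi> \<longleftrightarrow> sat M (\<lambda>i. xs ! i) \<phi>"

definition same_type :: "('f, 'r) language \<Rightarrow> ('f, 'r, 'a) struc \<Rightarrow> ('f, 'r, 'c) struc \<Rightarrow>
    'a list \<Rightarrow> 'c list \<Rightarrow> bool" where
  "same_type L M N xs ys \<longleftrightarrow> length xs = length ys \<and> set xs \<subseteq> dom M \<and> set ys \<subseteq> dom N \<and>
     (\<forall>\<phi>\<in>formulas L (length xs). sat_at M xs \<phi> \<longleftrightarrow> sat_at N ys \<phi>)"

primrec conj_list :: "('f, 'r) formula list \<Rightarrow> ('f, 'r) formula" where
  "conj_list [] = FEq (TVar 0) (TVar 0)"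
| "conj_list (\<phi> # \<phi>s) = FConj \<phi> (conj_list \<phi>s)"

text \<open>
  The empty conjunction is the formula \<open>x0 = x0\<close>, which is why at least one free
  variable has to be allowed.
\<close>

lemma conj_list_formulas: "set \<phi>s \<subseteq> formulas L (Suc n) \<Longrightarrow> conj_list \<phi>s \<in> formulas L (Suc n)"
  by (induction \<phi>s) (auto simp: formulas_def)

lemma sat_at_conj_list: "sat_at M xs (conj_list \<phi>s) \<longleftrightarrow> (\<forall>\<phi>\<in>set \<phi>s. sat_at M xs \<phi>)"
  by (induction \<phi>s) (auto simp: sat_at_def)

lemma sat_at_FNeg: "sat_at M xs (FNeg \<phi>) \<longleftrightarrow> \<not> sat_at M xs \<phi>"
  by (simp add: sat_at_def)

lemma sat_at_FConj: "sat_at M xs (FConj \<phi> \<psi>) \<longleftrightarrow> sat_at M xs \<phi> \<and> sat_at M xs \<psi>"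
  by (simp add: sat_at_def)

lemma sat_at_FEx:
  assumes "\<phi> \<in> formulas L (Suc n)" "length xs = n"
  shows "sat_at M xs (FEx n \<phi>) \<longleftrightarrow> (\<exists>a\<in>dom M. sat_at M (xs @ [a]) \<phi>)"
proof -
  have "sat M ((\<lambda>i. xs ! i)(n := a)) \<phi> \<longleftrightarrow> sat M (\<lambda>i. (xs @ [a]) ! i) \<phi>" for a
    by (rule sat_cong) (use assms in \<open>auto simp: formulas_def nth_append less_Suc_eq\<close>)
  then show ?thesis by (simp add: sat_at_def)
qed

lemma formulas_intros:
  "\<phi> \<in> formulas L n \<Longrightarrow> FNeg \<phi> \<in> formulas L n"
  "\<phi> \<in> formulas L n \<Longrightarrow> \<psi> \<in> formulas L n \<Longrightarrow> FConj \<phi> \<psi> \<in> formulas L n"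
  "\<phi> \<in> formulas L (Suc n) \<Longrightarrow> FEx n \<phi> \<in> formulas L n"
  by (auto simp: formulas_def less_Suc_eq)

definition oligomorphic :: "('f, 'r) language \<Rightarrow> ('f, 'r, 'a) struc \<Rightarrow> bool" where
  "oligomorphic L M \<longleftrightarrow> (\<forall>n. \<exists>K. finite K \<and> K \<subseteq> tuples (dom M) n \<and>
     (\<forall>xs\<in>tuples (dom M) n. \<exists>ys\<in>K. \<exists>h. isomorphism L M M h \<and> xs = map h ys))"

definition type_of :: "('f, 'r) language \<Rightarrow> ('f, 'r, 'a) struc \<Rightarrow> 'a list \<Rightarrow> ('f, 'r) formula set" where
  "type_of L M xs = {\<phi> \<in> formulas L (length xs). sat_at M xs \<phi>}"

text \<open>
  Conjugate tuples have the same type.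
\<close>

lemma finite_types:
  assumes "is_structure L M" "oligomorphic L M"
  shows "finite (type_of L M ` tuples (dom M) n)"
proof -
  obtain K where K: "finite K" "K \<subseteq> tuples (dom M) n"
    "\<And>xs. xs \<in> tuples (dom M) n \<Longrightarrow> \<exists>ys\<in>K. \<exists>h. isomorphism L M M h \<and> xs = map h ys"
    using assms(2) unfolding oligomorphic_def by metis
  have "type_of L M ` tuples (dom M) n \<subseteq> type_of L M ` K"
  proof
    fix t assume "t \<in> type_of L M ` tuples (dom M) n"
    then obtain xs where xs: "xs \<in> tuples (dom M) n" "t = type_of L M xs"
      by blast
    then obtain ys h where ys: "ys \<in> K" "isomorphism L M M h" "xs = map h ys"
      using K(3) by blast
    have "sat_at M ys \<phi> \<longleftrightarrow> sat_at M xs \<phi>" if \<phi>: "\<phi> \<in> formulas L (length ys)" for \<phi>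
    proof -
      have "ys ! i \<in> dom M" if "i \<in> free_vars \<phi>" for i
      proof -
        have "i < length ys"
          using that \<phi> by (auto simp: formulas_def)
        moreover have "ys \<in> tuples (dom M) n"
          using ys(1) K(2) by blast
        ultimately show ?thesis
          using nth_mem[of i ys] by (auto simp: tuples_def)
      qed
      then have "sat M (\<lambda>i. ys ! i) \<phi> \<longleftrightarrow> sat M (h \<circ> (\<lambda>i. ys ! i)) \<phi>"
        using \<phi> by (intro sat_isomorphism[OF assms(1) ys(2)]) (auto simp: formulas_def)
      also have "\<dots> \<longleftrightarrow> sat M (\<lambda>i. xs ! i) \<phi>"
        using \<phi> ys(3) by (intro sat_cong) (auto simp: formulas_def)
      finally show ?thesis by (simp add: sat_at_def)
    qed
    then have "t = type_of L M ys"
      using xs(2) ys(3) by (auto simp: type_of_def)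
    then show "t \<in> type_of L M ` K" using ys(1) by blast
  qed
  then show ?thesis using K(1) finite_subset by blast
qed

lemma finite_types_over:
  assumes "is_structure L M" "oligomorphic L M" "set xs \<subseteq> dom M"
  shows "finite ((\<lambda>c. type_of L M (xs @ [c])) ` dom M)"
  by (rule finite_subset[OF _ finite_types[OF assms(1,2), of "Suc (length xs)"]])
    (use assms(3) in \<open>auto simp: tuples_def\<close>)

text \<open>
  As finitely many types over \<open>xs\<close> are realized in \<open>M\<close>, the type of
  \<open>c\<close> is isolated by a formula \<open>\<alpha>\<close> among them. The tuple
  \<open>ys\<close> knows that \<open>\<alpha>\<close> is realized, and that
  \<open>\<alpha>\<close> implies every formula of the type of \<open>c\<close>.
\<close>

lemma same_type_forth:
  assumes M: "is_structure L M" "oligomorphic L M" and st: "same_type L M N xs ys" and c: "c \<in> dom M"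
  shows "\<exists>d\<in>dom N. same_type L M N (xs @ [c]) (ys @ [d])"
proof -
  let ?n = "length xs"
  define tp where "tp c = type_of L M (xs @ [c])" for c
  have len: "length ys = ?n" and sub: "set xs \<subseteq> dom M" "set ys \<subseteq> dom N"
    and eq: "\<And>\<phi>. \<phi> \<in> formulas L ?n \<Longrightarrow> sat_at M xs \<phi> \<longleftrightarrow> sat_at N ys \<phi>"
    using st by (auto simp: same_type_def)
  have "\<exists>\<phi>. \<phi> \<in> tp c \<and> \<phi> \<notin> t" if t: "t \<in> tp ` dom M" "t \<noteq> tp c" for t
  proof -
    obtain e where e: "t = tp e"
      using t(1) by blast
    then obtain \<phi> where "\<phi> \<in> formulas L (Suc ?n)" "sat_at M (xs @ [c]) \<phi> \<noteq> sat_at M (xs @ [e]) \<phi>"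
      using t(2) by (auto simp: tp_def type_of_def)
    then have "\<phi> \<in> tp c \<and> \<phi> \<notin> t \<or> FNeg \<phi> \<in> tp c \<and> FNeg \<phi> \<notin> t"
      by (auto simp: tp_def type_of_def e sat_at_FNeg formulas_intros)
    then show ?thesis by blast
  qed
  then obtain f where f: "\<And>t. t \<in> tp ` dom M \<Longrightarrow> t \<noteq> tp c \<Longrightarrow> f t \<in> tp c \<and> f t \<notin> t"
    by metis
  have finite_tp: "finite (tp ` dom M)"
    unfolding tp_def by (rule finite_types_over[OF M sub(1)])
  have "finite (f ` (tp ` dom M - {tp c}))"
    by (intro finite_imageI finite_Diff finite_tp)
  then obtain \<phi>s where \<phi>s: "set \<phi>s = f ` (tp ` dom M - {tp c})"
    by (meson finite_list)
  define \<alpha> where "\<alpha> = conj_list \<phi>s"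
  have "set \<phi>s \<subseteq> tp c"
    unfolding \<phi>s using f by (intro image_subsetI) simp
  then have \<alpha>: "\<alpha> \<in> formulas L (Suc ?n)" "sat_at M (xs @ [c]) \<alpha>"
    unfolding \<alpha>_def sat_at_conj_list by (auto intro!: conj_list_formulas simp: tp_def type_of_def)
  have isolate: "tp e = tp c" if "e \<in> dom M" "sat_at M (xs @ [e]) \<alpha>" for e
  proof (rule ccontr)
    assume ne: "tp e \<noteq> tp c"
    then have "f (tp e) \<in> set \<phi>s"
      unfolding \<phi>s using that(1) by (intro imageI) simp
    then have "sat_at M (xs @ [e]) (f (tp e))"
      using that(2) by (simp add: \<alpha>_def sat_at_conj_list)
    then show False
      using f[of "tp e"] ne that(1) by (auto simp: tp_def type_of_def)
  qed
  have "sat_at M xs (FEx ?n \<alpha>)"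
    using \<alpha> c sat_at_FEx[OF \<alpha>(1) refl] by blast
  then have "sat_at N ys (FEx ?n \<alpha>)"
    using eq formulas_intros(3)[OF \<alpha>(1)] by blast
  then obtain d where d: "d \<in> dom N" "sat_at N (ys @ [d]) \<alpha>"
    using sat_at_FEx[OF \<alpha>(1) len] by blast
  have transfer: "sat_at N (ys @ [d]) \<psi>" if \<psi>: "\<psi> \<in> formulas L (Suc ?n)" "sat_at M (xs @ [c]) \<psi>" for \<psi>
  proof -
    let ?\<theta> = "FConj \<alpha> (FNeg \<psi>)"
    have \<theta>: "?\<theta> \<in> formulas L (Suc ?n)"
      using \<alpha>(1) \<psi>(1) by (intro formulas_intros)
    have "sat_at M (xs @ [e]) \<psi>" if "e \<in> dom M" "sat_at M (xs @ [e]) \<alpha>" for e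
      using isolate[OF that] \<psi> by (auto simp: tp_def type_of_def)
    then have "\<not> sat_at M xs (FEx ?n ?\<theta>)"
      using sat_at_FEx[OF \<theta> refl] by (auto simp: sat_at_FConj sat_at_FNeg)
    then have "\<not> sat_at N ys (FEx ?n ?\<theta>)"
      using eq formulas_intros(3)[OF \<theta>] by blast
    then show ?thesis
      using sat_at_FEx[OF \<theta> len] d by (auto simp: sat_at_FConj sat_at_FNeg)
  qed
  have "sat_at M (xs @ [c]) \<psi> \<longleftrightarrow> sat_at N (ys @ [d]) \<psi>" if "\<psi> \<in> formulas L (Suc ?n)" for \<psi>
    using transfer[OF that] transfer[OF formulas_intros(1)[OF that]] by (auto simp: sat_at_FNeg)
  then have "same_type L M N (xs @ [c]) (ys @ [d])"
    using len sub c d(1) by (simp add: same_type_def)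
  with d(1) show ?thesis by blast
qed

text \<open>
  Otherwise every one of the finitely many types over \<open>xs\<close> realized in
  \<open>M\<close> contains a formula that fails at \<open>d\<close>. Then the negations of
  these formulas are jointly satisfiable over \<open>ys\<close>, hence over \<open>xs\<close>,
  by an element whose type is not on the list.
\<close>

lemma same_type_back:
  assumes M: "is_structure L M" "oligomorphic L M" and st: "same_type L M N xs ys" and d: "d \<in> dom N"
  shows "\<exists>c\<in>dom M. same_type L M N (xs @ [c]) (ys @ [d])"
proof (rule ccontr)
  assume none: "\<not> ?thesis"
  let ?n = "length xs"
  define tp where "tp c = type_of L M (xs @ [c])" for c
  have len: "length ys = ?n" and sub: "set xs \<subseteq> dom M" "set ys \<subseteq> dom N"
    and eq: "\<And>\<phi>. \<phi> \<in> formulas L ?n \<Longrightarrow> sat_at M xs \<phi> \<longleftrightarrow> sat_at N ys \<phi>"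
    using st by (auto simp: same_type_def)
  have "\<exists>\<phi>. \<phi> \<in> t \<and> \<not> sat_at N (ys @ [d]) \<phi>" if t: "t \<in> tp ` dom M" for t
  proof -
    obtain c where c: "c \<in> dom M" "t = tp c"
      using t by blast
    then obtain \<phi> where "\<phi> \<in> formulas L (Suc ?n)" "sat_at M (xs @ [c]) \<phi> \<noteq> sat_at N (ys @ [d]) \<phi>"
    proof -
      have "\<not> same_type L M N (xs @ [c]) (ys @ [d])"
        using none c(1) by blast
      then show ?thesis
        using that len sub d c(1) by (auto simp: same_type_def)
    qed
    then have "\<phi> \<in> t \<and> \<not> sat_at N (ys @ [d]) \<phi> \<or> FNeg \<phi> \<in> t \<and> \<not> sat_at N (ys @ [d]) (FNeg \<phi>)"
      by (auto simp: tp_def type_of_def c sat_at_FNeg formulas_intros)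
    then show ?thesis by blast
  qed
  then obtain f where f: "\<And>t. t \<in> tp ` dom M \<Longrightarrow> f t \<in> t \<and> \<not> sat_at N (ys @ [d]) (f t)"
    by metis
  have finite_tp: "finite (tp ` dom M)"
    unfolding tp_def by (rule finite_types_over[OF M sub(1)])
  have "finite ((FNeg \<circ> f) ` tp ` dom M)"
    by (intro finite_imageI finite_tp)
  then obtain \<phi>s where \<phi>s: "set \<phi>s = (FNeg \<circ> f) ` tp ` dom M"
    by (meson finite_list)
  define \<alpha> where "\<alpha> = conj_list \<phi>s"
  have "set \<phi>s \<subseteq> formulas L (Suc ?n)"
  proof -
    have "FNeg (f (tp c)) \<in> formulas L (Suc ?n)" if "c \<in> dom M" for c
      using f[of "tp c"] that by (intro formulas_intros) (auto simp: tp_def type_of_def)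
    then show ?thesis
      by (auto simp: \<phi>s)
  qed
  then have \<alpha>: "\<alpha> \<in> formulas L (Suc ?n)"
    unfolding \<alpha>_def by (rule conj_list_formulas)
  have "sat_at N (ys @ [d]) \<alpha>"
    unfolding \<alpha>_def sat_at_conj_list using f by (auto simp: \<phi>s sat_at_FNeg)
  then have "sat_at N ys (FEx ?n \<alpha>)"
    using d sat_at_FEx[OF \<alpha> len] by blast
  then have "sat_at M xs (FEx ?n \<alpha>)"
    using eq formulas_intros(3)[OF \<alpha>] by blast
  then obtain c where c: "c \<in> dom M" "sat_at M (xs @ [c]) \<alpha>"
    using sat_at_FEx[OF \<alpha> refl] by blast
  have "FNeg (f (tp c)) \<in> set \<phi>s"
    using c(1) \<phi>s by auto
  then have "\<not> sat_at M (xs @ [c]) (f (tp c))"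
    using c(2) unfolding \<alpha>_def sat_at_conj_list by (auto simp: sat_at_FNeg)
  moreover have "f (tp c) \<in> tp c"
    using f[of "tp c"] c(1) by simp
  ultimately show False by (simp add: tp_def type_of_def)
qed

lemma same_type_nth:
  assumes "same_type L M N xs ys" "i < length xs" "j < length xs"
  shows "xs ! i = xs ! j \<longleftrightarrow> ys ! i = ys ! j"
proof -
  have "FEq (TVar i) (TVar j) \<in> formulas L (length xs)"
    using assms by (auto simp: formulas_def)
  then have "sat_at M xs (FEq (TVar i) (TVar j)) \<longleftrightarrow> sat_at N ys (FEq (TVar i) (TVar j))"
    using assms(1) unfolding same_type_def by blast
  then show ?thesis by (simp add: sat_at_def)
qed

lemma same_type_relation:
  assumes "same_type L M N xs ys"
  shows "set (zip xs ys) \<subseteq> dom M \<times> dom N \<and> single_valued (set (zip xs ys)) \<and>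
    single_valued ((set (zip xs ys))\<inverse>)"
proof (intro conjI)
  have len: "length xs = length ys"
    using assms by (simp add: same_type_def)
  show "set (zip xs ys) \<subseteq> dom M \<times> dom N"
    using assms by (auto simp: same_type_def dest: set_zip_leftD set_zip_rightD)
  have index: "\<exists>i<length xs. xs ! i = a \<and> ys ! i = b" if "(a, b) \<in> set (zip xs ys)" for a b
    using that by (auto simp: in_set_zip)
  show "single_valued (set (zip xs ys))"
    by (rule single_valuedI) (metis index same_type_nth[OF assms])
  show "single_valued ((set (zip xs ys))\<inverse>)"
    by (rule single_valuedI) (metis converseD index same_type_nth[OF assms])
qed

text \<open>
  The back-and-forth starts with the empty tuples, which have the same type because
  \<open>N\<close> is a model of the theory of \<open>M\<close>. Function and relation symbols
  are then preserved because finitely many elements at a time are covered by tuples of equal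
  type.
\<close>

theorem oligomorphic_imp_omega_categorical:
  fixes M :: "('f, 'r, 'a) struc"
  assumes M: "is_structure L M" "countable (dom M)" "infinite (dom M)" and olig: "oligomorphic L M"
  shows "countable_omega_categorical L M"
  unfolding countable_omega_categorical_def
proof (intro conjI allI impI M)
  fix N :: "('f, 'r, nat) struc"
  assume N: "is_model L (theory_of L M) N \<and> infinite (dom N)"
  have sat_sentence: "sat M v \<phi> \<longleftrightarrow> holds M \<phi>" if "\<phi> \<in> sentences L" for \<phi> v
  proof -
    have "sat M v \<phi> \<longleftrightarrow> sat M w \<phi>" for w
      using that by (intro sat_cong) (simp add: sentences_def)
    moreover obtain a where "a \<in> dom M"
      using M(1) by (auto simp: is_structure_def)
    then have "range (\<lambda>_ :: nat. a) \<subseteq> dom M" by auto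
    ultimately show ?thesis
      unfolding holds_def by blast
  qed
  have sat_sentence_N: "sat N v \<phi> \<longleftrightarrow> holds N \<phi>" if "\<phi> \<in> sentences L" for \<phi> v
  proof -
    have "sat N v \<phi> \<longleftrightarrow> sat N w \<phi>" for w
      using that by (intro sat_cong) (simp add: sentences_def)
    moreover obtain a where "a \<in> dom N"
      using N by (auto simp: is_model_def is_structure_def)
    then have "range (\<lambda>_ :: nat. a) \<subseteq> dom N" by auto
    ultimately show ?thesis
      unfolding holds_def by blast
  qed
  have Th: "holds N \<phi>" if "\<phi> \<in> sentences L" "holds M \<phi>" for \<phi>
    using N that by (simp add: is_model_def theory_of_def)
  have "same_type L M N [] []"
    unfolding same_type_def
  proof (intro conjI ballI)
    fix \<phi> assume "\<phi> \<in> formulas L (length ([] :: 'a list))"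
    then have \<phi>: "\<phi> \<in> sentences L" "FNeg \<phi> \<in> sentences L"
      by (auto simp: formulas_def sentences_def)
    have "holds N \<phi>" if "sat_at M [] \<phi>"
      using that Th[OF \<phi>(1)] sat_sentence[OF \<phi>(1)] by (simp add: sat_at_def)
    moreover have "\<not> holds N \<phi>" if "\<not> sat_at M [] \<phi>"
    proof -
      have "holds N (FNeg \<phi>)"
        using that Th[OF \<phi>(2)] sat_sentence[OF \<phi>(2)] by (simp add: sat_at_def flip: sat.simps(3))
      then show ?thesis
        using sat_sentence_N[OF \<phi>(1), of "undefined"] sat_sentence_N[OF \<phi>(2), of "undefined"] by simp
    qed
    ultimately show "sat_at M [] \<phi> \<longleftrightarrow> sat_at N [] \<phi>"
      using sat_sentence_N[OF \<phi>(1)] by (auto simp: sat_at_def)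
  qed simp_all
  \<comment> \<open>Partial maps between tuples of the same type; equalities of entries are part of the type.\<close>
  define P where "P R \<longleftrightarrow> (\<exists>xs ys. same_type L M N xs ys \<and> R = set (zip xs ys))" for R
  have P_snoc: "P (insert (c, d) (set (zip xs ys)))" if "same_type L M N (xs @ [c]) (ys @ [d])" for xs ys c d
  proof -
    have "length xs = length ys"
      using that by (simp add: same_type_def)
    then have "insert (c, d) (set (zip xs ys)) = set (zip (xs @ [c]) (ys @ [d]))"
      by simp
    with that show ?thesis unfolding P_def by blast
  qed
  have P0: "P {}"
    unfolding P_def using \<open>same_type L M N [] []\<close> by (metis list.set(1) zip_Nil)
  have "\<exists>h. bij_betw h (dom M) (dom N) \<and>
    (\<forall>S. finite S \<longrightarrow> S \<subseteq> dom M \<longrightarrow> (\<exists>R. P R \<and> (\<forall>x\<in>S. (x, h x) \<in> R)))"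
  proof (rule back_and_forth[where X = "dom M" and Y = "dom N" and P = P, OF M(2) _ P0])
    fix R assume "P R"
    then show "R \<subseteq> dom M \<times> dom N \<and> single_valued R \<and> single_valued (R\<inverse>)"
      unfolding P_def using same_type_relation by blast
  next
    fix R c assume R: "P R" and c: "c \<in> dom M"
    then obtain xs ys where xs: "same_type L M N xs ys" "R = set (zip xs ys)"
      unfolding P_def by blast
    then obtain d where d: "same_type L M N (xs @ [c]) (ys @ [d])"
      using same_type_forth[OF M(1) olig _ c] by blast
    show "\<exists>R'. P R' \<and> R \<subseteq> R' \<and> c \<in> Domain R'"
      by (rule exI[of _ "insert (c, d) R"]) (use P_snoc[OF d] xs(2) in auto)
  next
    fix R d assume R: "P R" and d: "d \<in> dom N"
    then obtain xs ys where xs: "same_type L M N xs ys" "R = set (zip xs ys)"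
      unfolding P_def by blast
    then obtain c where c: "same_type L M N (xs @ [c]) (ys @ [d])"
      using same_type_back[OF M(1) olig _ d] by blast
    show "\<exists>R'. P R' \<and> R \<subseteq> R' \<and> d \<in> Range R'"
      by (rule exI[of _ "insert (c, d) R"]) (use P_snoc[OF c] xs(2) in auto)
  next
    fix h
    assume "bij_betw h (dom M) (dom N)"
      "\<And>S. finite S \<Longrightarrow> S \<subseteq> dom M \<Longrightarrow> \<exists>R. P R \<and> (\<forall>x\<in>S. (x, h x) \<in> R)"
    then show ?thesis by blast
  qed simp
  then obtain h where h: "bij_betw h (dom M) (dom N)"
    "\<And>S. finite S \<Longrightarrow> S \<subseteq> dom M \<Longrightarrow> \<exists>R. P R \<and> (\<forall>x\<in>S. (x, h x) \<in> R)"
    by blast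
  have names: "\<exists>xs ys r. same_type L M N xs ys \<and> (\<forall>x\<in>S. r x < length xs \<and> xs ! r x = x \<and> ys ! r x = h x)"
    if S: "finite S" "S \<subseteq> dom M" for S
  proof -
    obtain xs ys where xs: "same_type L M N xs ys" "\<forall>x\<in>S. (x, h x) \<in> set (zip xs ys)"
      using h(2)[OF S] unfolding P_def by blast
    then have "\<forall>x\<in>S. \<exists>i<length xs. xs ! i = x \<and> ys ! i = h x"
      by (auto simp: in_set_zip)
    then show ?thesis
      using xs(1) by metis
  qed
  have "isomorphism L M N h"
    unfolding isomorphism_def
  proof (intro conjI ballI h(1))
    fix f zs assume f: "f \<in> funs L" and zs: "zs \<in> tuples (dom M) (fun_arity L f)"
    let ?S = "insert (fun_interp M f zs) (set zs)"
    have "fun_interp M f zs \<in> dom M"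
      using M(1) f zs by (simp add: is_structure_def)
    then obtain xs ys r where xs: "same_type L M N xs ys"
      "\<forall>x\<in>?S. r x < length xs \<and> xs ! r x = x \<and> ys ! r x = h x"
      using names[of ?S] zs by (auto simp: tuples_def)
    let ?\<phi> = "FEq (TFun f (map (TVar \<circ> r) zs)) (TVar (r (fun_interp M f zs)))"
    have "?\<phi> \<in> formulas L (length xs)"
      using f zs xs(2) by (auto simp: formulas_def tuples_def list_all_iff)
    then have "sat_at M xs ?\<phi> \<longleftrightarrow> sat_at N ys ?\<phi>"
      using xs(1) unfolding same_type_def by blast
    moreover have "map (eval_term M (\<lambda>i. xs ! i)) (map (TVar \<circ> r) zs) = zs"
      using xs(2) by (auto intro!: map_idI)
    moreover have "map (eval_term N (\<lambda>i. ys ! i)) (map (TVar \<circ> r) zs) = map h zs"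
      using xs(2) by auto
    ultimately show "h (fun_interp M f zs) = fun_interp N f (map h zs)"
      using xs(2) unfolding sat_at_def by (simp del: map_map)
  next
    fix R zs assume R: "R \<in> rels L" and zs: "zs \<in> tuples (dom M) (rel_arity L R)"
    then obtain xs ys r where xs: "same_type L M N xs ys"
      "\<forall>x\<in>set zs. r x < length xs \<and> xs ! r x = x \<and> ys ! r x = h x"
      using names[of "set zs"] by (auto simp: tuples_def)
    let ?\<phi> = "FRel R (map (TVar \<circ> r) zs)"
    have "?\<phi> \<in> formulas L (length xs)"
      using R zs xs(2) by (auto simp: formulas_def tuples_def)
    then have "sat_at M xs ?\<phi> \<longleftrightarrow> sat_at N ys ?\<phi>"
      using xs(1) unfolding same_type_def by blast
    moreover have "map (eval_term M (\<lambda>i. xs ! i)) (map (TVar \<circ> r) zs) = zs"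
      using xs(2) by (auto intro!: map_idI)
    moreover have "map (eval_term N (\<lambda>i. ys ! i)) (map (TVar \<circ> r) zs) = map h zs"
      using xs(2) by auto
    ultimately show "rel_interp M R zs \<longleftrightarrow> rel_interp N R (map h zs)"
      unfolding sat_at_def by (simp del: map_map)
  qed
  then show "\<exists>h. isomorphism L M N h" by blast
qed

section \<open>Automorphism groups as topological groups\<close>

lemma map_tuples: "h ` A \<subseteq> B \<Longrightarrow> xs \<in> tuples A n \<Longrightarrow> map h xs \<in> tuples B n"
  by (auto simp: tuples_def)

lemma isomorphism_compose:
  assumes "isomorphism L M N f" "isomorphism L N P g"
  shows "isomorphism L M P (g \<circ> f)"
  unfolding isomorphism_def
proof (intro conjI ballI)
  have img: "f ` dom M \<subseteq> dom N"
    using assms(1) by (auto simp: isomorphism_def bij_betw_def)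
  show "bij_betw (g \<circ> f) (dom M) (dom P)"
    using assms by (auto simp: isomorphism_def intro: bij_betw_trans)
  show "(g \<circ> f) (fun_interp M k xs) = fun_interp P k (map (g \<circ> f) xs)"
    if "k \<in> funs L" "xs \<in> tuples (dom M) (fun_arity L k)" for k xs
    using that map_tuples[OF img that(2)] assms by (simp add: isomorphism_def)
  show "rel_interp M r xs \<longleftrightarrow> rel_interp P r (map (g \<circ> f) xs)"
    if "r \<in> rels L" "xs \<in> tuples (dom M) (rel_arity L r)" for r xs
    using that map_tuples[OF img that(2)] assms by (simp add: isomorphism_def)
qed

lemma isomorphism_cong:
  assumes M: "is_structure L M" and f: "isomorphism L M N f" and fg: "\<And>x. x \<in> dom M \<Longrightarrow> g x = f x"
  shows "isomorphism L M N g"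
  unfolding isomorphism_def
proof (intro conjI ballI)
  have map_eq: "map g xs = map f xs" if "xs \<in> tuples (dom M) n" for xs n
    using fg that by (auto simp: tuples_def)
  show "bij_betw g (dom M) (dom N)"
    using f bij_betw_cong[of "dom M" g f "dom N", OF fg] by (simp add: isomorphism_def)
  show "g (fun_interp M k xs) = fun_interp N k (map g xs)"
    if k: "k \<in> funs L" and xs: "xs \<in> tuples (dom M) (fun_arity L k)" for k xs
  proof -
    have "fun_interp M k xs \<in> dom M"
      using M k xs by (simp add: is_structure_def)
    then show ?thesis
      using f k xs map_eq[OF xs] fg by (simp only: isomorphism_def)
  qed
  show "rel_interp M r xs \<longleftrightarrow> rel_interp N r (map g xs)"
    if r: "r \<in> rels L" and xs: "xs \<in> tuples (dom M) (rel_arity L r)" for r xs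
    using f r xs map_eq[OF xs] by (simp only: isomorphism_def)
qed

lemma isomorphism_inverse:
  assumes M: "is_structure L M" and f: "isomorphism L M N f"
  shows "isomorphism L N M (inv_into (dom M) f)"
  unfolding isomorphism_def
proof (intro conjI ballI)
  let ?g = "inv_into (dom M) f"
  have bij: "bij_betw f (dom M) (dom N)"
    using f by (simp add: isomorphism_def)
  show bij': "bij_betw ?g (dom N) (dom M)"
    using bij by (rule bij_betw_inv_into)
  have img: "?g ` dom N \<subseteq> dom M"
    using bij' by (simp add: bij_betw_def)
  have fg: "map f (map ?g ys) = ys" if "ys \<in> tuples (dom N) n" for ys n
    using that bij_betw_inv_into_right[OF bij] by (auto simp: tuples_def intro!: map_idI)
  show "?g (fun_interp N k ys) = fun_interp M k (map ?g ys)"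
    if k: "k \<in> funs L" and ys: "ys \<in> tuples (dom N) (fun_arity L k)" for k ys
  proof -
    have t: "map ?g ys \<in> tuples (dom M) (fun_arity L k)"
      using map_tuples[OF img ys] .
    then have "f (fun_interp M k (map ?g ys)) = fun_interp N k (map f (map ?g ys))"
      using f k unfolding isomorphism_def by blast
    then have "fun_interp N k ys = f (fun_interp M k (map ?g ys))"
      unfolding fg[OF ys] by simp
    moreover have "fun_interp M k (map ?g ys) \<in> dom M"
      using M k t by (simp add: is_structure_def)
    ultimately show ?thesis
      using bij_betw_inv_into_left[OF bij] by simp
  qed
  show "rel_interp N r ys \<longleftrightarrow> rel_interp M r (map ?g ys)"
    if r: "r \<in> rels L" and ys: "ys \<in> tuples (dom N) (rel_arity L r)" for r ys
  proof -
    have "rel_interp M r (map ?g ys) \<longleftrightarrow> rel_interp N r (map f (map ?g ys))"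
      using f r map_tuples[OF img ys] unfolding isomorphism_def by blast
    then show ?thesis unfolding fg[OF ys] by simp
  qed
qed

locale fo_structure =
  fixes L :: "('f, 'r) language" and M :: "('f, 'r, 'a) struc"
  assumes struc: "is_structure L M"
begin

abbreviation A where "A \<equiv> {g \<in> Bij (dom M). isomorphism L M M g}"

lemma carrier_Aut: "carrier (Aut L M) = A"
  by (simp add: Aut_def)

lemma isomorphism_restrict:
  assumes h: "isomorphism L M M h"
  shows "restrict h (dom M) \<in> A"
proof -
  have iso: "isomorphism L M M (restrict h (dom M))"
    by (rule isomorphism_cong[OF struc h]) simp
  then show ?thesis
    by (simp add: Bij_def isomorphism_def)
qed

lemma subgroup_Aut: "subgroup A (BijGroup (dom M))"
proof (rule group.subgroupI[OF group_BijGroup])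
  show "A \<subseteq> carrier (BijGroup (dom M))"
    by (auto simp: BijGroup_def)
  have "isomorphism L M M id"
    by (simp add: isomorphism_def)
  then show "A \<noteq> {}"
    using isomorphism_restrict by blast
next
  fix f assume f: "f \<in> A"
  then have "inv\<^bsub>BijGroup (dom M)\<^esub> f = restrict (inv_into (dom M) f) (dom M)"
    by (simp add: inv_BijGroup)
  then show "inv\<^bsub>BijGroup (dom M)\<^esub> f \<in> A"
    using isomorphism_restrict[OF isomorphism_inverse[OF struc]] f by simp
next
  fix f g assume fg: "f \<in> A" "g \<in> A"
  then have "f \<otimes>\<^bsub>BijGroup (dom M)\<^esub> g = restrict (f \<circ> g) (dom M)"
    by (simp add: BijGroup_def compose_def o_def)
  moreover have "isomorphism L M M (f \<circ> g)"
    by (rule isomorphism_compose[of L M M]) (use fg in auto)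
  then have "restrict (f \<circ> g) (dom M) \<in> A"
    by (rule isomorphism_restrict)
  ultimately show "f \<otimes>\<^bsub>BijGroup (dom M)\<^esub> g \<in> A"
    by (simp only:)
qed

lemma group_Aut: "group (Aut L M)"
  unfolding Aut_def using subgroup.subgroup_is_group[OF subgroup_Aut group_BijGroup] .

lemma group_action_Aut: "group_action (Aut L M) (dom M) (\<lambda>g. g)"
  unfolding group_action_def group_hom_def group_hom_axioms_def
  using group_Aut group_BijGroup by (auto simp: hom_def Aut_def BijGroup_def)

lemma inv_Aut: "g \<in> A \<Longrightarrow> inv\<^bsub>Aut L M\<^esub> g = restrict (inv_into (dom M) g) (dom M)"
  using group.m_inv_consistent[OF group_BijGroup subgroup_Aut] by (simp add: Aut_def inv_BijGroup)

lemma A_maps: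
  assumes "g \<in> A" "x \<in> dom M"
  shows "g x \<in> dom M"
proof -
  have "bij_betw g (dom M) (dom M)"
    using assms(1) by (simp add: Bij_def)
  then show ?thesis
    using assms(2) by (simp add: bij_betw_apply)
qed

lemma topspace_pointwise: "topspace (pointwise_topology L M) = A"
proof -
  have "A \<subseteq> (\<Pi>\<^sub>E i\<in>dom M. dom M)"
  proof
    fix g assume "g \<in> A"
    then have "g \<in> Bij (dom M)" by simp
    then show "g \<in> (\<Pi>\<^sub>E i\<in>dom M. dom M)"
      by (simp add: PiE_def Bij_imp_funcset Bij_imp_extensional)
  qed
  then show ?thesis
    by (auto simp: pointwise_topology_def carrier_Aut)
qed

lemma openin_pointwise:
  assumes "x \<in> dom M"
  shows "openin (pointwise_topology L M) {g \<in> A. g x = y}"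
proof (cases "y \<in> dom M")
  case True
  have "continuous_map (pointwise_topology L M) (discrete_topology (dom M)) (\<lambda>g. g x)"
    unfolding pointwise_topology_def
    using assms by (intro continuous_map_from_subtopology continuous_map_product_coordinates)
  then have "openin (pointwise_topology L M) {g \<in> topspace (pointwise_topology L M). g x \<in> {y}}"
    by (rule openin_continuous_map_preimage) (use True in simp)
  then show ?thesis
    unfolding topspace_pointwise by simp
next
  case False
  then have "{g \<in> A. g x = y} = {}"
    using A_maps[OF _ assms] by auto
  then show ?thesis by (simp only: openin_empty)
qed

text \<open>
  Continuity of the action of the automorphism group on its structure, which is also what makes
  multiplication continuous: \<open>(g h) x\<close> is a twofold evaluation.
\<close>

lemma continuous_evaluation:
  "continuous_map (prod_topology (pointwise_topology L M) (discrete_topology (dom M)))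
     (discrete_topology (dom M)) (\<lambda>(g, x). g x)"
  (is "continuous_map ?P _ _")
proof -
  have topP: "topspace ?P = A \<times> dom M"
    by (simp add: topspace_pointwise)
  have "openin ?P {p \<in> topspace ?P. (case p of (g, x) \<Rightarrow> g x) \<in> U}" for U
  proof (subst openin_subopen, intro ballI)
    fix p assume p: "p \<in> {p \<in> topspace ?P. (case p of (g, x) \<Rightarrow> g x) \<in> U}"
    then obtain g x where gx: "p = (g, x)" "g \<in> A" "x \<in> dom M" "g x \<in> U"
      unfolding topP by auto
    let ?W = "{h \<in> A. h x = g x} \<times> {x}"
    have "openin ?P ?W"
      using gx(3) openin_pointwise[OF gx(3)] by (simp add: openin_prod_Times_iff)
    moreover have "p \<in> ?W" using gx by simp
    moreover have "?W \<subseteq> {p \<in> topspace ?P. (case p of (g, x) \<Rightarrow> g x) \<in> U}"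
      unfolding topP using gx by auto
    ultimately show "\<exists>W. openin ?P W \<and> p \<in> W \<and> W \<subseteq> {p \<in> topspace ?P. (case p of (g, x) \<Rightarrow> g x) \<in> U}"
      by blast
  qed
  moreover have "(\<lambda>(g, x). g x) \<in> topspace ?P \<rightarrow> dom M"
    unfolding topP using A_maps by auto
  ultimately show ?thesis
    by (simp add: continuous_map_def)
qed

lemma continuous_into_pointwise:
  assumes "\<And>p. p \<in> topspace X \<Longrightarrow> f p \<in> A"
    and "\<And>x. x \<in> dom M \<Longrightarrow> continuous_map X (discrete_topology (dom M)) (\<lambda>p. f p x)"
  shows "continuous_map X (pointwise_topology L M) f"
proof -
  have "f p \<in> extensional (dom M)" if "p \<in> topspace X" for p
    using assms(1)[OF that] by (simp add: Bij_def)
  then have "continuous_map X (product_topology (\<lambda>_. discrete_topology (dom M)) (dom M)) f"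
    unfolding continuous_map_componentwise using assms(2) by auto
  then show ?thesis
    unfolding pointwise_topology_def carrier_Aut
    using assms(1) by (auto simp: continuous_map_in_subtopology)
qed

text \<open>
  Inversion is continuous because \<open>g\<inverse> x = y\<close> is the open condition
  \<open>g y = x\<close>.
\<close>

lemma topological_group_Aut: "topological_group (Aut L M) (pointwise_topology L M)"
  unfolding topological_group_def topspace_pointwise carrier_Aut
proof (intro conjI group_Aut refl)
  let ?T = "pointwise_topology L M"
  interpret group "Aut L M" by (rule group_Aut)
  show "continuous_map (prod_topology ?T ?T) ?T (\<lambda>(g, h). g \<otimes>\<^bsub>Aut L M\<^esub> h)"
  proof (rule continuous_into_pointwise)
    fix p assume "p \<in> topspace (prod_topology ?T ?T)"
    then show "(case p of (g, h) \<Rightarrow> g \<otimes>\<^bsub>Aut L M\<^esub> h) \<in> A"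
      using m_closed by (auto simp: topspace_pointwise carrier_Aut)
  next
    fix x assume x: "x \<in> dom M"
    have "continuous_map (prod_topology ?T ?T) (prod_topology ?T (discrete_topology (dom M))) (\<lambda>p. (snd p, x))"
      using x by (simp add: continuous_map_pairedI continuous_map_snd)
    from continuous_map_compose[OF this continuous_evaluation]
    have "continuous_map (prod_topology ?T ?T) (discrete_topology (dom M)) (\<lambda>p. snd p x)"
      by (simp add: o_def)
    then have "continuous_map (prod_topology ?T ?T) (prod_topology ?T (discrete_topology (dom M)))
        (\<lambda>p. (fst p, snd p x))"
      by (simp add: continuous_map_pairedI continuous_map_fst)
    from continuous_map_compose[OF this continuous_evaluation]
    have "continuous_map (prod_topology ?T ?T) (discrete_topology (dom M)) (\<lambda>p. fst p (snd p x))"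
      by (simp add: o_def)
    then show "continuous_map (prod_topology ?T ?T) (discrete_topology (dom M))
        (\<lambda>p. (case p of (g, h) \<Rightarrow> g \<otimes>\<^bsub>Aut L M\<^esub> h) x)"
      by (rule continuous_map_eq)
        (use x in \<open>auto simp: topspace_pointwise Aut_def BijGroup_def compose_def\<close>)
  qed
  show "continuous_map ?T ?T (\<lambda>g. inv\<^bsub>Aut L M\<^esub> g)"
  proof (rule continuous_into_pointwise)
    fix g assume "g \<in> topspace ?T"
    then show "inv\<^bsub>Aut L M\<^esub> g \<in> A"
      using inv_closed by (simp add: topspace_pointwise carrier_Aut)
  next
    fix x assume x: "x \<in> dom M"
    have inv_iff: "(inv\<^bsub>Aut L M\<^esub> g) x = y \<longleftrightarrow> g y = x" if "g \<in> A" "y \<in> dom M" for g y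
    proof -
      have "bij_betw g (dom M) (dom M)"
        using that(1) by (simp add: Bij_def)
      then show ?thesis
        using that x by (auto simp: inv_Aut bij_betw_inv_into_left bij_betw_inv_into_right)
    qed
    have maps: "(inv\<^bsub>Aut L M\<^esub> g) x \<in> dom M" if "g \<in> A" for g
      using A_maps[OF _ x] inv_closed that by (simp add: carrier_Aut)
    have "openin ?T {g \<in> A. (inv\<^bsub>Aut L M\<^esub> g) x \<in> U}" if "U \<subseteq> dom M" for U
    proof -
      have "{g \<in> A. (inv\<^bsub>Aut L M\<^esub> g) x \<in> U} = (\<Union>y\<in>U. {g \<in> A. g y = x})"
      proof (intro equalityI subsetI)
        fix g assume g: "g \<in> {g \<in> A. (inv\<^bsub>Aut L M\<^esub> g) x \<in> U}"
        then have "g ((inv\<^bsub>Aut L M\<^esub> g) x) = x"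
          using inv_iff[of g "(inv\<^bsub>Aut L M\<^esub> g) x"] that by blast
        then show "g \<in> (\<Union>y\<in>U. {g \<in> A. g y = x})"
          using g by blast
      next
        fix g assume "g \<in> (\<Union>y\<in>U. {g \<in> A. g y = x})"
        then obtain y where y: "y \<in> U" "g \<in> A" "g y = x"
          by blast
        then have "(inv\<^bsub>Aut L M\<^esub> g) x = y"
          using inv_iff[of g y] that by blast
        then show "g \<in> {g \<in> A. (inv\<^bsub>Aut L M\<^esub> g) x \<in> U}"
          using y by blast
      qed
      also have "openin ?T \<dots>"
      proof (rule openin_Union)
        fix S assume "S \<in> (\<lambda>y. {g \<in> A. g y = x}) ` U"
        then obtain y where "y \<in> U" "S = {g \<in> A. g y = x}"
          by blast
        then show "openin ?T S"
          using that openin_pointwise[of y x] by blast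
      qed
      finally show ?thesis .
    qed
    then show "continuous_map ?T (discrete_topology (dom M)) (\<lambda>g. (inv\<^bsub>Aut L M\<^esub> g) x)"
      using maps by (auto simp: continuous_map_def topspace_pointwise)
  qed
qed

lemma acts_on_graph_Aut:
  assumes "\<And>g x y. g \<in> A \<Longrightarrow> x \<in> dom M \<Longrightarrow> y \<in> dom M \<Longrightarrow> {g x, g y} \<in> E \<longleftrightarrow> {x, y} \<in> E"
  shows "acts_on_graph (Aut L M) (pointwise_topology L M) (dom M) E (\<lambda>g. g)"
  unfolding acts_on_graph_def continuous_action_def
  using group_action_Aut continuous_evaluation assms by (simp add: carrier_Aut)

lemma finite_orbits_Aut:
  assumes "oligomorphic L M"
  shows "finite (orbits (Aut L M) (tuples (dom M) n) (diagonal (\<lambda>g. g)))"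
proof -
  interpret group_action "Aut L M" "dom M" "\<lambda>g. g" by (rule group_action_Aut)
  interpret group "Aut L M" by (rule group_Aut)
  obtain K where K: "finite K" "K \<subseteq> tuples (dom M) n"
    "\<And>xs. xs \<in> tuples (dom M) n \<Longrightarrow> \<exists>ys\<in>K. \<exists>h. isomorphism L M M h \<and> xs = map h ys"
    using assms unfolding oligomorphic_def by metis
  let ?orb = "orbit (Aut L M) (diagonal (\<lambda>g. g))"
  have "?orb xs \<in> ?orb ` K" if xs: "xs \<in> tuples (dom M) n" for xs
  proof -
    obtain ys h where ys: "ys \<in> K" "isomorphism L M M h" "xs = map h ys"
      using K(3)[OF xs] by blast
    let ?h = "restrict h (dom M)"
    have h: "?h \<in> carrier (Aut L M)"
      using isomorphism_restrict[OF ys(2)] by (simp add: carrier_Aut)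
    have sub: "set ys \<subseteq> dom M"
      using ys(1) K(2) by (auto simp: tuples_def)
    then have xs_eq: "xs = map ?h ys"
      using ys(3) by (auto simp: subset_iff)
    have "?orb xs = ?orb ys"
    proof (intro equalityI subsetI)
      fix zs assume "zs \<in> ?orb xs"
      then obtain g where g: "g \<in> carrier (Aut L M)" "zs = map g xs"
        by (auto simp: orbit_def diagonal_def)
      have "zs = map (g \<otimes>\<^bsub>Aut L M\<^esub> ?h) ys"
        using g h sub composition_rule[OF _ g(1) h] by (auto simp: xs_eq subset_iff)
      then show "zs \<in> ?orb ys"
        using g(1) h by (auto simp: orbit_def diagonal_def)
    next
      fix zs assume "zs \<in> ?orb ys"
      then obtain g where g: "g \<in> carrier (Aut L M)" "zs = map g ys"
        by (auto simp: orbit_def diagonal_def)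
      let ?k = "g \<otimes>\<^bsub>Aut L M\<^esub> inv\<^bsub>Aut L M\<^esub> ?h"
      have "?k (?h y) = g y" if y: "y \<in> dom M" for y
        using composition_rule[OF element_image[OF h y refl] g(1) inv_closed[OF h]]
          orbit_sym_aux[OF h y refl] by simp
      then have "zs = map ?k xs"
        using g(2) sub unfolding xs_eq by (auto simp del: restrict_apply simp: subset_iff)
      then show "zs \<in> ?orb xs"
        using g(1) h by (auto simp: orbit_def diagonal_def)
    qed
    then show ?thesis using ys(1) by blast
  qed
  then have "orbits (Aut L M) (tuples (dom M) n) (diagonal (\<lambda>g. g)) \<subseteq> ?orb ` K"
    by (auto simp: orbits_def)
  then show ?thesis
    using K(1) finite_subset by blast
qed

text \<open>
  Each of the finitely many orbits of the full group splits into finitely many orbits of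
  \<open>H\<close>, and every orbit of \<open>H\<close> occurs in this way because orbits of
  \<open>H\<close> are disjoint or equal.
\<close>

lemma finite_orbits_co_precompact:
  assumes olig: "oligomorphic L M" and H: "subgroup H (Aut L M)" and co: "co_precompact L M H"
  shows "finite (orbits (subgroup_as_group (Aut L M) H) (tuples (dom M) n) (diagonal (\<lambda>g. g)))"
    (is "finite ?orbH")
proof -
  interpret group_action "Aut L M" "dom M" "\<lambda>g. g" by (rule group_action_Aut)
  interpret group "Aut L M" by (rule group_Aut)
  have HG: "H \<subseteq> carrier (Aut L M)"
    using subgroup.subset[OF H] .
  let ?orb = "orbit (subgroup_as_group (Aut L M) H) (diagonal (\<lambda>g. g))"
  let ?orbits = "orbits (Aut L M) (tuples (dom M) n) (diagonal (\<lambda>g. g))"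
  have "\<forall>\<Omega>\<in>?orbits. \<exists>F. finite F \<and> F \<subseteq> ?orbH \<and> \<Omega> = \<Union>F"
    using co unfolding co_precompact_def by blast
  then obtain F where F: "\<And>\<Omega>. \<Omega> \<in> ?orbits \<Longrightarrow> finite (F \<Omega>) \<and> F \<Omega> \<subseteq> ?orbH \<and> \<Omega> = \<Union>(F \<Omega>)"
    by metis
  have same: "?orb xs = ?orb ys" if ys: "ys \<in> tuples (dom M) n" and xs: "xs \<in> ?orb ys" for xs ys
  proof -
    obtain h where h: "h \<in> H" "xs = map h ys"
      using xs by (auto simp: orbit_def diagonal_def)
    have hG: "h \<in> carrier (Aut L M)" using h(1) HG by blast
    have sub: "set ys \<subseteq> dom M" using ys by (simp add: tuples_def)
    show ?thesis
    proof (intro equalityI subsetI)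
      fix zs assume "zs \<in> ?orb xs"
      then obtain g where g: "g \<in> H" "zs = map g xs"
        by (auto simp: orbit_def diagonal_def)
      have "zs = map (g \<otimes>\<^bsub>Aut L M\<^esub> h) ys"
        using g h(2) sub composition_rule[OF _ _ hG, of _ g] HG by (auto simp: subset_iff)
      moreover have "g \<otimes>\<^bsub>Aut L M\<^esub> h \<in> H"
        using subgroup.m_closed[OF H g(1) h(1)] .
      ultimately show "zs \<in> ?orb ys"
        by (auto simp: orbit_def diagonal_def)
    next
      fix zs assume "zs \<in> ?orb ys"
      then obtain g where g: "g \<in> H" "zs = map g ys"
        by (auto simp: orbit_def diagonal_def)
      have gG: "g \<in> carrier (Aut L M)" using g(1) HG by blast
      let ?k = "g \<otimes>\<^bsub>Aut L M\<^esub> inv\<^bsub>Aut L M\<^esub> h"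
      have "?k (h y) = g y" if y: "y \<in> dom M" for y
        using composition_rule[OF element_image[OF hG y refl] gG inv_closed[OF hG]]
          orbit_sym_aux[OF hG y refl] by simp
      then have "zs = map ?k xs"
        using g(2) h(2) sub by (auto simp: subset_iff)
      moreover have "?k \<in> H"
        using subgroup.m_closed[OF H g(1) subgroup.m_inv_closed[OF H h(1)]] .
      ultimately show "zs \<in> ?orb xs"
        by (auto simp: orbit_def diagonal_def)
    qed
  qed
  have one: "xs = diagonal (\<lambda>g. g) \<one>\<^bsub>Aut L M\<^esub> xs" if "xs \<in> tuples (dom M) n" for xs
  proof -
    have "\<one>\<^bsub>Aut L M\<^esub> = (\<lambda>x\<in>dom M. x)"
      by (simp add: Aut_def BijGroup_def)
    then show ?thesis
      using that by (auto simp: diagonal_def tuples_def subset_iff intro!: map_idI[symmetric])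
  qed
  have "?orbH \<subseteq> \<Union>(F ` ?orbits)"
  proof
    fix \<Omega> assume "\<Omega> \<in> ?orbH"
    then obtain xs where xs: "xs \<in> tuples (dom M) n" "\<Omega> = ?orb xs"
      by (auto simp: orbits_def)
    let ?\<Omega> = "orbit (Aut L M) (diagonal (\<lambda>g. g)) xs"
    have \<Omega>: "?\<Omega> \<in> ?orbits"
      using xs(1) by (auto simp: orbits_def)
    have "xs \<in> ?\<Omega>"
      using one[OF xs(1)] one_closed unfolding orbit_def by blast
    then obtain \<Omega>' where \<Omega>': "\<Omega>' \<in> F ?\<Omega>" "xs \<in> \<Omega>'"
      using F[OF \<Omega>] by blast
    then obtain ys where "ys \<in> tuples (dom M) n" "\<Omega>' = ?orb ys"
      using F[OF \<Omega>] by (auto simp: orbits_def)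
    then have "\<Omega>' = \<Omega>"
      using same \<Omega>'(2) xs(2) by simp
    then show "\<Omega> \<in> \<Union>(F ` ?orbits)"
      using \<Omega>'(1) \<Omega> by blast
  qed
  moreover have "finite (\<Union>(F ` ?orbits))"
    using finite_orbits_Aut[OF olig] F by (intro finite_UN_I) auto
  ultimately show ?thesis
    by (rule finite_subset)
qed

end

section \<open>Amenable subgroups and orbits on pairs\<close>

definition graph_language :: "(nat, nat) language" where
  "graph_language = \<lparr>funs = {}, fun_arity = (\<lambda>_. 0), rels = {0}, rel_arity = (\<lambda>_. 2)\<rparr>"

definition graph_structure :: "nat set set \<Rightarrow> (nat, nat, nat) struc" where
  "graph_structure E = \<lparr>dom = UNIV, fun_interp = (\<lambda>_ _. 0), rel_interp = (\<lambda>_ xs. {xs ! 0, xs ! 1} \<in> E)\<rparr>"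

lemma isomorphism_graph_structure:
  "isomorphism graph_language (graph_structure E) (graph_structure E) h \<longleftrightarrow>
     bij h \<and> (\<forall>x y. {h x, h y} \<in> E \<longleftrightarrow> {x, y} \<in> E)"
proof -
  have "(\<forall>xs\<in>tuples UNIV 2. {xs ! 0, xs ! 1} \<in> E \<longleftrightarrow> {map h xs ! 0, map h xs ! 1} \<in> E) \<longleftrightarrow>
      (\<forall>x y. {h x, h y} \<in> E \<longleftrightarrow> {x, y} \<in> E)" (is "?l \<longleftrightarrow> ?r")
  proof
    assume l: ?l
    show ?r
    proof (intro allI)
      fix x y :: nat
      have "[x, y] \<in> tuples UNIV 2" by (simp add: tuples_def)
      with l have "{[x, y] ! 0, [x, y] ! 1} \<in> E \<longleftrightarrow> {map h [x, y] ! 0, map h [x, y] ! 1} \<in> E"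
        by blast
      then show "{h x, h y} \<in> E \<longleftrightarrow> {x, y} \<in> E" by simp
    qed
  qed (simp add: tuples_def)
  then show ?thesis
    by (simp add: isomorphism_def graph_language_def graph_structure_def)
qed

text \<open>
  The generic graph as a structure whose only symbol is a binary relation. Its automorphism
  group acts on it continuously, the graph is 2-sparse with infinite valencies, and finitely
  many orbits on pairs contradict \<open>amenable_subgroup_infinite_orbits\<close>.
\<close>

theorem omega_categorical_without_amenable_subgroup:
  "\<exists>(L :: (nat, nat) language) (M :: (nat, nat, nat) struc).
     countable_omega_categorical L M \<and>
     \<not> (\<exists>H. subgroup H (Aut L M) \<and> co_precompact L M H \<and>
            amenable (subgroup_as_group (Aut L M) H) (subtopology (pointwise_topology L M) H))"
proof -
  obtain E where E: "generic E"
    using generic_exists by blast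
  let ?L = graph_language and ?M = "graph_structure E"
  have dom: "dom ?M = UNIV"
    by (simp add: graph_structure_def)
  have struc: "is_structure ?L ?M"
    by (simp add: is_structure_def graph_language_def graph_structure_def)
  interpret fo_structure ?L ?M
    by unfold_locales (rule struc)
  have olig: "oligomorphic ?L ?M"
    unfolding oligomorphic_def
  proof
    fix n
    obtain K where K: "finite K" "\<forall>ys\<in>K. length ys = n"
      "\<And>xs. length xs = n \<Longrightarrow> \<exists>ys\<in>K. \<exists>h. bij h \<and> (\<forall>X. X \<in> E \<longleftrightarrow> h ` X \<in> E) \<and> xs = map h ys"
      using generic_oligomorphic[OF E, of n] by blast
    have iso: "isomorphism ?L ?M ?M h" if h: "bij h" "\<forall>X. X \<in> E \<longleftrightarrow> h ` X \<in> E" for h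
    proof -
      have "{h x, h y} \<in> E \<longleftrightarrow> {x, y} \<in> E" for x y
        using h(2)[rule_format, of "{x, y}"] by simp
      then show ?thesis
        using h(1) by (simp add: isomorphism_graph_structure)
    qed
    have "\<exists>ys\<in>K. \<exists>h. isomorphism ?L ?M ?M h \<and> xs = map h ys" if xs: "xs \<in> tuples (dom ?M) n" for xs
    proof -
      have "length xs = n"
        using xs by (simp add: tuples_def)
      from K(3)[OF this] show ?thesis
        using iso by blast
    qed
    moreover have "K \<subseteq> tuples (dom ?M) n"
      using K(2) by (auto simp: tuples_def dom)
    ultimately show "\<exists>K. finite K \<and> K \<subseteq> tuples (dom ?M) n \<and>
        (\<forall>xs\<in>tuples (dom ?M) n. \<exists>ys\<in>K. \<exists>h. isomorphism ?L ?M ?M h \<and> xs = map h ys)"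
      using K(1) by blast
  qed
  have "countable_omega_categorical ?L ?M"
    by (rule oligomorphic_imp_omega_categorical[OF struc _ _ olig]) (simp_all add: dom)
  moreover have False
    if H: "subgroup H (Aut ?L ?M)" "co_precompact ?L ?M H"
      "amenable (subgroup_as_group (Aut ?L ?M) H) (subtopology (pointwise_topology ?L ?M) H)" for H
  proof -
    have graph: "simple_graph (dom ?M) E"
      using E by (simp add: simple_graph_def generic_def dom)
    have sparse: "k_sparse 2 (dom ?M) E"
      unfolding k_sparse_def using generic_sparse[OF E] finite_edges_within by blast
    have valency: "\<forall>x\<in>dom ?M. infinite_valency E x"
      using generic_infinite_valency[OF E] by (simp add: infinite_valency_def)
    have acts: "acts_on_graph (Aut ?L ?M) (pointwise_topology ?L ?M) (dom ?M) E (\<lambda>g. g)"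
      by (rule acts_on_graph_Aut) (simp add: isomorphism_graph_structure)
    have "dom ?M \<noteq> {}"
      by (simp add: dom)
    from amenable_subgroup_infinite_orbits[OF this graph sparse valency topological_group_Aut acts H(1,3)]
    have "infinite (orbits (subgroup_as_group (Aut ?L ?M) H) (tuples (dom ?M) 2) (diagonal (\<lambda>g. g)))" .
    then show False
      using finite_orbits_co_precompact[OF olig H(1,2)] by blast
  qed
  ultimately show ?thesis by blast
qed

theorem corollary3p11:
  shows "(\<forall>(k :: nat) (V :: 'v set) (E :: 'v set set)
            (G :: ('g, 'b) monoid_scheme) (T :: 'g topology) (act :: 'g \<Rightarrow> 'v \<Rightarrow> 'v) (H :: 'g set).
            V \<noteq> {} \<and> simple_graph V E \<and> k_sparse k V E \<and> (\<forall>x\<in>V. infinite_valency E x) \<and>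
            topological_group G T \<and> acts_on_graph G T V E act \<and>
            subgroup H G \<and> amenable (subgroup_as_group G H) (subtopology T H)
            \<longrightarrow> infinite (orbits (subgroup_as_group G H) (tuples V 2) (diagonal act)))
       \<and> (\<exists>(L :: (nat, nat) language) (M :: (nat, nat, nat) struc).
            countable_omega_categorical L M \<and>
            \<not> (\<exists>H. subgroup H (Aut L M) \<and> co_precompact L M H \<and>
                   amenable (subgroup_as_group (Aut L M) H)
                     (subtopology (pointwise_topology L M) H)))"
proof (intro conjI allI impI omega_categorical_without_amenable_subgroup, elim conjE)
  fix k and V :: "'v set" and E :: "'v set set" and G :: "('g, 'b) monoid_scheme"
    and T :: "'g topology" and act :: "'g \<Rightarrow> 'v \<Rightarrow> 'v" and H :: "'g set"
  assume "V \<noteq> {}" "simple_graph V E" "k_sparse k V E" "\<forall>x\<in>V. infinite_valency E x"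
    "topological_group G T" "acts_on_graph G T V E act"
    "subgroup H G" "amenable (subgroup_as_group G H) (subtopology T H)"
  then show "infinite (orbits (subgroup_as_group G H) (tuples V 2) (diagonal act))"
    by (rule amenable_subgroup_infinite_orbits)
qed

end
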